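(* For every even integer $n\geq 8$, $R(S_n(1,2),W_8)=R(S_n(2,1),W_8)=R(S_n(3),W_8)=2n$.
   Context: All graphs are finite, simple, undirected. For graphs $G,H$, the Ramsey number $R(G,H)$ is the smallest positive integer $N$ such that for every graph $F$ on $N$ vertices, either $F$ contains a subgraph isomorphic to $G$ or the complement $\overline{F}$ contains a subgraph isomorphic to $H$. $W_8$ is the wheel on 9 vertices: a cycle $C_8$ plus one vertex adjacent to all its vertices. $S_k$ denotes the star on $k$ vertices. $S_n(l,s)$ denotes the tree of order $n$ obtained from the star $S_{n-sl}$ by subdividing each of $l$ chosen edges $s$ times. $S_n(3)$ denotes the tree of order $n$ obtained from the stars $S_3$ (path on 3 vertices, center the middle vertex) and $S_{n-3}$ by adding an edge joining their centers. *)

theory Defs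
  imports Main "HOL-Library.Ramsey"
begin

type_synonym 'a graph = "'a set \<times> 'a set set"

abbreviation verts :: "'a graph \<Rightarrow> 'a set" where
  "verts \<equiv> fst"

abbreviation edges :: "'a graph \<Rightarrow> 'a set set" where
  "edges \<equiv> snd"

definition is_graph :: "'a graph \<Rightarrow> bool" where
  "is_graph G \<longleftrightarrow> finite (verts G) \<and> edges G \<subseteq> [verts G]\<^bsup>2\<^esup>"

definition complement :: "'a graph \<Rightarrow> 'a graph" where
  "complement G = (verts G, [verts G]\<^bsup>2\<^esup> - edges G)"

definition subgraph :: "'a graph \<Rightarrow> 'a graph \<Rightarrow> bool" where
  "subgraph H G \<longleftrightarrow> is_graph H \<and> verts H \<subseteq> verts G \<and> edges H \<subseteq> edges G"

definition isomorphic :: "'a graph \<Rightarrow> 'b graph \<Rightarrow> bool" where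
  "isomorphic G H \<longleftrightarrow> (\<exists>f. bij_betw f (verts G) (verts H) \<and>
     (\<forall>u\<in>verts G. \<forall>v\<in>verts G. {u, v} \<in> edges G \<longleftrightarrow> {f u, f v} \<in> edges H))"

definition contains :: "'a graph \<Rightarrow> 'b graph \<Rightarrow> bool" where
  "contains F G \<longleftrightarrow> (\<exists>K. subgraph K F \<and> isomorphic K G)"

text \<open>The graphs \<open>F\<close> range over graphs with vertices in \<^typ>\<open>nat\<close> only; this loses nothing,
  see \<open>arrows_any_type\<close>. The minimum in \<open>ramsey_number\<close> is attained, see \<open>arrows_exists\<close>.\<close>

definition arrows :: "nat \<Rightarrow> 'a graph \<Rightarrow> 'b graph \<Rightarrow> bool" where
  "arrows N G H \<longleftrightarrow> (\<forall>F :: nat graph. is_graph F \<and> card (verts F) = N \<longrightarrow>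
     contains F G \<or> contains (complement F) H)"

definition ramsey_number :: "'a graph \<Rightarrow> 'b graph \<Rightarrow> nat" where
  "ramsey_number G H = (LEAST N. 0 < N \<and> arrows N G H)"

definition cycle_graph :: "nat \<Rightarrow> nat graph" where
  "cycle_graph m = ({..<m}, {{i, Suc i mod m} | i. i < m})"

text \<open>\<open>wheel m\<close> has \<open>m + 1\<close> vertices: the index is the length of the rim, and vertex \<open>m\<close> is the hub.\<close>

definition wheel :: "nat \<Rightarrow> nat graph" where
  "wheel m = (insert m (verts (cycle_graph m)),
              edges (cycle_graph m) \<union> {{m, i} | i. i \<in> verts (cycle_graph m)})"

definition star :: "'a \<Rightarrow> 'a set \<Rightarrow> 'a graph" where
  "star c L = (insert c L, {{c, x} | x. x \<in> L})"

text \<open>\<open>subdivide_edge u v ws G\<close> replaces the edge \<open>uv\<close> of \<open>G\<close> by the path from \<open>u\<close> to \<open>v\<close>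
  whose inner vertices are \<open>ws\<close>; that is, \<open>uv\<close> is subdivided \<open>length ws\<close> times. The vertices
  \<open>ws\<close> are meant to be distinct and not in \<open>G\<close>.\<close>

definition path_edges :: "'a list \<Rightarrow> 'a set set" where
  "path_edges xs = {{xs ! i, xs ! Suc i} | i. Suc i < length xs}"

definition subdivide_edge :: "'a \<Rightarrow> 'a \<Rightarrow> 'a list \<Rightarrow> 'a graph \<Rightarrow> 'a graph" where
  "subdivide_edge u v ws G =
     (verts G \<union> set ws, (edges G - {{u, v}}) \<union> path_edges (u # ws @ [v]))"

text \<open>\<open>subdivided_star k s l\<close>: the star on \<open>k\<close> vertices with centre \<open>0\<close> and leaves
  \<open>1, \<dots>, k - 1\<close>, the edges from \<open>0\<close> to \<open>1, \<dots>, l\<close> being subdivided \<open>s\<close> times each (\<open>l < k\<close>).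
  The new vertices are \<open>k, \<dots>, k + l * s - 1\<close>.\<close>

primrec subdivided_star :: "nat \<Rightarrow> nat \<Rightarrow> nat \<Rightarrow> nat graph" where
  "subdivided_star k s 0 = star 0 {1..<k}"
| "subdivided_star k s (Suc l) =
     subdivide_edge 0 (Suc l) [k + l * s..<k + Suc l * s] (subdivided_star k s l)"

definition S_sub :: "nat \<Rightarrow> nat \<Rightarrow> nat \<Rightarrow> nat graph" where
  "S_sub n l s = subdivided_star (n - s * l) s l"

text \<open>\<open>S_join n m\<close>: the disjoint union of the stars on \<open>n - m\<close> and on \<open>m\<close> vertices, together
  with an edge between their centres \<open>0\<close> and \<open>n - m\<close> (\<open>0 < m < n\<close>).\<close>

definition S_join :: "nat \<Rightarrow> nat \<Rightarrow> nat graph" where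
  "S_join n m =
     (let A = star 0 {1..<n - m}; B = star (n - m) {Suc (n - m)..<n}
      in (verts A \<union> verts B, edges A \<union> edges B \<union> {{0, n - m}}))"


lemma contains_iff_embedding:
  assumes "is_graph G"
  shows "contains F G \<longleftrightarrow>
    (\<exists>f. inj_on f (verts G) \<and> f ` verts G \<subseteq> verts F \<and> (\<forall>e\<in>edges G. f ` e \<in> edges F))"
    (is "_ \<longleftrightarrow> (\<exists>f. ?emb f)")
proof
  assume "contains F G"
  then obtain K g where K: "subgraph K F" and g: "bij_betw g (verts K) (verts G)"
    and ge: "\<forall>u\<in>verts K. \<forall>v\<in>verts K. {u, v} \<in> edges K \<longleftrightarrow> {g u, g v} \<in> edges G"
    unfolding contains_def isomorphic_def by blast
  define f where "f = the_inv_into (verts K) g"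
  have f: "bij_betw f (verts G) (verts K)"
    unfolding f_def by (rule bij_betw_the_inv_into[OF g])
  have gf: "g (f x) = x" if "x \<in> verts G" for x
    unfolding f_def using g that by (metis bij_betw_def f_the_inv_into_f)
  have "f ` e \<in> edges F" if "e \<in> edges G" for e
  proof -
    from that assms obtain x y where e: "e = {x, y}" "x \<in> verts G" "y \<in> verts G"
      unfolding is_graph_def by (meson nsets2_E subsetD)
    then have "f x \<in> verts K" "f y \<in> verts K" using f by (auto simp: bij_betw_def)
    then have "{f x, f y} \<in> edges K" using ge gf e that by auto
    then show ?thesis using K e by (auto simp: subgraph_def)
  qed
  moreover have "inj_on f (verts G)" "f ` verts G \<subseteq> verts F"
    using f K by (auto simp: bij_betw_def subgraph_def)
  ultimately show "\<exists>f. ?emb f" by blast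
next
  assume "\<exists>f. ?emb f"
  then obtain f where f: "inj_on f (verts G)" "f ` verts G \<subseteq> verts F"
    and fe: "\<forall>e\<in>edges G. f ` e \<in> edges F" by blast
  define K where "K = (f ` verts G, (`) f ` edges G)"
  have sub: "e \<subseteq> verts G" if "e \<in> edges G" for e
    using that assms by (auto simp: is_graph_def nsets_def)
  have "edges K \<subseteq> [verts K]\<^bsup>2\<^esup>"
  proof
    fix d assume "d \<in> edges K"
    then obtain e where e: "e \<in> edges G" "d = f ` e" by (auto simp: K_def)
    then have "e \<in> [verts G]\<^bsup>2\<^esup>" using assms by (auto simp: is_graph_def)
    then obtain x y where "e = {x, y}" "x \<in> verts G" "y \<in> verts G" "x \<noteq> y"
      by (rule nsets2_E)
    then show "d \<in> [verts K]\<^bsup>2\<^esup>" using e f by (auto simp: K_def dest: inj_onD)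
  qed
  then have "subgraph K F"
    using assms f fe by (auto simp: subgraph_def is_graph_def K_def)
  moreover have "isomorphic K G"
  proof -
    define g where "g = the_inv_into (verts G) f"
    have g: "bij_betw g (verts K) (verts G)"
      using f unfolding g_def K_def by (simp add: bij_betw_the_inv_into inj_on_imp_bij_betw)
    have gf: "g (f x) = x" if "x \<in> verts G" for x
      unfolding g_def using f that by (simp add: the_inv_into_f_f)
    have "{f x, f y} \<in> edges K \<longleftrightarrow> {x, y} \<in> edges G"
      if "x \<in> verts G" "y \<in> verts G" for x y
    proof
      assume "{f x, f y} \<in> edges K"
      then obtain e where e: "e \<in> edges G" "f ` {x, y} = f ` e" by (auto simp: K_def)
      then have "{x, y} = e" using sub[OF e(1)] that f(1)
        by (metis empty_subsetI inj_on_image_eq_iff insert_subset)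
      then show "{x, y} \<in> edges G" using e by simp
    next
      assume "{x, y} \<in> edges G"
      then have "f ` {x, y} \<in> edges K" unfolding K_def by (metis image_eqI snd_conv)
      then show "{f x, f y} \<in> edges K" by simp
    qed
    then have "\<forall>u\<in>verts K. \<forall>v\<in>verts K. {u, v} \<in> edges K \<longleftrightarrow> {g u, g v} \<in> edges G"
      by (auto simp: K_def gf)
    with g show ?thesis unfolding isomorphic_def by blast
  qed
  ultimately show "contains F G" unfolding contains_def by blast
qed

lemma arrows_any_type:
  fixes F :: "'c graph"
  assumes G: "is_graph G" and H: "is_graph H" and ar: "arrows N G H"
    and F: "is_graph F" "card (verts F) = N"
  shows "contains F G \<or> contains (complement F) H"
proof -
  have "finite (verts F)" using F by (simp add: is_graph_def)
  then obtain h :: "nat \<Rightarrow> 'c" where h: "bij_betw h {..<N} (verts F)"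
    using ex_bij_betw_nat_finite[of "verts F"] F(2) by (auto simp: atLeast0LessThan)
  define F' :: "nat graph" where "F' = ({..<N}, {e \<in> [{..<N}]\<^bsup>2\<^esup>. h ` e \<in> edges F})"
  have F': "is_graph F'" "card (verts F') = N" unfolding F'_def is_graph_def by (simp_all add: subset_iff)
  have transfer: "contains K' J" if "is_graph J" "contains K J" "verts K \<subseteq> {..<N}"
    "verts K' = verts F" "\<And>e. e \<in> edges K \<Longrightarrow> h ` e \<in> edges K'"
    for J :: "'z graph" and K :: "nat graph" and K' :: "'c graph"
  proof -
    from that obtain f where f: "inj_on f (verts J)" "f ` verts J \<subseteq> verts K"
      "\<forall>e\<in>edges J. f ` e \<in> edges K" by (auto simp: contains_iff_embedding)
    have "inj_on (h \<circ> f) (verts J)"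
      using f that(3) h by (meson bij_betw_def comp_inj_on inj_on_subset order_trans)
    moreover have "(h \<circ> f) ` verts J \<subseteq> verts K'"
    proof -
      have "f ` verts J \<subseteq> {..<N}" using f(2) that(3) by (rule order_trans)
      then have "h ` f ` verts J \<subseteq> h ` {..<N}" by (rule image_mono)
      then show ?thesis using that(4) h by (simp add: bij_betw_def image_comp)
    qed
    moreover have "\<forall>e\<in>edges J. (h \<circ> f) ` e \<in> edges K'"
      using f(3) that(5) by (simp add: image_comp[symmetric] del: o_apply)
    ultimately show ?thesis using that(1) contains_iff_embedding by blast
  qed
  from ar F' have "contains F' G \<or> contains (complement F') H" unfolding arrows_def by blast
  then show ?thesis
  proof
    assume "contains F' G"
    then have "contains F G" by (rule transfer[OF G]) (auto simp: F'_def)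
    then show ?thesis ..
  next
    assume *: "contains (complement F') H"
    have "contains (complement F) H"
    proof (rule transfer[OF H *])
      fix e assume e: "e \<in> edges (complement F')"
      then have "e \<in> [{..<N}]\<^bsup>2\<^esup>" by (auto simp: complement_def F'_def)
      then have "h ` e \<in> [verts F]\<^bsup>2\<^esup>"
        by (rule nsets2_E) (use h in \<open>auto simp: bij_betw_def dest: inj_onD\<close>)
      then show "h ` e \<in> edges (complement F)" using e
        by (auto simp: complement_def F'_def)
    qed (auto simp: complement_def F'_def)
    then show ?thesis ..
  qed
qed

lemma arrows_exists:
  fixes G :: "'a graph" and H :: "'b graph"
  assumes G: "is_graph G" and H: "is_graph H"
  shows "\<exists>N>0. arrows N G H"
proof -
  obtain r :: nat where r: "r \<ge> 1" and *: "\<forall>(V :: nat set) E. finite V \<and> card V \<ge> r \<longrightarrow>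
    (\<exists>R \<subseteq> V. card R = card (verts G) \<and> clique R E \<or> card R = card (verts H) \<and> indep R E)"
    using ramsey2 by blast
  have emb: "contains F J" if J: "is_graph J" and R: "R \<subseteq> verts F" "finite R" "card R = card (verts J)"
    and cl: "clique R (edges F)" for J :: "'z graph" and F :: "nat graph" and R
  proof -
    have "finite (verts J)" using J by (simp add: is_graph_def)
    then obtain f where f: "bij_betw f (verts J) R"
      using R by (metis finite_same_card_bij)
    have "f ` e \<in> edges F" if "e \<in> edges J" for e
    proof -
      have "e \<in> [verts J]\<^bsup>2\<^esup>" using J that by (auto simp: is_graph_def)
      then show ?thesis
        by (rule nsets2_E) (use f cl in \<open>auto simp: bij_betw_def clique_def inj_on_def\<close>)
    qed
    then show ?thesis using f R J by (auto simp: contains_iff_embedding bij_betw_def)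
  qed
  have "arrows r G H" unfolding arrows_def
  proof (intro allI impI)
    fix F :: "nat graph" assume F: "is_graph F \<and> card (verts F) = r"
    then have fin: "finite (verts F)" by (simp add: is_graph_def)
    then obtain R where R: "R \<subseteq> verts F"
      "card R = card (verts G) \<and> clique R (edges F) \<or> card R = card (verts H) \<and> indep R (edges F)"
      using * F by (metis order_refl)
    have Rfin: "finite R" using R fin finite_subset by blast
    from R(2) show "contains F G \<or> contains (complement F) H"
    proof
      assume "card R = card (verts G) \<and> clique R (edges F)"
      then show ?thesis using emb[OF G R(1) Rfin] by blast
    next
      assume r: "card R = card (verts H) \<and> indep R (edges F)"
      then have "clique R (edges (complement F))"
        using R(1) by (auto simp: clique_def indep_def complement_def)
      then show ?thesis using emb[OF H, of R "complement F"] R(1) Rfin r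
        by (auto simp: complement_def)
    qed
  qed
  with r show ?thesis by (metis Suc_le_eq One_nat_def)
qed

lemma ramsey_number_arrows:
  assumes "is_graph G" and "is_graph H"
  shows "0 < ramsey_number G H \<and> arrows (ramsey_number G H) G H"
  unfolding ramsey_number_def using arrows_exists[OF assms] by (rule LeastI_ex)

lemma is_graph_wheel:
  assumes "3 \<le> m"
  shows "is_graph (wheel m)" and "card (verts (wheel m)) = m + 1"
proof -
  have "Suc i mod m \<noteq> i" "Suc i mod m < m" if "i < m" for i
    using that assms by (auto simp: mod_Suc)
  then show "is_graph (wheel m)"
    by (force simp: is_graph_def wheel_def cycle_graph_def)
  show "card (verts (wheel m)) = m + 1"
    by (simp add: wheel_def cycle_graph_def)
qed

lemma verts_subdivided_star:
  assumes "0 < k"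
  shows "verts (subdivided_star k s l) = {..<k + l * s}"
proof (induction l)
  case 0
  show ?case using assms by (auto simp: star_def)
next
  case (Suc l)
  have "{..<k + l * s} \<union> {k + l * s..<k + Suc l * s} = {..<k + Suc l * s}"
    by (rule ivl_disj_un_one(2)) simp
  then show ?case by (simp only: subdivided_star.simps subdivide_edge_def fst_conv Suc.IH set_upt)
qed

lemma is_graph_subdivided_star:
  assumes "l < k"
  shows "is_graph (subdivided_star k s l)"
  using assms
proof (induction l)
  case 0
  then show ?case by (auto simp: is_graph_def star_def)
next
  case (Suc l)
  let ?ws = "[k + l * s..<k + Suc l * s]"
  let ?xs = "0 # ?ws @ [Suc l]"
  have d: "distinct ?xs" using Suc.prems by auto
  have sub: "set ?xs \<subseteq> {..<k + Suc l * s}" using Suc.prems by auto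
  have "path_edges ?xs \<subseteq> [{..<k + Suc l * s}]\<^bsup>2\<^esup>"
  proof
    fix e assume "e \<in> path_edges ?xs"
    then obtain i where i: "Suc i < length ?xs" "e = {?xs ! i, ?xs ! Suc i}"
      unfolding path_edges_def by blast
    then have "?xs ! i \<noteq> ?xs ! Suc i" using d by (metis Suc_lessD n_not_Suc_n nth_eq_iff_index_eq)
    moreover have "?xs ! i \<in> {..<k + Suc l * s}" "?xs ! Suc i \<in> {..<k + Suc l * s}"
      using sub i(1) by (meson Suc_lessD nth_mem subsetD)+
    ultimately show "e \<in> [{..<k + Suc l * s}]\<^bsup>2\<^esup>" using i(2) by simp
  qed
  moreover have "edges (subdivided_star k s l) \<subseteq> [{..<k + Suc l * s}]\<^bsup>2\<^esup>"
  proof -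
    have "edges (subdivided_star k s l) \<subseteq> [{..<k + l * s}]\<^bsup>2\<^esup>"
      using Suc verts_subdivided_star[of k s l] by (simp add: is_graph_def)
    also have "\<dots> \<subseteq> [{..<k + Suc l * s}]\<^bsup>2\<^esup>" by (rule nsets_mono) auto
    finally show ?thesis .
  qed
  moreover have "verts (subdivided_star k s (Suc l)) = {..<k + Suc l * s}"
    using Suc.prems by (intro verts_subdivided_star) simp
  moreover have "edges (subdivided_star k s (Suc l))
      \<subseteq> edges (subdivided_star k s l) \<union> path_edges ?xs"
    by (auto simp: subdivide_edge_def)
  ultimately show ?case unfolding is_graph_def by auto
qed

lemma is_graph_S_sub:
  assumes "l + s * l < n"
  shows "is_graph (S_sub n l s)" and "card (verts (S_sub n l s)) = n"
proof -
  from assms show "is_graph (S_sub n l s)"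
    unfolding S_sub_def by (intro is_graph_subdivided_star) simp
  from assms show "card (verts (S_sub n l s)) = n"
    by (simp add: S_sub_def verts_subdivided_star mult.commute)
qed

lemma is_graph_S_join:
  assumes "0 < m" and "m < n"
  shows "is_graph (S_join n m)" and "card (verts (S_join n m)) = n"
proof -
  have v: "verts (S_join n m) = {..<n}"
    using assms by (auto simp: S_join_def star_def Let_def)
  then show "card (verts (S_join n m)) = n" by simp
  show "is_graph (S_join n m)"
    unfolding is_graph_def v using assms by (auto simp: S_join_def star_def Let_def)
qed

end

theory Submission
  imports Defs
begin

text \<open>Let \<open>G\<close> have \<open>2n\<close> vertices and suppose that its complement has no \<open>W\<^sub>8\<close>.

Some vertex of \<open>G\<close> has degree at least \<open>n - 3\<close>. Otherwise the complement has minimum degree at least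
\<open>n + 3\<close>. For an edge \<open>uv\<close> of the complement with common neighbourhood \<open>C\<close> of size \<open>k\<close>, a path on seven
vertices with both ends in \<open>C\<close> inside the neighbourhood of \<open>v\<close> would close through \<open>u\<close> to an 8-cycle;
an Erdos--Gallai type bound for graphs without such paths yields \<open>(k - 6)(n + 2 - k) \<le> 0\<close>. If \<open>k = 6\<close>
for all edges, then a neighbour of \<open>v\<close> is joined to every non-neighbour of \<open>v\<close>, and if \<open>k \<ge> n + 2\<close>, then
each vertex of \<open>C\<close> is joined to everything outside \<open>C\<close>; both produce a wheel whose rim alternates.

Around a vertex \<open>v\<close> of degree at least \<open>n - 3\<close>, the absence of the tree forces the neighbourhood of \<open>v\<close> to
be almost completely joined, in the complement, to the remaining vertices. Without a wheel both sides
have maximum degree at most 3 in the complement, so the side with more than \<open>n\<close> vertices is nearly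
complete in \<open>G\<close> and contains the tree.

For the lower bound, take the union of \<open>K\<^bsub>n-1\<^esub>\<close> and of the complement of a cubic graph on \<open>n\<close> vertices
all of whose components are \<open>K\<^sub>4\<close> or \<open>K\<^bsub>3,3\<^esub>\<close>.\<close>

section \<open>Graphs without anchored paths on seven vertices\<close>

text \<open>Each of the three trees has a centre of degree \<open>n - 3\<close>. On
  \<open>2 * n\<close> vertices a degree of at most \<open>n - 4\<close> means complement degree at
  least \<open>n + 3\<close>, and this is the origin of both constants. Adjacent vertices of the
  complement then have at least \<open>2 * (n + 3) - 2 * n = 6\<close> common neighbours, so the
  quadratic inequality for \<open>k\<close> has no slack and leaves only its two extremes.

  The path bound allots 5 to a vertex of \<open>C\<close>, the inner degree in a complete graph on
  six vertices, and 6 to a vertex of \<open>X\<close>, three edges counted at both ends. Edges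
  inside \<open>X\<close> can be discarded because only the degrees of vertices of \<open>C\<close>
  enter the count; once \<open>X\<close> is independent, every neighbour of a vertex of
  \<open>X\<close> can serve as an anchor.

  Parity acts in both directions. A cubic complement on \<open>n\<close> vertices leaves all degrees
  at \<open>n - 4\<close>, one too few for a centre, and it exists because \<open>n\<close> is even.
  On \<open>n + 1\<close> vertices it cannot exist, so a side of that size offers a vertex of degree
  at least \<open>n - 2\<close>.\<close>

definition deg_in :: "('a \<Rightarrow> 'a \<Rightarrow> bool) \<Rightarrow> 'a set \<Rightarrow> 'a \<Rightarrow> nat" where
  "deg_in R S v = card {u \<in> S. R v u}"

lemma ex_nbr_outside:
  assumes "finite S" and "card T < deg_in R S v" and "finite T"
  obtains u where "u \<in> S" "R v u" "u \<notin> T"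
proof -
  have "\<not> {u \<in> S. R v u} \<subseteq> T"
    using assms card_mono[of T "{u \<in> S. R v u}"] by (auto simp: deg_in_def)
  then show ?thesis using that by blast
qed

lemma sum_deg_in_insert:
  assumes fin: "finite S" and v: "v \<notin> S" and sym: "\<And>x y. R x y \<Longrightarrow> R y x" and irr: "\<And>x. \<not> R x x"
  shows "(\<Sum>x\<in>insert v S. deg_in R (insert v S) x) = (\<Sum>x\<in>S. deg_in R S x) + 2 * deg_in R (insert v S) v"
proof -
  have 1: "deg_in R (insert v S) x = deg_in R S x + (if R v x then 1 else 0)" if "x \<in> S" for x
  proof (cases "R v x")
    case True
    then have "{u \<in> insert v S. R x u} = insert v {u \<in> S. R x u}" using sym by auto
    then show ?thesis using True fin v by (simp add: deg_in_def)
  next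
    case False
    then have "{u \<in> insert v S. R x u} = {u \<in> S. R x u}" using sym by auto
    then show ?thesis using False by (simp add: deg_in_def)
  qed
  have 2: "deg_in R (insert v S) v = (\<Sum>x\<in>S. if R v x then 1 else 0)"
  proof -
    have "{u \<in> insert v S. R v u} = {u \<in> S. R v u}" using irr by auto
    moreover have "S \<inter> Collect (R v) = {u \<in> S. R v u}" by auto
    ultimately show ?thesis using fin by (simp add: deg_in_def sum.If_cases)
  qed
  show ?thesis using fin v by (simp add: 1 2 sum.distrib mult_2)
qed

lemma deg_in_Un:
  assumes "finite S" "finite T" "S \<inter> T = {}"
  shows "deg_in R (S \<union> T) w = deg_in R S w + deg_in R T w"
proof -
  have "{u \<in> S \<union> T. R w u} = {u \<in> S. R w u} \<union> {u \<in> T. R w u}" by auto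
  then show ?thesis using assms by (simp add: deg_in_def card_Un_disjoint disjoint_iff)
qed

lemma sum_deg_in_swap:
  assumes "finite S" "finite T" and sym: "\<And>x y. R x y \<Longrightarrow> R y x"
  shows "(\<Sum>x\<in>S. deg_in R T x) = (\<Sum>y\<in>T. deg_in R S y)"
proof -
  have "(\<Sum>x\<in>S. deg_in R T x) = (\<Sum>y\<in>T. card {x \<in> S. R x y})"
    using sum.swap_restrict[OF assms(1,2), of "\<lambda>_ _. 1::nat" R] by (simp add: deg_in_def)
  also have "\<dots> = (\<Sum>y\<in>T. deg_in R S y)"
    unfolding deg_in_def using sym by (intro sum.cong refl arg_cong[of _ _ card]) blast
  finally show ?thesis .
qed

lemma even_sum_deg_in:
  assumes "finite S" and sym: "\<And>x y. R x y \<Longrightarrow> R y x" and irr: "\<And>x. \<not> R x x"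
  shows "even (\<Sum>x\<in>S. deg_in R S x)"
  using assms(1)
proof (induction S)
  case (insert v S)
  then show ?case using sum_deg_in_insert[of S v R, OF insert.hyps sym irr] by simp
qed simp

lemma sum_deg_in_Un:
  assumes fin: "finite S" "finite T" and disj: "S \<inter> T = {}"
    and sep: "\<And>x y. x \<in> S \<Longrightarrow> y \<in> T \<Longrightarrow> \<not> R x y \<and> \<not> R y x"
  shows "(\<Sum>x\<in>S \<union> T. deg_in R (S \<union> T) x) = (\<Sum>x\<in>S. deg_in R S x) + (\<Sum>x\<in>T. deg_in R T x)"
proof -
  have "{u \<in> S \<union> T. R x u} = {u \<in> S. R x u}" if "x \<in> S" for x using sep that by blast
  moreover have "{u \<in> S \<union> T. R x u} = {u \<in> T. R x u}" if "x \<in> T" for x using sep that by blast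
  ultimately show ?thesis using fin disj by (simp add: sum.union_disjoint deg_in_def)
qed

text \<open>In the application \<open>C\<close> is the common neighbourhood of an edge \<open>uv\<close>, and \<open>X\<close> consists of the other
  neighbours of \<open>v\<close>, with the edges inside \<open>X\<close> discarded.\<close>

locale anchored_graph =
  fixes R :: "'a \<Rightarrow> 'a \<Rightarrow> bool" and C X :: "'a set"
  assumes sym: "R x y \<Longrightarrow> R y x"
    and irr: "\<not> R x x"
    and finC: "finite C" and finX: "finite X" and disj: "C \<inter> X = {}"
    and indep: "x \<in> X \<Longrightarrow> y \<in> X \<Longrightarrow> \<not> R x y"
    and no_path7: "\<lbrakk>distinct [a,b,c,d,e,f,g]; {b,c,d,e,f} \<subseteq> C \<union> X; a \<in> C; g \<in> C;
      R a b; R b c; R c d; R d e; R e f; R f g\<rbrakk> \<Longrightarrow> False"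

text \<open>The thresholds are the ones below which \<open>sum_deg_le\<close> deletes a vertex:
  deleting degree at most 2 from \<open>C\<close> lowers the degree sum by at most 4, and deleting
  degree at most 3 from \<open>X\<close> lowers it by at most 6.\<close>

locale anchored_graph_mindeg = anchored_graph +
  assumes degC: "x \<in> C \<Longrightarrow> 3 \<le> deg_in R (C \<union> X) x"
    and degX: "x \<in> X \<Longrightarrow> 4 \<le> deg_in R (C \<union> X) x"
begin

lemma nbrC:
  assumes "x \<in> C"
  obtains u where "u \<in> C \<union> X" "R x u" "u \<noteq> s" "u \<noteq> t"
proof -
  have "card {s, t} < deg_in R (C \<union> X) x" using degC[OF assms] by (simp add: card_insert_if)
  then show ?thesis using ex_nbr_outside[of "C \<union> X" "{s,t}" R x] finC finX that by auto
qed

text \<open>All neighbours of a vertex of \<open>X\<close> lie in \<open>C\<close>, so one of at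
  least four survives any three exclusions and is a possible anchor.\<close>

lemma nbrX:
  assumes "x \<in> X"
  obtains u where "u \<in> C" "R x u" "u \<noteq> s" "u \<noteq> t" "u \<noteq> r"
proof -
  have "card {s, t, r} < deg_in R (C \<union> X) x" using degX[OF assms] by (simp add: card_insert_if)
  then obtain u where "u \<in> C \<union> X" "R x u" "u \<notin> {s,t,r}"
    using ex_nbr_outside[of "C \<union> X" "{s,t,r}" R x] finC finX by auto
  then show ?thesis using that indep assms by auto
qed

text \<open>A path on eight vertices whose second and second-last vertices lie in \<open>X\<close> has no anchored
  subpath on seven vertices. It is the one configuration that rotations do not shorten, hence the
  case analysis in the next lemmas.\<close>

lemma no_path8_C:
  assumes dist: "distinct [a,x,b,p,q,c,y,d]"
    and C: "a \<in> C" "b \<in> C" "p \<in> C" "q \<in> C" "c \<in> C" "d \<in> C" and X: "x \<in> X" "y \<in> X"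
    and E: "R a x" "R x b" "R b p" "R p q" "R q c" "R c y" "R y d"
  shows False
proof -
  note E' = E E[THEN sym]
  \<comment> \<open>The end \<open>d\<close> has a third neighbour besides \<open>y\<close> and
    possibly \<open>q\<close>. Wherever else on the path \<open>r\<close> might lie, it yields an
    anchored path on seven vertices; a new \<open>r\<close> in \<open>C\<close> does so too.\<close>
  obtain r where r: "r \<in> C \<union> X" "R d r" "r \<noteq> y" "r \<noteq> q" using nbrC[OF \<open>d \<in> C\<close>] .
  have rd: "R r d" "r \<noteq> d" using r sym irr by auto
  have "r \<noteq> c" using no_path7[of a x b p q c d] dist C X E' rd by auto
  moreover have "r \<noteq> p" using no_path7[of a x b p d y c] dist C X E' rd by auto
  moreover have "r \<noteq> b" using no_path7[of a x b d y c q] dist C X E' rd by auto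
  moreover have "r \<noteq> x" using no_path7[of a x d y c q p] dist C X E' rd by auto
  moreover have "r \<noteq> a" using no_path7[of b p q c y d a] dist C X E' r by auto
  ultimately have rn: "distinct [r,a,x,b,p,q,c,y,d]" using r rd dist by auto
  have "r \<notin> C" using no_path7[of b p q c y d r] rn C X E' r by auto
  then have "r \<in> X" using r by auto
  \<comment> \<open>Now \<open>r\<close> is new and in \<open>X\<close>. If \<open>s\<close> is new
    as well, then \<open>p q c y d r s\<close> is anchored; each old vertex still possible for
    \<open>s\<close> gives another such path.\<close>
  obtain s where s: "s \<in> C" "R r s" "s \<noteq> d" "s \<noteq> c" using nbrX[OF \<open>r \<in> X\<close>] by metis
  have sr: "R s r" "s \<noteq> r" using s sym irr by auto
  have sn: "s \<noteq> x" "s \<noteq> y" using s X disj by auto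
  have "s \<noteq> a" using no_path7[of a r d y c q p] rn C X E' r rd s sr \<open>r \<in> X\<close> by auto
  moreover have "s \<noteq> b" using no_path7[of a x b r d y c] rn C X E' r rd s sr \<open>r \<in> X\<close> by auto
  moreover have "s \<noteq> p" using no_path7[of b p r d y c q] rn C X E' r rd s sr \<open>r \<in> X\<close> by auto
  moreover have "s \<noteq> q" using no_path7[of a x b p q r d] rn C X E' r rd s sr \<open>r \<in> X\<close> by auto
  ultimately show False using no_path7[of p q c y d r s] rn C X E' r rd s sr sn \<open>r \<in> X\<close> by auto
qed

text \<open>The extension argument at \<open>d\<close> is that of \<open>no_path8_C\<close>. With
  \<open>q\<close> in \<open>X\<close>, a path ending in \<open>q\<close> is no longer anchored, so
  \<open>b\<close> joins \<open>q\<close> as a neighbour that cannot be ruled out.\<close>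

lemma path8_X_end:
  assumes dist: "distinct [a,x,b,p,q,c,y,d]"
    and C: "a \<in> C" "b \<in> C" "p \<in> C" "c \<in> C" "d \<in> C" and X: "x \<in> X" "y \<in> X" "q \<in> X"
    and E: "R a x" "R x b" "R b p" "R p q" "R q c" "R c y" "R y d"
    and r: "r \<in> C \<union> X" "R d r" "r \<noteq> y"
  shows "r = q \<or> r = b"
proof (rule ccontr)
  assume "\<not> (r = q \<or> r = b)"
  note E' = E E[THEN sym]
  have rd: "R r d" "r \<noteq> d" using r sym irr by auto
  have "r \<noteq> c" using no_path7[of a x b p q c d] dist C X E' rd by auto
  moreover have "r \<noteq> p" using no_path7[of a x b p d y c] dist C X E' rd by auto
  moreover have "r \<noteq> x" using no_path7[of a x d y c q p] dist C X E' rd by auto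
  moreover have "r \<noteq> a" using no_path7[of b p q c y d a] dist C X E' r by auto
  ultimately have rn: "distinct [r,a,x,b,p,q,c,y,d]"
    using r rd dist \<open>\<not> (r = q \<or> r = b)\<close> by auto
  have "r \<notin> C" using no_path7[of b p q c y d r] rn C X E' r by auto
  then have "r \<in> X" using r by auto
  obtain s where s: "s \<in> C" "R r s" "s \<noteq> d" "s \<noteq> c" "s \<noteq> p" using nbrX[OF \<open>r \<in> X\<close>] by metis
  have sr: "R s r" "s \<noteq> r" using s sym irr by auto
  have sn: "s \<noteq> x" "s \<noteq> y" "s \<noteq> q" using s X disj by auto
  have "s \<noteq> a" using no_path7[of a r d y c q p] rn C X E' r rd s sr \<open>r \<in> X\<close> by auto
  moreover have "s \<noteq> b" using no_path7[of a x b r d y c] rn C X E' r rd s sr \<open>r \<in> X\<close> by auto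
  ultimately show False using no_path7[of p q c y d r s] rn C X E' r rd s sr sn \<open>r \<in> X\<close> by auto
qed

text \<open>The end restriction holds for every neighbour of \<open>y\<close> in \<open>C\<close>
  off the rest of the path. Two such neighbours \<open>d\<close> and \<open>e\<close> therefore both
  see \<open>b\<close> and \<open>q\<close>, and \<open>p b d y e q c\<close> is anchored.\<close>

lemma no_path8_X:
  assumes dist: "distinct [a,x,b,p,q,c,y,d]"
    and C: "a \<in> C" "b \<in> C" "p \<in> C" "c \<in> C" "d \<in> C" and X: "x \<in> X" "y \<in> X" "q \<in> X"
    and E: "R a x" "R x b" "R b p" "R p q" "R q c" "R c y" "R y d"
  shows False
proof -
  note E' = E E[THEN sym]
  have end_nbrs: "R z q \<and> R z b" if "distinct [a,x,b,p,q,c,y,z]" "z \<in> C" "R y z" for z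
  proof
    note * = path8_X_end[OF that(1) C(1-4) that(2) X E(1-6) that(3)]
    obtain r where "r \<in> C \<union> X" "R z r" "r \<noteq> y" "r \<noteq> b" using nbrC[OF \<open>z \<in> C\<close>] .
    with *[of r] show "R z q" by auto
    obtain r where "r \<in> C \<union> X" "R z r" "r \<noteq> y" "r \<noteq> q" using nbrC[OF \<open>z \<in> C\<close>] .
    with *[of r] show "R z b" by auto
  qed
  obtain e where e: "e \<in> C" "R y e" "e \<noteq> c" "e \<noteq> d" "e \<noteq> p" using nbrX[OF \<open>y \<in> X\<close>] .
  have ey: "R e y" "e \<noteq> y" using e sym irr by auto
  have en: "e \<noteq> x" "e \<noteq> q" using e X disj by auto
  have "e \<noteq> a" using no_path7[of b x a y c q p] dist C X E' e ey by auto
  moreover have "e \<noteq> b" using no_path7[of a x b y c q p] dist C X E' e ey by auto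
  ultimately have dn: "distinct [a,x,b,p,q,c,y,d,e]" using dist e ey en by auto
  have "R d q" "R d b" "R e q" "R e b" using end_nbrs[of d] end_nbrs[of e] dn C E e by auto
  then show False using no_path7[of p b d y e q c] dn C X E' e ey sym by auto
qed

text \<open>Independence of \<open>X\<close> forces \<open>b\<close> and \<open>c\<close> into
  \<open>C\<close> and keeps \<open>p\<close> and \<open>q\<close> from both lying in
  \<open>X\<close>; reversing the path exchanges the two mixed cases.\<close>

lemma no_path8:
  assumes dist: "distinct [a,x,b,p,q,c,y,d]"
    and C: "a \<in> C" "d \<in> C" and X: "x \<in> X" "y \<in> X" and pq: "p \<in> C \<union> X" "q \<in> C \<union> X"
    and bc: "b \<in> C \<union> X" "c \<in> C \<union> X"
    and E: "R a x" "R x b" "R b p" "R p q" "R q c" "R c y" "R y d"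
  shows False
proof -
  have bc: "b \<in> C" "c \<in> C" using bc X E indep by auto
  consider "p \<in> C" "q \<in> C" | "p \<in> C" "q \<in> X" | "p \<in> X" "q \<in> C" using pq indep E by auto
  then show False
  proof cases
    case 1
    then show ?thesis using no_path8_C[OF dist] C X bc E by blast
  next
    case 2
    then show ?thesis using no_path8_X[OF dist] C X bc E by blast
  next
    case 3
    then show ?thesis using no_path8_X[of d y c q p b x a] C X bc E dist sym by auto
  qed
qed

text \<open>Rotating along an edge from \<open>a\<close> to a later vertex makes the predecessor of
  that vertex the new end, which has to lie in \<open>C\<close>. For \<open>c\<close> the
  predecessor is \<open>b\<close>, a neighbour of \<open>a\<close> and hence in \<open>C\<close>.
  Otherwise \<open>a\<close> has three neighbours among \<open>d, e, f, g\<close>; two of them are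
  consecutive, and the earlier one is in \<open>C\<close>.\<close>

lemma rotate_X_end:
  assumes dist: "distinct [a,b,c,d,e,f,g]" and V: "{b,c,d,e,f,g} \<subseteq> C \<union> X" and a: "a \<in> X"
    and E: "R a b" "R b c" "R c d" "R d e" "R e f" "R f g"
    and nbrs: "\<And>u. u \<in> C \<Longrightarrow> R a u \<Longrightarrow> u \<in> {b,c,d,e,f,g}"
  obtains a' b' c' d' e' f' where "distinct [a',b',c',d',e',f',g]" "{b',c',d',e',f'} \<subseteq> C \<union> X" "a' \<in> C"
     "R a' b'" "R b' c'" "R c' d'" "R d' e'" "R e' f'" "R f' g"
proof -
  note E' = E E[THEN sym]
  have bC: "b \<in> C" using V a E indep by auto
  \<comment> \<open>The three exclusion patterns carry out this pigeonhole argument: each excludes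
    \<open>b\<close> and two more positions, leaving three candidates.\<close>
  obtain u where u: "u \<in> C" "R a u" "u \<noteq> b" "u \<noteq> d" "u \<noteq> f" using nbrX[OF a] .
  obtain w where w: "w \<in> C" "R a w" "w \<noteq> b" "w \<noteq> e" "w \<noteq> g" using nbrX[OF a] .
  obtain t where t: "t \<in> C" "R a t" "t \<noteq> b" "t \<noteq> d" "t \<noteq> g" using nbrX[OF a] .
  have mem: "u \<in> {c,e,g}" "w \<in> {c,d,f}" "t \<in> {c,e,f}"
    using nbrs u w t by blast+
  have "R a c \<or> (R a d \<and> R a e \<and> d \<in> C) \<or> (R a e \<and> R a f \<and> e \<in> C) \<or> (R a f \<and> R a g \<and> f \<in> C)"
    using mem u w t by auto
  then consider "R a c" | "R a e" "d \<in> C" | "R a f" "e \<in> C" | "R a g" "f \<in> C" by blast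
  then show thesis
  proof cases
    case 1 then show ?thesis by (intro that(1)[of b a c d e f]) (use bC a V E' dist in auto)
  next
    case 2 then show ?thesis by (intro that(1)[of d c b a e f]) (use bC a V E' dist in auto)
  next
    case 3 then show ?thesis by (intro that(1)[of e d c b a f]) (use bC a V E' dist in auto)
  next
    case 4 then show ?thesis by (intro that(1)[of f e d c b a]) (use bC a V E' dist in auto)
  qed
qed

text \<open>If \<open>g\<close> is in \<open>X\<close> and has a neighbour \<open>u\<close> off the
  path, then appending \<open>u\<close> gives eight vertices. For \<open>b\<close> in
  \<open>C\<close> dropping \<open>a\<close> leaves an anchored path; for \<open>b\<close> in
  \<open>X\<close> it is the configuration of \<open>no_path8\<close>. Without such \<open>u\<close>
  a rotation at \<open>g\<close> brings an anchor to that end.\<close>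

lemma no_path7_from_C:
  assumes dist: "distinct [a,b,c,d,e,f,g]" and V: "{b,c,d,e,f,g} \<subseteq> C \<union> X" and a: "a \<in> C"
    and E: "R a b" "R b c" "R c d" "R d e" "R e f" "R f g"
  shows False
proof (cases "g \<in> C")
  case True
  then show ?thesis using no_path7[OF dist] V a E by auto
next
  case False
  then have g: "g \<in> X" using V by auto
  note E' = E E[THEN sym]
  show ?thesis
  proof (cases "\<exists>u\<in>C. R g u \<and> u \<notin> {a,b,c,d,e,f}")
    case True
    then obtain u where u: "u \<in> C" "R g u" "u \<notin> {a,b,c,d,e,f}" by blast
    then have ug: "u \<noteq> g" using irr by auto
    have "b \<notin> C" using no_path7[of b c d e f g u] u ug dist V g E by auto
    then show ?thesis using no_path8[of a b c d e f g u] u ug dist V g a E by auto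
  next
    case False
    show ?thesis
    proof (rule rotate_X_end[of g f e d c b a])
      fix a' b' c' d' e' f'
      assume "distinct [a',b',c',d',e',f',a]" "{b',c',d',e',f'} \<subseteq> C \<union> X" "a' \<in> C"
        "R a' b'" "R b' c'" "R c' d'" "R d' e'" "R e' f'" "R f' a"
      then show False using no_path7[of a' b' c' d' e' f' a] a by blast
    qed (use dist V a g E' False in auto)
  qed
qed

lemma no_path7_anywhere:
  assumes dist: "distinct [a,b,c,d,e,f,g]" and V: "{a,b,c,d,e,f,g} \<subseteq> C \<union> X"
    and E: "R a b" "R b c" "R c d" "R d e" "R e f" "R f g"
  shows False
proof -
  note E' = E E[THEN sym]
  consider "a \<in> C" | "g \<in> C" | "a \<in> X" "g \<in> X" using V by auto
  then show False
  proof cases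
    case 1
    then show ?thesis using no_path7_from_C[OF dist] V E by auto
  next
    case 2
    then show ?thesis using no_path7_from_C[of g f e d c b a] dist V E' by auto
  next
    case 3
    show ?thesis
    proof (cases "\<exists>u\<in>C. R a u \<and> u \<notin> {b,c,d,e,f,g}")
      case True
      then obtain u where u: "u \<in> C" "R a u" "u \<notin> {b,c,d,e,f,g}" by blast
      then have "u \<noteq> a" "R u a" using irr sym by auto
      then show ?thesis using no_path7_from_C[of u a b c d e f] u dist V E 3 by auto
    next
      case False
      show ?thesis
      proof (rule rotate_X_end[of a b c d e f g])
        fix a' b' c' d' e' f'
        assume "distinct [a',b',c',d',e',f',g]" "{b',c',d',e',f'} \<subseteq> C \<union> X" "a' \<in> C"
          "R a' b'" "R b' c'" "R c' d'" "R d' e'" "R e' f'" "R f' g"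
        then show False using no_path7_from_C[of a' b' c' d' e' f' g] 3 by blast
      qed (use dist V 3 E False in auto)
    qed
  qed
qed

end

section \<open>Longest paths, the cycles they close to, and the degree sum\<close>

lemma exists_longest_path:
  assumes "finite S" and "S \<noteq> {}"
  obtains xs where "distinct xs" "set xs \<subseteq> S" "successively R xs" "xs \<noteq> []"
    "\<And>ys. distinct ys \<Longrightarrow> set ys \<subseteq> S \<Longrightarrow> successively R ys \<Longrightarrow> length ys \<le> length xs"
proof -
  let ?P = "\<lambda>xs. distinct xs \<and> set xs \<subseteq> S \<and> successively R xs"
  have bound: "\<forall>ys. ?P ys \<longrightarrow> length ys < Suc (card S)"
    using assms(1) by (metis card_mono distinct_card le_imp_less_Suc)
  obtain s where "s \<in> S" using assms(2) by auto
  then have s: "?P [s]" by simp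
  obtain xs where xs: "?P xs" "\<forall>ys. ?P ys \<longrightarrow> length ys \<le> length xs"
    using ex_has_greatest_nat[of ?P "[s]" length "Suc (card S)"] s bound by blast
  then have "length [s] \<le> length xs" using s by blast
  then show ?thesis using xs that[of xs] by fastforce
qed

text \<open>The two chords turn \<open>us @ rev vs\<close> into a cycle on the vertices of the path.
  Cutting it open at \<open>p\<close> and putting \<open>z\<close> in front would give a longer
  path.\<close>

lemma longest_path_cycle_closed:
  assumes xs: "distinct (us @ vs)" "set (us @ vs) \<subseteq> S" "successively R (us @ vs)"
    and ne: "us \<noteq> []" "vs \<noteq> []"
    and longest: "\<And>ys. distinct ys \<Longrightarrow> set ys \<subseteq> S \<Longrightarrow> successively R ys \<Longrightarrow> length ys \<le> length (us @ vs)"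
    and sym: "\<And>x y. R x y \<Longrightarrow> R y x"
    and cyc: "R (hd us) (hd vs)" "R (last us) (last vs)"
    and z: "z \<in> S" "z \<notin> set (us @ vs)" and p: "p \<in> set (us @ vs)"
  shows "\<not> R z p"
proof
  assume "R z p"
  let ?c = "us @ rev vs"
  have rev: "successively (\<lambda>x y. R y x) ws = successively R ws" for ws
    using sym by (auto elim!: successively_mono)
  have sc: "successively R ?c"
    using xs(3) ne cyc by (auto simp: successively_append_iff rev hd_rev successively_rev)
  have close: "R (last ?c) (hd ?c)" using ne cyc sym by (simp add: last_rev)
  have "p \<in> set ?c" using p by simp
  then obtain ys zs where c: "?c = ys @ p # zs" by (meson split_list)
  let ?n = "z # p # zs @ ys"
  have "successively R ?n"
  proof -
    have "successively R (p # zs)" "successively R ys"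
      using sc unfolding c by (auto simp: successively_append_iff)
    moreover have "R (last (p # zs)) (hd ys)" if "ys \<noteq> []"
      using close that unfolding c by simp
    ultimately have "successively R ((p # zs) @ ys)"
      unfolding successively_append_iff by blast
    then show ?thesis using \<open>R z p\<close> by simp
  qed
  moreover have same: "set ?c = set (us @ vs)" by simp
  have len: "length ?n = Suc (length (us @ vs))"
    using arg_cong[OF c, of length] by simp
  have "distinct ?c" using xs(1) by auto
  then have "distinct ?n" "set ?n \<subseteq> S"
    using z xs(2) same unfolding c by auto
  ultimately show False using longest[of ?n] len by simp
qed

text \<open>Ore's crossing argument: the path has at most five edges. At least three of them end in
  a neighbour of \<open>hd xs\<close> and at least three begin in a neighbour of
  \<open>last xs\<close>, so some edge does both.\<close>

lemma crossing_index:
  assumes xs: "distinct xs" "length xs \<le> 6" "xs \<noteq> []"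
    and hd: "3 \<le> deg_in R (set xs) (hd xs)" and last: "3 \<le> deg_in R (set xs) (last xs)"
    and irr: "\<And>x. \<not> R x x"
  obtains us vs where "xs = us @ vs" "us \<noteq> []" "vs \<noteq> []" "R (hd xs) (hd vs)" "R (last xs) (last us)"
proof -
  let ?m = "length xs - 1"
  let ?I = "{i. i < ?m \<and> R (hd xs) (xs ! Suc i)}" and ?J = "{i. i < ?m \<and> R (last xs) (xs ! i)}"
  have "{u \<in> set xs. R (hd xs) u} \<subseteq> (\<lambda>i. xs ! Suc i) ` ?I"
  proof
    fix u assume "u \<in> {u \<in> set xs. R (hd xs) u}"
    then obtain j where j: "j < length xs" "u = xs ! j" "R (hd xs) u" by (auto simp: in_set_conv_nth)
    have "j \<noteq> 0" using j irr xs(3) by (metis hd_conv_nth)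
    then obtain i where "j = Suc i" by (cases j) auto
    then show "u \<in> (\<lambda>i. xs ! Suc i) ` ?I" using j by auto
  qed
  then have "deg_in R (set xs) (hd xs) \<le> card ?I"
    unfolding deg_in_def by (rule surj_card_le[rotated]) simp
  moreover have "{u \<in> set xs. R (last xs) u} \<subseteq> (\<lambda>i. xs ! i) ` ?J"
  proof
    fix u assume "u \<in> {u \<in> set xs. R (last xs) u}"
    then obtain j where j: "j < length xs" "u = xs ! j" "R (last xs) u" by (auto simp: in_set_conv_nth)
    have "j \<noteq> length xs - 1" using j irr xs(3) by (metis last_conv_nth)
    then show "u \<in> (\<lambda>i. xs ! i) ` ?J" using j by auto
  qed
  then have "deg_in R (set xs) (last xs) \<le> card ?J"
    unfolding deg_in_def by (rule surj_card_le[rotated]) simp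
  moreover have "?I \<inter> ?J \<noteq> {}"
  proof
    assume "?I \<inter> ?J = {}"
    then have "card (?I \<union> ?J) = card ?I + card ?J" by (intro card_Un_disjoint) auto
    moreover have "card (?I \<union> ?J) \<le> card {..<?m}" by (intro card_mono) auto
    ultimately show False
      using \<open>deg_in R (set xs) (hd xs) \<le> card ?I\<close> \<open>deg_in R (set xs) (last xs) \<le> card ?J\<close> hd last xs(2)
      by simp
  qed
  then obtain i where i: "i < ?m" "R (hd xs) (xs ! Suc i)" "R (last xs) (xs ! i)" by auto
  show ?thesis
  proof (rule that[of "take (Suc i) xs" "drop (Suc i) xs"])
    show "R (last xs) (last (take (Suc i) xs))"
      using i by (simp add: last_conv_nth take_Suc_conv_app_nth)
  qed (use i xs in \<open>auto simp: hd_drop_conv_nth\<close>)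
qed

context anchored_graph begin

lemma anchored_graph_subset: "C' \<subseteq> C \<Longrightarrow> X' \<subseteq> X \<Longrightarrow> anchored_graph R C' X'"
proof
  assume C: "C' \<subseteq> C" and X: "X' \<subseteq> X"
  show "R y x" if "R x y" for x y using that sym by blast
  show "\<not> R x x" for x using irr .
  show "finite C'" "finite X'" using C X finC finX finite_subset by auto
  show "C' \<inter> X' = {}" using C X disj by auto
  show "\<not> R x y" if "x \<in> X'" "y \<in> X'" for x y using that X indep by auto
  fix a b c d e f g
  assume "distinct [a,b,c,d,e,f,g]" "{b,c,d,e,f} \<subseteq> C' \<union> X'" "a \<in> C'" "g \<in> C'"
      "R a b" "R b c" "R c d" "R d e" "R e f" "R f g"
  moreover have "{b,c,d,e,f} \<subseteq> C \<union> X" using calculation(2) C X by auto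
  ultimately show False using no_path7[of a b c d e f g] C by blast
qed

end

text \<open>No path has seven vertices, so a longest one has at most six. The degrees of its ends
  close it to a cycle, and maximality separates that cycle from all other vertices.\<close>

lemma (in anchored_graph_mindeg) exists_closed_small:
  assumes "C \<union> X \<noteq> {}"
  obtains K where "K \<subseteq> C \<union> X" "K \<noteq> {}" "card K \<le> 6"
    "\<And>x y. x \<in> K \<Longrightarrow> y \<in> C \<union> X - K \<Longrightarrow> \<not> R x y \<and> \<not> R y x"
proof -
  let ?S = "C \<union> X"
  have finS: "finite ?S" using finC finX by simp
  obtain xs where xs: "distinct xs" "set xs \<subseteq> ?S" "successively R xs" "xs \<noteq> []"
    and longest: "\<And>ys. distinct ys \<Longrightarrow> set ys \<subseteq> ?S \<Longrightarrow> successively R ys \<Longrightarrow> length ys \<le> length xs"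
    using exists_longest_path[OF finS assms] by blast
  have len: "length xs \<le> 6"
  proof (rule ccontr)
    assume "\<not> length xs \<le> 6"
    then have "Suc (Suc (Suc (Suc (Suc (Suc (Suc 0)))))) \<le> length xs" by simp
    then obtain a b c d e f g ys where "xs = a # b # c # d # e # f # g # ys"
      by (auto simp: Suc_le_length_iff)
    then show False using no_path7_anywhere[of a b c d e f g] xs by auto
  qed
  have deg3: "3 \<le> deg_in R ?S x" if "x \<in> ?S" for x using that degC degX by fastforce
  have ext: "u \<in> set xs" if "u \<in> ?S" "R u (hd xs)" for u
  proof (rule ccontr)
    assume "u \<notin> set xs"
    then show False using longest[of "u # xs"] xs that by (cases xs) auto
  qed
  have ext': "u \<in> set xs" if "u \<in> ?S" "R u (last xs)" for u
  proof (rule ccontr)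
    assume "u \<notin> set xs"
    then show False using longest[of "xs @ [u]"] xs that sym by (auto simp: successively_append_iff)
  qed
  have "{u \<in> ?S. R (hd xs) u} = {u \<in> set xs. R (hd xs) u}" using ext sym xs(2) by auto
  then have hd: "3 \<le> deg_in R (set xs) (hd xs)" using deg3[of "hd xs"] xs by (simp add: deg_in_def subset_iff)
  have "{u \<in> ?S. R (last xs) u} = {u \<in> set xs. R (last xs) u}" using ext' sym xs(2) by auto
  then have last: "3 \<le> deg_in R (set xs) (last xs)" using deg3[of "last xs"] xs by (simp add: deg_in_def subset_iff)
  obtain us vs where uv: "xs = us @ vs" "us \<noteq> []" "vs \<noteq> []" "R (hd xs) (hd vs)" "R (last xs) (last us)"
    using crossing_index[OF xs(1) len xs(4) hd last irr] .
  have closed: "\<not> R z p" if "z \<in> ?S" "z \<notin> set xs" "p \<in> set xs" for z p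
    using longest_path_cycle_closed[of us vs ?S R z p] uv xs longest sym that by (simp add: uv(1))
  show ?thesis
  proof (rule that[of "set xs"])
    show "set xs \<noteq> {}" using xs by simp
    show "card (set xs) \<le> 6" using xs len by (simp add: distinct_card)
    show "\<not> R x y \<and> \<not> R y x" if "x \<in> set xs" "y \<in> ?S - set xs" for x y
      using closed that sym by blast
  qed (rule xs)
qed

text \<open>Induction by deletion. Each deleted vertex is paid for by its own weight, as deleting
  degree \<open>d\<close> costs \<open>2 * d\<close>. When no vertex is cheap enough, a closed set
  of at most six vertices splits off; its inner degrees are at most 5, within the weights of both
  sides.\<close>

lemma (in anchored_graph) sum_deg_le:
  "(\<Sum>x\<in>C \<union> X. deg_in R (C \<union> X) x) \<le> 5 * card C + 6 * card X"
proof -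
  have "(\<Sum>x\<in>C' \<union> X'. deg_in R (C' \<union> X') x) \<le> 5 * card C' + 6 * card X'"
    if "C' \<subseteq> C" "X' \<subseteq> X" for C' X'
    using that
  proof (induction "card (C' \<union> X')" arbitrary: C' X' rule: less_induct)
    case less
    interpret sub: anchored_graph R C' X' using anchored_graph_subset less.prems .
    let ?S = "C' \<union> X'"
    have fin: "finite ?S" using sub.finC sub.finX by simp
    show ?case
    proof (cases "\<exists>x\<in>C'. deg_in R ?S x \<le> 2")
      case True
      then obtain x where x: "x \<in> C'" "deg_in R ?S x \<le> 2" by blast
      have xX: "x \<notin> X'" using x sub.disj by auto
      have S: "?S = insert x ((C' - {x}) \<union> X')" using x by auto
      have "card ((C' - {x}) \<union> X') < card ?S"
        using fin x xX by (intro psubset_card_mono) auto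
      then have "(\<Sum>y\<in>(C' - {x}) \<union> X'. deg_in R ((C' - {x}) \<union> X') y) \<le> 5 * card (C' - {x}) + 6 * card X'"
        using less.prems by (intro less.hyps) auto
      moreover have "(\<Sum>y\<in>?S. deg_in R ?S y) =
          (\<Sum>y\<in>(C' - {x}) \<union> X'. deg_in R ((C' - {x}) \<union> X') y) + 2 * deg_in R ?S x"
        unfolding S using fin xX by (intro sum_deg_in_insert[OF _ _ sub.sym sub.irr]) auto
      moreover have "card C' = Suc (card (C' - {x}))"
        using card.remove[OF sub.finC x(1)] .
      ultimately show ?thesis using x(2) by linarith
    next
      case C: False
      show ?thesis
      proof (cases "\<exists>x\<in>X'. deg_in R ?S x \<le> 3")
        case True
        then obtain x where x: "x \<in> X'" "deg_in R ?S x \<le> 3" by blast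
        have xC: "x \<notin> C'" using x sub.disj by auto
        have S: "?S = insert x (C' \<union> (X' - {x}))" using x by auto
        have "card (C' \<union> (X' - {x})) < card ?S"
          using fin x xC by (intro psubset_card_mono) auto
        then have "(\<Sum>y\<in>C' \<union> (X' - {x}). deg_in R (C' \<union> (X' - {x})) y) \<le> 5 * card C' + 6 * card (X' - {x})"
          using less.prems by (intro less.hyps) auto
        moreover have "(\<Sum>y\<in>?S. deg_in R ?S y) =
            (\<Sum>y\<in>C' \<union> (X' - {x}). deg_in R (C' \<union> (X' - {x})) y) + 2 * deg_in R ?S x"
          unfolding S using fin xC by (intro sum_deg_in_insert[OF _ _ sub.sym sub.irr]) auto
        moreover have "card X' = Suc (card (X' - {x}))"
          using card.remove[OF sub.finX x(1)] .
        ultimately show ?thesis using x(2) by linarith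
      next
        case X: False
        show ?thesis
        proof (cases "?S = {}")
          case False
          interpret md: anchored_graph_mindeg R C' X'
          proof
            show "3 \<le> deg_in R ?S x" if "x \<in> C'" for x
            proof (rule ccontr)
              assume "\<not> 3 \<le> deg_in R ?S x"
              then have "deg_in R ?S x \<le> 2" by linarith
              then show False using C that by blast
            qed
            show "4 \<le> deg_in R ?S x" if "x \<in> X'" for x
            proof (rule ccontr)
              assume "\<not> 4 \<le> deg_in R ?S x"
              then have "deg_in R ?S x \<le> 3" by linarith
              then show False using X that by blast
            qed
          qed
          obtain K where K: "K \<subseteq> ?S" "K \<noteq> {}" "card K \<le> 6"
            "\<And>x y. x \<in> K \<Longrightarrow> y \<in> ?S - K \<Longrightarrow> \<not> R x y \<and> \<not> R y x"
            using md.exists_closed_small[OF False] by blast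
          let ?C = "C' - K" and ?X = "X' - K"
          have finK: "finite K" using finite_subset[OF K(1) fin] .
          have S: "?S = K \<union> (?C \<union> ?X)" using K by auto
          have small: "deg_in R K x \<le> 5" if "x \<in> K" for x
          proof -
            have "{u \<in> K. R x u} \<subseteq> K - {x}" using irr by auto
            then have "deg_in R K x \<le> card (K - {x})"
              unfolding deg_in_def using finK by (intro card_mono) auto
            also have "\<dots> \<le> 5" using K(3) that finK by simp
            finally show ?thesis .
          qed
          have "(\<Sum>x\<in>K. deg_in R K x) \<le> 5 * card K"
            using sum_bounded_above[of K "deg_in R K" 5] small by simp
          moreover have "card (?C \<union> ?X) < card ?S"
            using fin K by (intro psubset_card_mono) auto
          then have "(\<Sum>y\<in>?C \<union> ?X. deg_in R (?C \<union> ?X) y) \<le> 5 * card ?C + 6 * card ?X"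
            using less.prems by (intro less.hyps) auto
          moreover have "(\<Sum>y\<in>?S. deg_in R ?S y) =
              (\<Sum>y\<in>K. deg_in R K y) + (\<Sum>y\<in>?C \<union> ?X. deg_in R (?C \<union> ?X) y)"
            by (subst (1 2) S, rule sum_deg_in_Un) (use finK fin K in auto)
          moreover have "card K = card (C' \<inter> K) + card (X' \<inter> K)"
          proof -
            have "K = (C' \<inter> K) \<union> (X' \<inter> K)" using K by auto
            moreover have "card ((C' \<inter> K) \<union> (X' \<inter> K)) = card (C' \<inter> K) + card (X' \<inter> K)"
              using sub.disj finK by (intro card_Un_disjoint) auto
            ultimately show ?thesis by simp
          qed
          moreover have "card C' = card (C' \<inter> K) + card ?C"
            using card_Int_Diff[OF sub.finC, of K] .
          moreover have "card X' = card (X' \<inter> K) + card ?X"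
            using card_Int_Diff[OF sub.finX, of K] .
          ultimately show ?thesis by linarith
        qed simp
      qed
    qed
  qed
  then show ?thesis by blast
qed

section \<open>Large minimum degree in the complement forces a wheel\<close>

text \<open>\<open>A\<close> is the adjacency of the complement; the adjacency of the graph itself is \<open>E\<close> below.
  Correspondingly, \<open>N v\<close> and \<open>D v\<close> are the neighbourhoods of \<open>v\<close> in the complement and in the graph.\<close>

locale w8_free =
  fixes V :: "'a set" and A :: "'a \<Rightarrow> 'a \<Rightarrow> bool"
  assumes finV: "finite V"
    and A_sym: "A x y \<Longrightarrow> A y x"
    and A_irr: "\<not> A x x"
    and A_V: "A x y \<Longrightarrow> x \<in> V"
    and no_wheel: "\<lbrakk>distinct [h,a,b,c,d,e,f,g,i]; A h a; A h b; A h c; A h d; A h e; A h f; A h g; A h i;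
      A a b; A b c; A c d; A d e; A e f; A f g; A g i; A i a\<rbrakk> \<Longrightarrow> False"
begin

definition N :: "'a \<Rightarrow> 'a set" where "N v = {u. A v u}"

lemma N_V: "N v \<subseteq> V"
  using A_sym A_V by (auto simp: N_def)

lemma finN: "finite (N v)"
  using N_V finV finite_subset by blast

lemma no_alternating_wheel:
  assumes "distinct [h,x1,x2,x3,x4,y1,y2,y3,y4]"
    and "A h x1" "A h x2" "A h x3" "A h x4" "A h y1" "A h y2" "A h y3" "A h y4"
    and "A x1 y1" "A x2 y1" "A x2 y2" "A x3 y2" "A x3 y3" "A x4 y3" "A x4 y4" "A x1 y4"
  shows False
  using no_wheel[of h x1 y1 x2 y2 x3 y3 x4 y4] assms A_sym by auto

lemma ex_four:
  assumes "4 \<le> card S"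
  obtains a b c d where "{a,b,c,d} \<subseteq> S" "distinct [a,b,c,d]"
proof -
  obtain T where T: "T \<subseteq> S" "card T = 4" using assms by (meson obtain_subset_with_card_n)
  then have "card T = Suc (Suc (Suc (Suc 0)))" by simp
  then obtain a b c d where "T = {a,b,c,d}" "distinct [a,b,c,d]"
    by (auto simp: card_Suc_eq)
  then show ?thesis using that T by blast
qed

lemma no_join_wheel:
  assumes X: "4 \<le> card X" "\<And>x. x \<in> X \<Longrightarrow> A h x" and Y: "4 \<le> card Y" "\<And>y. y \<in> Y \<Longrightarrow> A h y"
    and XY: "\<And>x y. x \<in> X \<Longrightarrow> y \<in> Y \<Longrightarrow> A x y"
  shows False
proof -
  obtain a b c d where x: "{a,b,c,d} \<subseteq> X" "distinct [a,b,c,d]" using ex_four[OF X(1)] .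
  obtain e f g i where y: "{e,f,g,i} \<subseteq> Y" "distinct [e,f,g,i]" using ex_four[OF Y(1)] .
  have "X \<inter> Y = {}" "h \<notin> X" "h \<notin> Y" using XY X(2) Y(2) A_irr by blast+
  then have "distinct [h,a,b,c,d,e,f,g,i]" using x y by auto
  then show False
    using no_alternating_wheel[of h a b c d e f g i] x(1) y(1) X(2) Y(2) XY by auto
qed

lemma common_nbrs_anchored:
  assumes uv: "A u v"
  shows "anchored_graph (\<lambda>x y. A x y \<and> \<not> (x \<in> N v - N u \<and> y \<in> N v - N u)) (N u \<inter> N v) (N v - N u - {u})"
proof
  fix a b c d e f g
  assume d: "distinct [a,b,c,d,e,f,g]"
    and S: "{b,c,d,e,f} \<subseteq> N u \<inter> N v \<union> (N v - N u - {u})" "a \<in> N u \<inter> N v" "g \<in> N u \<inter> N v"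
    and E: "A a b \<and> \<not> (a \<in> N v - N u \<and> b \<in> N v - N u)" "A b c \<and> \<not> (b \<in> N v - N u \<and> c \<in> N v - N u)"
      "A c d \<and> \<not> (c \<in> N v - N u \<and> d \<in> N v - N u)" "A d e \<and> \<not> (d \<in> N v - N u \<and> e \<in> N v - N u)"
      "A e f \<and> \<not> (e \<in> N v - N u \<and> f \<in> N v - N u)" "A f g \<and> \<not> (f \<in> N v - N u \<and> g \<in> N v - N u)"
  have "u \<notin> {a,b,c,d,e,f,g}" "v \<notin> {a,b,c,d,e,f,g}" "u \<noteq> v"
    using S uv A_irr by (auto simp: N_def)
  then have "distinct [v,u,a,b,c,d,e,f,g]" using d by auto
  moreover have "A v a" "A v b" "A v c" "A v d" "A v e" "A v f" "A v g" "A u a" "A g u" "A v u"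
    using S uv A_sym by (auto simp: N_def)
  ultimately show False using no_wheel[of v u a b c d e f g] E by blast
qed (use A_sym A_irr finN in \<open>auto simp: N_def\<close>)

text \<open>Every edge between \<open>C\<close> and \<open>X\<close> enters the degree sum at both
  ends. Moving the contribution of \<open>X\<close> over to \<open>C\<close> by double counting
  produces the factor 2.\<close>

lemma sum_common_nbrs_le:
  assumes uv: "A u v"
  defines "C \<equiv> N u \<inter> N v" and "X \<equiv> N v - N u - {u}"
  shows "(\<Sum>w\<in>C. card (N w \<inter> C) + 2 * card (N w \<inter> X)) \<le> 5 * card C + 6 * card X"
proof -
  let ?R = "\<lambda>x y. A x y \<and> \<not> (x \<in> N v - N u \<and> y \<in> N v - N u)"
  interpret anchored_graph ?R C X
    unfolding C_def X_def by (rule common_nbrs_anchored[OF uv])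
  have dC: "deg_in ?R (C \<union> X) w = card (N w \<inter> C) + card (N w \<inter> X)" if "w \<in> C" for w
  proof -
    have "{u \<in> C \<union> X. ?R w u} = (N w \<inter> C) \<union> (N w \<inter> X)"
      using that by (auto simp: N_def C_def X_def)
    moreover have "card ((N w \<inter> C) \<union> (N w \<inter> X)) = card (N w \<inter> C) + card (N w \<inter> X)"
      by (intro card_Un_disjoint) (auto simp: finN C_def X_def)
    ultimately show ?thesis by (simp add: deg_in_def)
  qed
  have dX: "deg_in ?R (C \<union> X) x = card {w \<in> C. x \<in> N w \<inter> X}" if "x \<in> X" for x
  proof -
    have "{u \<in> C \<union> X. ?R x u} = {w \<in> C. x \<in> N w \<inter> X}"
      using that A_sym by (auto simp: N_def C_def X_def)
    then show ?thesis by (simp add: deg_in_def)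
  qed
  have "(\<Sum>x\<in>X. card {w \<in> C. x \<in> N w \<inter> X}) = (\<Sum>w\<in>C. card {x \<in> X. x \<in> N w \<inter> X})"
    using sum.swap_restrict[OF finC finX, of "\<lambda>_ _. 1::nat" "\<lambda>w x. x \<in> N w \<inter> X"] by simp
  also have "\<dots> = (\<Sum>w\<in>C. card (N w \<inter> X))"
    by (rule sum.cong[OF refl], rule arg_cong[of _ _ card]) auto
  finally have "(\<Sum>x\<in>X. deg_in ?R (C \<union> X) x) = (\<Sum>w\<in>C. card (N w \<inter> X))"
    using dX by simp
  moreover have "(\<Sum>x\<in>C \<union> X. deg_in ?R (C \<union> X) x) =
      (\<Sum>x\<in>C. deg_in ?R (C \<union> X) x) + (\<Sum>x\<in>X. deg_in ?R (C \<union> X) x)"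
    by (rule sum.union_disjoint[OF finC finX disj])
  moreover have "(\<Sum>x\<in>C. deg_in ?R (C \<union> X) x) = (\<Sum>w\<in>C. card (N w \<inter> C) + card (N w \<inter> X))"
    using dC by simp
  ultimately show ?thesis using sum_deg_le by (simp add: sum.distrib flip: sum_distrib_left)
qed

end

text \<open>Here \<open>T\<close> is the number of vertices adjacent to exactly one of \<open>u\<close>, \<open>v\<close>, and \<open>2n - 2 - k - T\<close> the number
  of vertices adjacent to neither. Eliminating \<open>S\<close> and \<open>T\<close> leaves \<open>(n + 2 - k)(k - 6) \<le> 0\<close>.\<close>

lemma codegree_window:
  fixes k n T S :: int
  assumes "k * (n + 1) \<le> S + k * (2 * n - 2 - k - T)" and "S \<le> 5 * k + 3 * T"
    and "2 * n + 4 - 2 * k \<le> T" and "6 \<le> k" and "k < n + 2"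
  shows "k = 6 \<and> T \<le> 2 * n - 8"
proof -
  have 1: "T * (k - 3) \<le> k * (n + 2 - k)"
    using assms(1,2) by (simp add: algebra_simps)
  moreover have "(2 * n + 4 - 2 * k) * (k - 3) \<le> T * (k - 3)"
    using assms(3,4) by (intro mult_right_mono) auto
  ultimately have "(n + 2 - k) * (k - 6) \<le> 0" by (simp add: algebra_simps)
  then have "k = 6" using assms(4,5) by (simp add: mult_le_0_iff)
  with 1 show ?thesis by simp
qed

context w8_free begin

text \<open>A common neighbour has at least \<open>n + 1\<close> neighbours besides \<open>u\<close>
  and \<open>v\<close>, spread over \<open>C\<close>, \<open>X\<close>, \<open>Y\<close> and
  \<open>Z\<close>. The path bounds limit the first three in total, and \<open>card Z\<close> limits
  the last.\<close>

lemma codegree_six_or_large: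
  assumes V: "card V = 2 * n" and deg: "\<And>x. x \<in> V \<Longrightarrow> n + 3 \<le> card (N x)"
    and uv: "A u v"
  shows "n + 2 \<le> card (N u \<inter> N v) \<or>
    card (N u \<inter> N v) = 6 \<and> card (N u) = n + 3 \<and> card (N v) = n + 3"
proof -
  define C where "C = N u \<inter> N v"
  define X where "X = N v - N u - {u}"
  define Y where "Y = N u - N v - {v}"
  define k where "k = card C"
  have uvV: "u \<in> V" "v \<in> V" "u \<noteq> v" using uv A_sym A_V A_irr by auto
  have vu: "A v u" using uv A_sym by auto
  have fin: "finite C" "finite X" "finite Y" by (auto simp: C_def X_def Y_def finN)
  have "N v = insert u (C \<union> X)" "u \<notin> C \<union> X" "C \<inter> X = {}"
    using vu A_irr by (auto simp: C_def X_def N_def)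
  then have Nv: "card (N v) = k + card X + 1"
    using fin by (simp add: card_Un_disjoint k_def)
  have "N u = insert v (C \<union> Y)" "v \<notin> C \<union> Y" "C \<inter> Y = {}"
    using uv A_irr by (auto simp: C_def Y_def N_def)
  then have Nu: "card (N u) = k + card Y + 1"
    using fin by (simp add: card_Un_disjoint k_def)
  define Z where "Z = V - (N u \<union> N v)"
  have cUn: "card (N u \<union> N v) + k = card (N u) + card (N v)"
    using card_Un_Int[OF finN finN, of u v] by (simp add: k_def C_def)
  have NN: "N u \<union> N v \<subseteq> V" using N_V by blast
  have Zc: "card Z + card (N u \<union> N v) = 2 * n"
    using card_Diff_subset[of "N u \<union> N v" V] card_mono[OF finV NN] NN V finN by (simp add: Z_def)
  have k6: "6 \<le> k" using cUn Zc deg[of u] deg[of v] uvV by linarith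
  have w: "n + 1 \<le> card (N w \<inter> C) + card (N w \<inter> X) + card (N w \<inter> Y) + card Z" if "w \<in> C" for w
  proof -
    have "N w \<subseteq> (N w \<inter> C) \<union> (N w \<inter> X) \<union> (N w \<inter> Y) \<union> Z \<union> {u, v}"
      using N_V by (auto simp: C_def X_def Y_def Z_def)
    moreover have "finite ((N w \<inter> C) \<union> (N w \<inter> X) \<union> (N w \<inter> Y) \<union> Z \<union> {u, v})"
      using finN finV by (auto simp: Z_def)
    ultimately have "card (N w) \<le> card ((N w \<inter> C) \<union> (N w \<inter> X) \<union> (N w \<inter> Y) \<union> Z \<union> {u, v})"
      by (rule card_mono[rotated])
    also have "\<dots> \<le> card (N w \<inter> C) + card (N w \<inter> X) + card (N w \<inter> Y) + card Z + card {u, v}"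
      by (meson add_mono card_Un_le le_refl order_trans)
    finally have "card (N w) \<le> card (N w \<inter> C) + card (N w \<inter> X) + card (N w \<inter> Y) + card Z + 2"
      using uvV by simp
    moreover have "w \<in> V" using that N_V by (auto simp: C_def)
    ultimately show ?thesis using deg[of w] by linarith
  qed
  define S where "S = (\<Sum>w\<in>C. card (N w \<inter> C) + card (N w \<inter> X) + card (N w \<inter> Y))"
  have "k * (n + 1) \<le> (\<Sum>w\<in>C. card (N w \<inter> C) + card (N w \<inter> X) + card (N w \<inter> Y) + card Z)"
    unfolding k_def by (rule sum_bounded_below[where 'a = nat, simplified]) (rule w)
  also have "\<dots> = S + k * card Z" by (simp add: S_def sum.distrib k_def)
  finally have low: "k * (n + 1) \<le> S + k * card Z" .
  have "(\<Sum>w\<in>C. card (N w \<inter> C) + 2 * card (N w \<inter> X)) \<le> 5 * card C + 6 * card X"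
    using sum_common_nbrs_le[OF uv] by (simp add: C_def X_def)
  moreover have "(\<Sum>w\<in>C. card (N w \<inter> C) + 2 * card (N w \<inter> Y)) \<le> 5 * card C + 6 * card Y"
    using sum_common_nbrs_le[OF vu] by (simp add: C_def Y_def Int_commute)
  \<comment> \<open>Half the sum of two path bounds: \<open>X\<close> belongs to the wheels with hub
    \<open>v\<close>, \<open>Y\<close> to those with hub \<open>u\<close>.\<close>
  ultimately have up: "S \<le> 5 * k + 3 * (card X + card Y)"
    unfolding S_def k_def by (simp add: sum.distrib flip: sum_distrib_left)
  show ?thesis
  proof (cases "k < n + 2")
    case True
    define T where "T = int (card X + card Y)"
    have T: "2 * int n + 4 - 2 * int k \<le> T"
      using deg[of u] deg[of v] uvV Nu Nv by (simp add: T_def)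
    have Z: "int (card Z) = 2 * int n - 2 - int k - T"
      using Zc cUn Nu Nv by (simp add: T_def)
    have "int k * (int n + 1) \<le> int S + int k * (2 * int n - 2 - int k - T)"
      unfolding Z[symmetric] using low by (metis of_nat_1 of_nat_add of_nat_le_iff of_nat_mult)
    moreover have "int S \<le> 5 * int k + 3 * T" using up by (simp add: T_def)
    ultimately have "int k = 6 \<and> T \<le> 2 * int n - 8"
      using T k6 True by (intro codegree_window[of "int k" "int n" "int S" T]) auto
    then have "card (N u) = n + 3 \<and> card (N v) = n + 3 \<and> k = 6"
      using Nu Nv deg[of u] deg[of v] uvV by (auto simp: T_def)
    then show ?thesis by (simp add: k_def C_def)
  qed (simp add: k_def C_def)
qed

lemma ex_small_degree:
  assumes V: "card V = 2 * n" and n: "8 \<le> n"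
  shows "\<exists>x\<in>V. card (N x) < n + 3"
proof (rule ccontr)
  assume "\<not> ?thesis"
  then have deg: "n + 3 \<le> card (N x)" if "x \<in> V" for x using that by force
  show False
  proof (cases "\<exists>u v. A u v \<and> n + 2 \<le> card (N u \<inter> N v)")
    case True
    then obtain u v where uv: "A u v" and k: "n + 2 \<le> card (N u \<inter> N v)" by blast
    define C where "C = N u \<inter> N v"
    have finC: "finite C" and CV: "C \<subseteq> V" using finN N_V by (auto simp: C_def)
    have out: "card (V - C) = 2 * n - card C" using card_Diff_subset[OF finC CV] V by simp
    have kC: "n + 2 \<le> card C" using k by (simp add: C_def)
    have split: "card (N w) = card (N w \<inter> C) + card (N w - C)" for w
      using card_Int_Diff[OF finN] .
    have sub: "N w - C \<subseteq> V - C" for w using N_V by blast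
    have le: "card (N w - C) \<le> 2 * n - card C" for w
      using card_mono[OF _ sub] finV out by (metis finite_Diff)
    \<comment> \<open>At most \<open>n - 2\<close> vertices lie outside \<open>C\<close>, so each
      vertex of \<open>C\<close> has five neighbours inside. The path bound with empty
      \<open>X\<close> allows five on average; hence all have exactly five, and they miss nothing
      outside.\<close>
    have ge: "5 \<le> card (N w \<inter> C)" if "w \<in> C" for w
    proof -
      have "w \<in> V" using that CV by auto
      then show ?thesis using deg[of w] le[of w] split[of w] kC n by linarith
    qed
    have "(\<Sum>w\<in>C. card (N w \<inter> C)) \<le> 5 * card C"
    proof -
      let ?X = "N v - N u - {u}"
      let ?R = "\<lambda>x y. A x y \<and> \<not> (x \<in> N v - N u \<and> y \<in> N v - N u)"
      interpret anchored_graph ?R C "{}"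
        using anchored_graph.anchored_graph_subset[OF common_nbrs_anchored[OF uv]] by (simp add: C_def)
      have "deg_in ?R (C \<union> {}) w = card (N w \<inter> C)" if "w \<in> C" for w
        unfolding deg_in_def by (rule arg_cong[of _ _ card]) (use that in \<open>auto simp: N_def C_def\<close>)
      then show ?thesis using sum_deg_le by simp
    qed
    then have eq: "card (N w \<inter> C) = 5" if "w \<in> C" for w
    proof (rule contrapos_pp)
      assume "card (N w \<inter> C) \<noteq> 5"
      then have "5 < card (N w \<inter> C)" using ge[OF that] by simp
      then have "(\<Sum>w\<in>C. 5) < (\<Sum>w\<in>C. card (N w \<inter> C))"
        using ge that finC by (intro sum_strict_mono_ex1) auto
      then show "\<not> (\<Sum>w\<in>C. card (N w \<inter> C)) \<le> 5 * card C" by simp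
    qed
    have full: "N w - C = V - C" if "w \<in> C" for w
    proof (rule card_subset_eq)
      have "n + 3 \<le> 5 + card (N w - C)" using deg[of w] split[of w] eq[OF that] that CV by auto
      then show "card (N w - C) = card (V - C)" using le[of w] out kC by linarith
    qed (use sub finV in auto)
    obtain w where w: "w \<in> C" using kC by fastforce
    have "card (V - C) \<ge> 4" using deg[of w] split[of w] eq[OF w] w CV full[OF w] n by auto
    have adj: "A w y" if "w \<in> C" "y \<in> V - C" for w y
      using full[OF that(1)] that(2) by (auto simp: N_def)
    show False
    proof (rule no_join_wheel[of "N w \<inter> C" w "V - C"])
      show "4 \<le> card (N w \<inter> C)" using eq[OF w] by simp
      show "4 \<le> card (V - C)" by fact
      show "A w x" if "x \<in> N w \<inter> C" for x using that by (simp add: N_def)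
    qed (use adj w in blast)+
  next
    case False
    then have six: "card (N u \<inter> N v) = 6" "card (N u) = n + 3" if "A u v" for u v
      using codegree_six_or_large[OF V deg that] that by blast+
    have "V \<noteq> {}" using V n by auto
    then obtain v where v: "v \<in> V" by blast
    then have "N v \<noteq> {}" using deg[OF v] by auto
    then obtain u where u: "A v u" by (auto simp: N_def)
    have out: "card (V - N v) = n - 3"
      using card_Diff_subset[OF finN N_V, of v] V six(2)[OF u] by simp
    \<comment> \<open>Degree \<open>n + 3\<close> less the six common neighbours leaves
      \<open>n - 3\<close> neighbours of \<open>w\<close> outside \<open>N v\<close>, and there are
      no more vertices there.\<close>
    have full: "A w y" if "w \<in> N v" "y \<in> V - N v" for w y
    proof -
      have vw: "A v w" using that by (simp add: N_def)
      have "card (N w - N v) = n - 3"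
        using card_Int_Diff[OF finN, of w "N v"] six[OF vw] six(2)[OF A_sym[OF vw]] by (simp add: Int_commute)
      then have "N w - N v = V - N v" using out finV N_V by (intro card_subset_eq) auto
      then show ?thesis using that by (auto simp: N_def)
    qed
    show False
    proof (rule no_join_wheel[of "N v \<inter> N u" u "V - N v"])
      show "4 \<le> card (N v \<inter> N u)" "4 \<le> card (V - N v)" using six[OF u] out n by auto
      show "A u x" if "x \<in> N v \<inter> N u" for x using that by (simp add: N_def)
      have "u \<in> N v" using u by (simp add: N_def)
      then show "A u y" if "y \<in> V - N v" for y using full that by blast
      show "A x y" if "x \<in> N v \<inter> N u" "y \<in> V - N v" for x y using full that by blast
    qed
  qed
qed

end

section \<open>A vertex of large degree forces the trees\<close>

text \<open>The leaves at the centre are only counted: any \<open>n - 4\<close> (or \<open>n - 5\<close>) further neighbours of \<open>v\<close>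
  complete the tree.\<close>

definition has_S12 :: "('a \<Rightarrow> 'a \<Rightarrow> bool) \<Rightarrow> nat \<Rightarrow> bool" where
  "has_S12 E n \<longleftrightarrow> (\<exists>v a b c. distinct [v,a,b,c] \<and> E v a \<and> E a b \<and> E b c \<and>
     n - 4 \<le> card ({u. E v u} - {a,b,c}))"

definition has_S21 :: "('a \<Rightarrow> 'a \<Rightarrow> bool) \<Rightarrow> nat \<Rightarrow> bool" where
  "has_S21 E n \<longleftrightarrow> (\<exists>v a b c d. distinct [v,a,b,c,d] \<and> E v a \<and> E a b \<and> E v c \<and> E c d \<and>
     n - 5 \<le> card ({u. E v u} - {a,b,c,d}))"

definition has_S3 :: "('a \<Rightarrow> 'a \<Rightarrow> bool) \<Rightarrow> nat \<Rightarrow> bool" where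
  "has_S3 E n \<longleftrightarrow> (\<exists>v a b c. distinct [v,a,b,c] \<and> E v a \<and> E a b \<and> E a c \<and>
     n - 4 \<le> card ({u. E v u} - {a,b,c}))"

lemma ex_distinct_representatives4:
  assumes "4 \<le> card S" "4 \<le> card T" "4 \<le> card U" "4 \<le> card W"
  obtains s t u w where "s \<in> S" "t \<in> T" "u \<in> U" "w \<in> W" "distinct [s,t,u,w]"
proof -
  have pick: "\<exists>x\<in>Z. x \<notin> set xs" if "4 \<le> card Z" "length xs < 4" for Z xs
  proof (rule ccontr)
    assume "\<not> ?thesis"
    then have "card Z \<le> card (set xs)" by (intro card_mono) auto
    then show False using that card_length[of xs] by linarith
  qed
  obtain s where s: "s \<in> S" using pick[of S "[]"] assms by auto
  obtain t where t: "t \<in> T" "t \<notin> {s}" using pick[of T "[s]"] assms by auto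
  obtain u where u: "u \<in> U" "u \<notin> {s,t}" using pick[of U "[s,t]"] assms by auto
  obtain w where w: "w \<in> W" "w \<notin> {s,t,u}" using pick[of W "[s,t,u]"] assms by auto
  show ?thesis using that s t u w by auto
qed

section \<open>Joins in the complement and nearly complete sides\<close>

context w8_free begin

definition E :: "'a \<Rightarrow> 'a \<Rightarrow> bool" where "E x y \<longleftrightarrow> x \<in> V \<and> y \<in> V \<and> x \<noteq> y \<and> \<not> A x y"
definition D :: "'a \<Rightarrow> 'a set" where "D v = {u. E v u}"

lemma E_sym: "E x y \<Longrightarrow> E y x" using A_sym by (auto simp: E_def)
lemma D_V: "D v \<subseteq> V" by (auto simp: D_def E_def)
lemma finD: "finite (D v)" using D_V finV finite_subset by blast
lemma D_irr: "v \<notin> D v" by (simp add: D_def E_def)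
lemma D_sym: "u \<in> D v \<longleftrightarrow> v \<in> D u" using E_sym by (auto simp: D_def)
lemma A_iff: "x \<in> V \<Longrightarrow> y \<in> V \<Longrightarrow> x \<noteq> y \<Longrightarrow> A x y \<longleftrightarrow> y \<notin> D x" by (auto simp: D_def E_def)

lemma card_D_N:
  assumes "x \<in> K" "K \<subseteq> V"
  shows "card (D x \<inter> K) + card (N x \<inter> K) + 1 = card K"
proof -
  have "K = insert x ((D x \<inter> K) \<union> (N x \<inter> K))" using assms by (auto simp: D_def E_def N_def)
  moreover have "x \<notin> (D x \<inter> K) \<union> (N x \<inter> K)" "(D x \<inter> K) \<inter> (N x \<inter> K) = {}"
    using A_irr by (auto simp: D_def E_def N_def)
  ultimately show ?thesis
    using card_insert_disjoint[of "(D x \<inter> K) \<union> (N x \<inter> K)" x] card_Un_disjoint[of "D x \<inter> K" "N x \<inter> K"]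
    by (simp add: finD finN)
qed

lemma card_D_N_V: "x \<in> V \<Longrightarrow> card (D x) + card (N x) + 1 = card V"
  using card_D_N[of x V] D_V N_V by (simp add: Int_absorb2)

lemma card_le_D:
  assumes "card (N x \<inter> K) \<le> 3" "T \<subseteq> K" "K \<subseteq> V" "x \<in> K"
  shows "card T \<le> card (D x \<inter> T) + 4" and "x \<notin> T \<Longrightarrow> card T \<le> card (D x \<inter> T) + 3"
proof -
  have finT: "finite T" using assms finV finite_subset by metis
  have NT: "card (N x \<inter> T) \<le> 3"
    using assms(1,2) card_mono[of "N x \<inter> K" "N x \<inter> T"] finN by fastforce
  have 1: "card T \<le> card (D x \<inter> T) + card (N x \<inter> T) + card ({x} \<inter> T)"
  proof -
    have "T \<subseteq> (D x \<inter> T) \<union> (N x \<inter> T) \<union> ({x} \<inter> T)"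
      using assms by (auto simp: D_def E_def N_def)
    then have "card T \<le> card ((D x \<inter> T) \<union> (N x \<inter> T) \<union> ({x} \<inter> T))"
      using finT by (intro card_mono) auto
    also have "\<dots> \<le> card (D x \<inter> T) + card (N x \<inter> T) + card ({x} \<inter> T)"
      by (meson add_mono card_Un_le le_refl order_trans)
    finally show ?thesis .
  qed
  have "card ({x} \<inter> T) \<le> 1" by (simp add: Int_insert_left)
  with 1 NT show "card T \<le> card (D x \<inter> T) + 4" by linarith
  show "card T \<le> card (D x \<inter> T) + 3" if "x \<notin> T" using 1 NT that by simp
qed

text \<open>Four complement neighbours of \<open>h\<close> on its own side and four vertices of the
  other side would alternate on the rim of a wheel with hub \<open>h\<close>.\<close>

lemma join_card_N_le:
  assumes "4 \<le> card Q" "h \<in> P" and PQ: "\<And>p q. p \<in> P \<Longrightarrow> q \<in> Q \<Longrightarrow> A p q"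
  shows "card (N h \<inter> P) \<le> 3"
proof (rule ccontr)
  assume "\<not> ?thesis"
  then have "4 \<le> card (N h \<inter> P)" by simp
  then show False
  proof (rule no_join_wheel[of _ h Q])
    show "A h x" if "x \<in> N h \<inter> P" for x using that by (simp add: N_def)
  qed (use assms in blast)+
qed

text \<open>A rim vertex taken from \<open>R\<close> must avoid at most one exception each for the
  hub and its two rim neighbours. Thus \<open>7 - 3 = 4\<close> candidates remain for each of the
  four places, enough for distinct choices.\<close>

lemma no_near_join_wheel:
  assumes S: "S \<subseteq> N h" "4 \<le> card S" and R: "7 \<le> card R" "R \<subseteq> V" "R \<inter> insert h S = {}"
    and few: "\<And>s. s \<in> insert h S \<Longrightarrow> card (D s \<inter> R) \<le> 1"
  shows False
proof -
  obtain a b c d where q: "{a,b,c,d} \<subseteq> S" "distinct [a,b,c,d]" using ex_four[OF S(2)] .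
  have "S \<noteq> {}" using S(2) by auto
  then have hV: "h \<in> V" using S(1) A_V by (auto simp: N_def)
  have SV: "S \<subseteq> V" using S(1) N_V by blast
  define G where "G x y = R - (D h \<union> D x \<union> D y)" for x y
  have big: "4 \<le> card (G x y)" if "x \<in> S" "y \<in> S" for x y
  proof -
    have "R \<subseteq> G x y \<union> ((D h \<inter> R) \<union> (D x \<inter> R) \<union> (D y \<inter> R))" by (auto simp: G_def)
    moreover have finR: "finite R" using R finV finite_subset by blast
    ultimately have "card R \<le> card (G x y \<union> ((D h \<inter> R) \<union> (D x \<inter> R) \<union> (D y \<inter> R)))"
      by (intro card_mono) (auto simp: G_def)
    also have "\<dots> \<le> card (G x y) + (card (D h \<inter> R) + card (D x \<inter> R) + card (D y \<inter> R))"
      by (meson add_mono card_Un_le le_refl order_trans)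
    also have "\<dots> \<le> card (G x y) + 3" using few[of h] few[of x] few[of y] that by simp
    finally show ?thesis using R by linarith
  qed
  obtain e f g i where y: "e \<in> G a b" "f \<in> G b c" "g \<in> G c d" "i \<in> G d a" "distinct [e,f,g,i]"
    by (rule ex_distinct_representatives4[of "G a b" "G b c" "G c d" "G d a"]) (use big q in auto)
  have adj: "A x y" if "y \<in> R" "y \<notin> D x" "x \<in> insert h S" for x y
    using A_iff[of x y] that R SV hV by blast
  have "h \<notin> S" using S(1) A_irr by (auto simp: N_def)
  then have "distinct [h,a,b,c,d,e,f,g,i]" using q y R(3) by (auto simp: G_def)
  moreover have "A h x" if "x \<in> S" for x using S(1) that by (auto simp: N_def)
  ultimately show False
    using no_alternating_wheel[of h a b c d e f g i] adj q(1) y by (auto simp: G_def)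
qed

lemma near_complete_centre_has_trees:
  assumes n: "8 \<le> n" and K: "K \<subseteq> V" "n \<le> card K" "\<And>x. x \<in> K \<Longrightarrow> card (N x \<inter> K) \<le> 3"
    and q: "q \<in> K" "n - 2 \<le> card (D q \<inter> K)"
  shows "has_S12 E n \<and> has_S21 E n \<and> has_S3 E n"
proof -
  have finK: "finite K" using K(1) finV finite_subset by blast
  \<comment> \<open>In all three trees \<open>z\<close> will be attached to the centre only through
    \<open>a\<close>. Either it is a non-neighbour of \<open>q\<close>, or \<open>q\<close> sees all
    other vertices of \<open>K\<close> and can spare one; both ways \<open>M\<close> keeps
    \<open>n - 2\<close> neighbours.\<close>
  obtain z where z: "z \<in> K" "z \<noteq> q" "z \<notin> D q \<or> K - {q} \<subseteq> D q"
  proof (cases "K - {q} \<subseteq> D q")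
    case True
    have "card (K - {q}) \<noteq> 0" using K n q finK by simp
    then have "K - {q} \<noteq> {}" by (metis card.empty)
    then show ?thesis using that True by blast
  next
    case False
    then show ?thesis using that by blast
  qed
  define M where "M = D q \<inter> K - {z}"
  have finM: "finite M" and MK: "M \<subseteq> K" and zM: "z \<notin> M" and MD: "M \<subseteq> D q" using finK by (auto simp: M_def)
  have M: "n - 2 \<le> card M"
  proof (cases "z \<in> D q")
    case True
    then have "M = K - {q} - {z}" using z D_irr by (auto simp: M_def)
    then show ?thesis using K(2) q z finK by simp
  next
    case False
    then show ?thesis using q by (simp add: M_def)
  qed
  have qM: "q \<notin> M" using D_irr by (auto simp: M_def)
  have "3 \<le> card (D z \<inter> M)" using card_le_D(2)[OF K(3)[OF z(1)] MK K(1) z(1) zM] M n by linarith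
  then obtain a c where a: "a \<in> D z \<inter> M" and c: "c \<in> D z \<inter> M" and ac: "a \<noteq> c"
    by (metis One_nat_def card_le_Suc0_iff_eq finM finite_Int not_less_eq_eq numeral_3_eq_3 le_SucI)
  have Dq: "card (M - T) \<le> card (D q - insert z T)" for T
    using MD zM finD by (intro card_mono) auto
  have Mminus: "card M - card T \<le> card (M - T)" if "finite T" for T
    using diff_card_le_card_Diff[OF that] .
  have nn: "q \<noteq> a" "q \<noteq> c" "z \<noteq> a" "z \<noteq> c" using a c qM zM by auto
  have "has_S12 E n" unfolding has_S12_def
  proof (intro exI conjI)
    show "distinct [q,a,z,c]" using nn ac z by auto
    show "E q a" "E a z" "E z c" using a c MD E_sym by (auto simp: D_def)
    have "n - 4 \<le> card (D q - insert z {a,c})" using Dq[of "{a,c}"] Mminus[of "{a,c}"] M ac by simp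
    then show "n - 4 \<le> card ({u. E q u} - {a,z,c})" by (simp add: D_def insert_commute)
  qed
  moreover have "has_S3 E n" unfolding has_S3_def
  proof -
    have "a \<in> K" using a MK by auto
    then have "D a \<inter> M \<noteq> {}" using card_le_D(1)[OF K(3)[of a] MK K(1)] M n by fastforce
    then obtain b where b: "b \<in> D a" "b \<in> M" by auto
    then have nb: "b \<noteq> a" "b \<noteq> z" "b \<noteq> q" using D_irr zM qM by auto
    have "distinct [q,a,z,b]" using nn nb z by auto
    moreover have "E q a" "E a z" "E a b" using a b MD E_sym by (auto simp: D_def)
    moreover have "n - 4 \<le> card (D q - insert z {a,b})" using Dq[of "{a,b}"] Mminus[of "{a,b}"] M nb by simp
    then have "n - 4 \<le> card ({u. E q u} - {a,z,b})" by (simp add: D_def insert_commute)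
    ultimately show "\<exists>v a b c. distinct [v,a,b,c] \<and> E v a \<and> E a b \<and> E a c \<and> n - 4 \<le> card ({u. E v u} - {a,b,c})"
      by blast
  qed
  moreover have "has_S21 E n" unfolding has_S21_def
  proof -
    have "c \<in> K" using c MK by auto
    moreover have "n - 3 \<le> card (M - {a})" using Mminus[of "{a}"] M by simp
    ultimately have "D c \<inter> (M - {a}) \<noteq> {}"
      using card_le_D(1)[OF K(3)[of c], of "M - {a}"] MK K(1) n by fastforce
    then obtain b where b: "b \<in> D c" "b \<in> M" "b \<noteq> a" by auto
    then have nb: "b \<noteq> c" "b \<noteq> z" "b \<noteq> q" using D_irr zM qM by auto
    have "distinct [q,a,z,c,b]" using nn nb z b ac by auto
    moreover have "E q a" "E a z" "E q c" "E c b" using a b c MD E_sym by (auto simp: D_def)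
    moreover have "n - 5 \<le> card (D q - insert z {a,c,b})"
      using Dq[of "{a,c,b}"] Mminus[of "{a,c,b}"] M nb b ac by simp
    then have "n - 5 \<le> card ({u. E q u} - {a,z,c,b})" by (simp add: D_def insert_commute)
    ultimately show "\<exists>v a b c d. distinct [v,a,b,c,d] \<and> E v a \<and> E a b \<and> E v c \<and> E c d \<and> n - 5 \<le> card ({u. E v u} - {a,b,c,d})"
      by blast
  qed
  ultimately show ?thesis by blast
qed

text \<open>This is where the parity of \<open>n\<close> enters: the complement cannot be cubic on \<open>n + 1\<close> vertices.\<close>

lemma near_complete_has_trees:
  assumes n: "8 \<le> n" "even n" and K: "K \<subseteq> V" "n + 1 \<le> card K" "\<And>x. x \<in> K \<Longrightarrow> card (N x \<inter> K) \<le> 3"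
  shows "has_S12 E n \<and> has_S21 E n \<and> has_S3 E n"
proof -
  have finK: "finite K" using K(1) finV finite_subset by blast
  have "\<exists>q\<in>K. n - 2 \<le> card (D q \<inter> K)"
  proof (rule ccontr)
    assume "\<not> ?thesis"
    then have less: "card (D q \<inter> K) < n - 2" if "q \<in> K" for q using that by force
    have eq: "card (N q \<inter> K) = 3 \<and> card K = n + 1" if "q \<in> K" for q
      using less[OF that] card_D_N[OF that K(1)] K(2) K(3)[OF that] n by linarith
    have "K \<noteq> {}" using K(2) by auto
    then have cK: "card K = n + 1" using eq by blast
    have "deg_in A K x = 3" if "x \<in> K" for x
    proof -
      have "{u \<in> K. A x u} = N x \<inter> K" by (auto simp: N_def)
      then show ?thesis using eq[OF that] by (simp add: deg_in_def)
    qed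
    then have "(\<Sum>x\<in>K. deg_in A K x) = 3 * (n + 1)" using cK by simp
    moreover have "even (\<Sum>x\<in>K. deg_in A K x)"
      by (rule even_sum_deg_in[OF finK]) (use A_sym A_irr in blast)+
    ultimately show False using n by simp
  qed
  then show ?thesis using near_complete_centre_has_trees[of n K] n K by (meson add_leD1)
qed

end

section \<open>The tree with two edges subdivided once\<close>

context w8_free begin


lemma card_D_Diff: "card (D v) - card T \<le> card (D v - T)" if "finite T" for T
  using diff_card_le_card_Diff[OF that] .

lemma card_outside:
  assumes "v \<in> V"
  shows "card (V - {v} - D v) + card (D v) + 1 = card V"
proof -
  have "V - {v} - D v = N v"
    using assms N_V A_irr by (auto simp: D_def E_def N_def)
  then show ?thesis using card_D_N_V[OF assms] by simp
qed

lemma large_degree_has_S21: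
  assumes n: "8 \<le> n" "even n" and V: "card V = 2 * n"
    and v: "v \<in> V" "n - 3 \<le> card (D v)"
  shows "has_S21 E n"
proof (rule ccontr)
  assume no: "\<not> has_S21 E n"
  have no': "card (D v - {a,b,c,d}) < n - 5" if "E v a" "E a b" "E v c" "E c d" "distinct [v,a,b,c,d]" for a b c d
  proof (rule ccontr)
    assume "\<not> ?thesis"
    then have "n - 5 \<le> card ({u. E v u} - {a,b,c,d})" by (simp add: D_def)
    then have "has_S21 E n" unfolding has_S21_def using that by blast
    then show False using no by blast
  qed
  show False
  proof (cases "n - 1 \<le> card (D v)")
    case True
    have disj: False if "E v a" "E a b" "E v c" "E c d" "distinct [v,a,b,c,d]" for a b c d
    proof -
      have "card {a,b,c,d} \<le> 4" using card_length[of "[a,b,c,d]"] by simp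
      then show False using no'[OF that] card_D_Diff[of "{a,b,c,d}" v] True n by simp
    qed
    \<comment> \<open>Two disjoint branches of length two would complete the tree. So fix one
      branch, if any: the other neighbours of \<open>v\<close> have no edges except into
      \<open>{v,s,t}\<close>. If there is no branch at all, \<open>t\<close> is a dummy equal to
      \<open>s\<close>.\<close>
    obtain s t where st: "s \<in> D v" "\<And>x y. x \<in> D v - {s,t} \<Longrightarrow> E x y \<Longrightarrow> y \<in> {v,s,t}"
    proof (cases "\<exists>s t. s \<in> D v \<and> E s t \<and> t \<noteq> v")
      case True
      then obtain s t where st: "s \<in> D v" "E s t" "t \<noteq> v" by blast
      show ?thesis
      proof (rule that[of s t])
        fix x y assume x: "x \<in> D v - {s,t}" "E x y"
        show "y \<in> {v,s,t}"
        proof (rule ccontr)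
          assume "y \<notin> {v,s,t}"
          then have "distinct [v,s,t,x,y]" using x st by (auto simp: D_def E_def)
          then show False using disj[of s t x y] x st by (auto simp: D_def)
        qed
      qed (rule st)
    next
      case False
      have "D v \<noteq> {}" using True n by auto
      then obtain s where "s \<in> D v" by blast
      then show ?thesis using that[of s s] False by blast
    qed
    define Q where "Q = D v - {s,t}"
    have Q: "card (D v) \<le> card Q + 2"
      unfolding Q_def using card_D_Diff[of "{s,t}" v] by (simp add: card_insert_if split: if_splits)
    have adj: "A x y" if "x \<in> Q" "y \<in> V - {v,s,t}" "x \<noteq> y" for x y
      using st(2)[of x y] that D_V by (auto simp: E_def Q_def)
    obtain h where h: "h \<in> Q" using Q True n by fastforce
    have "4 \<le> card (Q - {h})" using Q True n h finD by (simp add: Q_def)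
    then obtain X where X: "X \<subseteq> Q - {h}" "card X = 4" by (meson obtain_subset_with_card_n)
    have "card ({v,s,t,h} \<union> X) \<le> card {v,s,t,h} + card X" by (rule card_Un_le)
    moreover have "card {v,s,t,h} \<le> 4" using card_length[of "[v,s,t,h]"] by simp
    moreover have "finite ({v,s,t,h} \<union> X)" using X(2) by (simp add: card_ge_0_finite)
    then have "card V - card ({v,s,t,h} \<union> X) \<le> card (V - ({v,s,t,h} \<union> X))"
      by (rule diff_card_le_card_Diff)
    ultimately have Y: "4 \<le> card (V - ({v,s,t,h} \<union> X))" using V n X(2) by linarith
    show False
    proof (rule no_join_wheel[of X h "V - ({v,s,t,h} \<union> X)"])
      show "4 \<le> card X" using X by simp
      show "A h x" if "x \<in> X" for x using adj[of h x] h X that D_V D_irr by (auto simp: Q_def)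
      show "A h y" if "y \<in> V - ({v,s,t,h} \<union> X)" for y using adj[of h y] h that by auto
      show "A x y" if "x \<in> X" "y \<in> V - ({v,s,t,h} \<union> X)" for x y using adj[of x y] X that by auto
    qed (rule Y)
  next
    case small: False
    define B where "B = V - {v} - D v"
    have B: "card B + card (D v) + 1 = 2 * n"
      using card_outside[OF v(1)] V by (simp add: B_def)
    show False
    proof (cases "\<exists>a\<in>D v. \<exists>b\<in>B. E a b")
      case True
      then obtain a b where ab: "a \<in> D v" "b \<in> B" "E a b" by blast
      \<comment> \<open>The edge \<open>ab\<close> already gives one branch. A graph edge between
        \<open>P\<close> and \<open>Q\<close> would give a second one disjoint from it, so these
        sets are completely joined in the complement.\<close>
      define P where "P = insert v (D v - {a})"
      define Q where "Q = B - {b}"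
      have vab: "E v a" "v \<noteq> a" "v \<noteq> b" "a \<noteq> b" using ab by (auto simp: D_def E_def B_def)
      have join: "A p q" if "p \<in> P" "q \<in> Q" for p q
      proof (rule ccontr)
        assume "\<not> A p q"
        then have pq: "E p q" "p \<noteq> v" using that D_V v by (auto simp: P_def Q_def B_def E_def D_def)
        then have p: "p \<in> D v" "p \<noteq> a" using that by (auto simp: P_def)
        have "distinct [v,a,b,p,q]" using vab p pq ab that by (auto simp: Q_def B_def)
        then have "card (D v - {a,b,p,q}) < n - 5" using no'[of a b p q] p pq ab by (auto simp: D_def)
        moreover have "D v - {a,b,p,q} = D v - {a,p}" using ab that by (auto simp: Q_def B_def)
        ultimately show False using card_D_Diff[of "{a,p}" v] v n p by simp
      qed
      have cP: "card P = card (D v)" using card.remove[OF finD ab(1)] D_irr finD by (simp add: P_def)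
      have "finite B" using finV by (simp add: B_def)
      then have "card B = Suc (card Q)" using card.remove[OF _ ab(2)] by (simp add: Q_def)
      then have cQ: "card Q + card (D v) + 2 = 2 * n" using B by linarith
      have NQ: "card (N x \<inter> Q) \<le> 3" if "x \<in> Q" for x
        by (rule join_card_N_le[of P]) (use that cP v n join A_sym in auto)
      have QV: "Q \<subseteq> V" by (auto simp: Q_def B_def)
      show False
      proof (cases "card (D v) = n - 3")
        case True
        then have "n + 1 \<le> card Q" using cQ n by linarith
        then show False using near_complete_has_trees[OF n QV _ NQ] no by blast
      next
        case False
        \<comment> \<open>Here \<open>Q\<close> has only \<open>n\<close> vertices, one too few for
          the parity argument. Instead the second branch \<open>v, c, e\<close> is found inside
          \<open>D v\<close>, which leaves exactly the required \<open>n - 5\<close> leaves.\<close>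
        then have d: "card (D v) = n - 2" using small v by linarith
        then have cQ4: "4 \<le> card Q" using cQ n by linarith
        have NP: "card (N x \<inter> P) \<le> 3" if "x \<in> P" for x
          by (rule join_card_N_le[of Q]) (use that cQ4 join in auto)
        have "card (D v - {a}) \<noteq> 0" using d n ab by simp
        then have "D v - {a} \<noteq> {}" by (metis card.empty)
        then obtain c where c: "c \<in> D v - {a}" by blast
        have PV: "P \<subseteq> V" and cP': "c \<in> P" "D v - {a} \<subseteq> P" using c D_V v by (auto simp: P_def)
        have "card (D v - {a}) = n - 3" using d ab by simp
        then have "card (D c \<inter> (D v - {a})) \<noteq> 0"
          using card_le_D(1)[OF NP[OF cP'(1)] cP'(2) PV cP'(1)] n by linarith
        then have "D c \<inter> (D v - {a}) \<noteq> {}" by (metis card.empty)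
        then obtain e where e: "e \<in> D c" "e \<in> D v - {a}" by blast
        have "distinct [v,a,b,c,e]" using c e vab ab D_irr by (auto simp: B_def)
        then have "card (D v - {a,b,c,e}) < n - 5" using no'[of a b c e] c e ab by (auto simp: D_def)
        moreover have "D v - {a,b,c,e} = D v - {a,c,e}" using ab by (auto simp: B_def)
        moreover have "card {a,c,e} \<le> 3" by (simp add: card_insert_if)
        ultimately show False using card_D_Diff[of "{a,c,e}" v] d n by simp
      qed
    next
      case False
      define P where "P = insert v (D v)"
      have join: "A p q" if "p \<in> P" "q \<in> B" for p q
      proof (cases "p = v")
        case True
        then show ?thesis using A_iff[of v q] that v by (auto simp: B_def)
      next
        case False
        then have "p \<in> D v" using that by (simp add: P_def)
        then have "\<not> E p q" using \<open>\<not> (\<exists>a\<in>D v. \<exists>b\<in>B. E a b)\<close> that by blast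
        then show ?thesis using \<open>p \<in> D v\<close> that D_V by (auto simp: E_def B_def)
      qed
      have cP: "4 \<le> card P" using v n finD D_irr by (simp add: P_def)
      have NB: "card (N x \<inter> B) \<le> 3" if "x \<in> B" for x
        by (rule join_card_N_le[of P]) (use that cP join A_sym in auto)
      have "B \<subseteq> V" "n + 1 \<le> card B" using B small by (auto simp: B_def)
      then show False using near_complete_has_trees[OF n _ _ NB] no by blast
    qed
  qed
qed


section \<open>The tree with one edge subdivided twice\<close>

lemma ex_near_join_wheel:
  assumes n: "8 \<le> n" and V: "card V = 2 * n"
    and h: "h \<in> V" "h \<noteq> v" "card (D h) \<le> 2"
    and R: "7 \<le> card (D v - {h})" and few: "\<And>w. w \<in> V - {v} \<Longrightarrow> card (D w \<inter> D v) \<le> 1"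
  shows False
proof -
  obtain T where T: "T \<subseteq> D v - {h}" "card T = 7" using R by (meson obtain_subset_with_card_n)
  define S where "S = N h - insert v T"
  have finT: "finite T" using T(2) by (simp add: card_ge_0_finite)
  have "card (N h) - card (insert v T) \<le> card S"
    unfolding S_def using finT by (intro diff_card_le_card_Diff) simp
  moreover have "card (insert v T) \<le> 8" using T(2) finT by (simp add: card_insert_if)
  moreover have "card (D h) + card (N h) + 1 = 2 * n" using card_D_N_V[OF h(1)] V by simp
  \<comment> \<open>The hub \<open>h\<close> has at least \<open>2 * n - 3\<close> complement
    neighbours; setting aside \<open>v\<close> and the seven vertices of \<open>T\<close> leaves
    \<open>2 * n - 11\<close>, at least five.\<close>
  ultimately have S: "4 \<le> card S" using h(3) n by linarith
  show False
  proof (rule no_near_join_wheel[of S h T])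
    show "S \<subseteq> N h" by (auto simp: S_def)
    show "7 \<le> card T" using T by simp
    show "T \<subseteq> V" using T D_V by blast
    show "T \<inter> insert h S = {}" using T by (auto simp: S_def)
    fix s assume "s \<in> insert h S"
    then have "s \<in> V - {v}" using h N_V by (auto simp: S_def)
    moreover have "card (D s \<inter> T) \<le> card (D s \<inter> D v)" using T finD by (intro card_mono) auto
    ultimately show "card (D s \<inter> T) \<le> 1" using few[of s] by linarith
  qed (rule S)
qed

text \<open>Remove one path \<open>x y z\<close>. If the rest \<open>R\<close> has no path on three
  vertices, its inner degrees are at most 1, so each of its at least five vertices sends an edge to
  the path, which can take only \<open>2 + 1 + 2 = 5\<close>. Equality throughout makes the degree
  sum in \<open>R\<close> equal to 5, which is odd.\<close>

lemma two_disjoint_path3: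
  assumes fin: "finite K" "8 \<le> card K" and deg: "\<And>x. x \<in> K \<Longrightarrow> 2 \<le> deg_in A K x \<and> deg_in A K x \<le> 3"
  shows "\<exists>a b c d e f. {a,b,c,d,e,f} \<subseteq> K \<and> distinct [a,b,c,d,e,f] \<and> A a b \<and> A b c \<and> A d e \<and> A e f" (is ?goal)
proof (rule ccontr)
  assume no: "\<not> ?thesis"
  have two: "\<exists>x z. x \<in> S \<and> z \<in> S \<and> x \<noteq> z \<and> A y x \<and> A y z" if "2 \<le> deg_in A S y" for S y
    using that by (auto simp: deg_in_def card_le_Suc_iff numeral_2_eq_2)
  obtain y where y: "y \<in> K" using fin by fastforce
  obtain x z where xz: "x \<in> K" "z \<in> K" "x \<noteq> z" "A y x" "A y z" using two[of K y] deg[OF y] by blast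
  have ne: "x \<noteq> y" "z \<noteq> y" using xz A_irr by auto
  define R where "R = K - {x,y,z}"
  have finR: "finite R" and RK: "R \<subseteq> K" using fin by (auto simp: R_def)
  have K: "K = R \<union> {x,y,z}" "R \<inter> {x,y,z} = {}" using xz y by (auto simp: R_def)
  have "card (R \<union> {x,y,z}) = card R + card {x,y,z}"
    by (rule card_Un_disjoint[OF finR _ K(2)]) simp
  moreover have "card {x,y,z} = 3" using xz(3) ne by simp
  ultimately have cR: "card K = card R + 3" using K(1) by simp
  have le1: "deg_in A R r \<le> 1" if "r \<in> R" for r
  proof (rule ccontr)
    assume "\<not> deg_in A R r \<le> 1"
    then obtain s t where st: "s \<in> R" "t \<in> R" "s \<noteq> t" "A r s" "A r t" using two[of R r] by auto
    moreover have "r \<noteq> s" "r \<noteq> t" using calculation A_irr by auto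
    ultimately have "{x,y,z,s,r,t} \<subseteq> K \<and> distinct [x,y,z,s,r,t] \<and> A x y \<and> A y z \<and> A s r \<and> A r t"
      using xz y ne that A_sym[of y x] A_sym[of r s] by (auto simp: R_def)
    then have ?goal by (intro exI, assumption)
    then show False using no by simp
  qed
  have split: "deg_in A K w = deg_in A R w + deg_in A {x,y,z} w" for w
    unfolding K(1) by (rule deg_in_Un) (use finR K(2) in auto)
  have "deg_in A {x,y,z} w \<noteq> 0" if "w = x \<or> w = z" for w
    using that xz(4,5) A_sym by (auto simp: deg_in_def)
  then have "deg_in A R x \<le> 2" "deg_in A R z \<le> 2"
    using split[of x] split[of z] deg[of x] deg[of z] xz by fastforce+
  moreover have "{x, z} \<subseteq> {u \<in> {x,y,z}. A y u}" using xz by auto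
  then have "card {x, z} \<le> deg_in A {x,y,z} y" unfolding deg_in_def by (intro card_mono) auto
  then have "deg_in A R y \<le> 1" using split[of y] deg[OF y] xz(3) by simp
  ultimately have "(\<Sum>t\<in>{x,y,z}. deg_in A R t) \<le> 5" using xz(3) ne by simp
  moreover have "(\<Sum>r\<in>R. deg_in A {x,y,z} r) = (\<Sum>t\<in>{x,y,z}. deg_in A R t)"
    by (rule sum_deg_in_swap) (use finR A_sym in auto)
  moreover have "2 * card R \<le> (\<Sum>r\<in>R. deg_in A K r)"
    using sum_bounded_below[of R 2 "deg_in A K"] deg RK by (auto simp: mult.commute)
  moreover have "(\<Sum>r\<in>R. deg_in A K r) = (\<Sum>r\<in>R. deg_in A R r) + (\<Sum>r\<in>R. deg_in A {x,y,z} r)"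
    by (simp add: split sum.distrib)
  moreover have "(\<Sum>r\<in>R. deg_in A R r) \<le> card R"
    using sum_bounded_above[of R "deg_in A R" 1] le1 by simp
  ultimately have "(\<Sum>r\<in>R. deg_in A R r) = 5" using cR fin(2) by linarith
  moreover have "even (\<Sum>r\<in>R. deg_in A R r)"
    by (rule even_sum_deg_in[OF finR]) (use A_sym A_irr in blast)+
  ultimately show False by simp
qed

lemma deg_in_A: "deg_in A K x = card (N x \<inter> K)"
  unfolding deg_in_def N_def by (rule arg_cong[of _ _ card]) auto

lemma large_degree_has_S12:
  assumes n: "8 \<le> n" "even n" and V: "card V = 2 * n"
    and v: "v \<in> V" "n - 3 \<le> card (D v)"
  shows "has_S12 E n"
proof (rule ccontr)
  assume no: "\<not> has_S12 E n"
  have no': "card (D v - {a,b,c}) < n - 4" if "E v a" "E a b" "E b c" "distinct [v,a,b,c]" for a b c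
  proof (rule ccontr)
    assume "\<not> ?thesis"
    then have "n - 4 \<le> card ({u. E v u} - {a,b,c})" by (simp add: D_def)
    then have "has_S12 E n" unfolding has_S12_def using that by blast
    then show False using no by blast
  qed
  define B where "B = V - {v} - D v"
  \<comment> \<open>These vertices are at distance two from \<open>v\<close> in the graph. A graph
    edge from one of them to another vertex of \<open>B\<close> would finish a path
    \<open>v a b c\<close> with enough leaves left over, so \<open>B1\<close> is joined in the
    complement to the rest of \<open>B\<close> and may be moved to the side of
    \<open>D v\<close>.\<close>
  define B1 where "B1 = {b \<in> B. D b \<inter> D v \<noteq> {}}"
  define B0 where "B0 = B - B1"
  define P where "P = insert v (D v \<union> B1)"
  have finB: "finite B" "finite B1" "finite B0" using finV by (auto simp: B_def B1_def B0_def)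
  have cB: "card B + card (D v) + 1 = 2 * n" using card_outside[OF v(1)] V by (simp add: B_def)
  have cB01: "card B = card B0 + card B1"
    using card_Un_disjoint[of B0 B1] finB by (auto simp: B0_def B1_def Un_absorb2 intro: arg_cong[of _ _ card])
  have B1_B: "A b c" if bB1: "b \<in> B1" and "c \<in> B" "b \<noteq> c" for b c
  proof (rule ccontr)
    assume "\<not> A b c"
    then have bc: "E b c" using that by (auto simp: E_def B_def B1_def)
    obtain a where a: "a \<in> D b" "a \<in> D v" using bB1 by (auto simp: B1_def)
    have "distinct [v,a,b,c]" using that a by (auto simp: B_def B1_def D_def E_def)
    then have "card (D v - {a,b,c}) < n - 4" using no'[of a b c] a bc E_sym by (auto simp: D_def)
    moreover have "D v - {a,b,c} = D v - {a}" using that by (auto simp: B_def B1_def)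
    ultimately show False using v a by simp
  qed
  have v_B: "A v b" if "b \<in> B" for b using A_iff[of v b] that v by (auto simp: B_def)
  have P_B0: "A p q" if "p \<in> P" "q \<in> B0" for p q
  proof -
    have "p = v \<or> p \<in> D v \<or> p \<in> B1" using that by (auto simp: P_def)
    then consider "p = v" | "p \<in> D v" | "p \<in> B1" by blast
    then show ?thesis
    proof cases
      case 1 then show ?thesis using v_B that by (auto simp: B0_def)
    next
      case 2
      then have "q \<notin> D p" "p \<noteq> q" using that D_sym[of q p] by (auto simp: B0_def B1_def B_def)
      then show ?thesis using A_iff[of p q] 2 that D_V by (auto simp: B0_def B_def)
    next
      case 3 then show ?thesis using B1_B[of p q] that by (auto simp: B0_def)
    qed
  qed
  have PV: "P \<subseteq> V" "B0 \<subseteq> V" using v D_V by (auto simp: P_def B_def B0_def B1_def)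
  have "card P = 1 + (card (D v) + card B1)"
    unfolding P_def using finD finB D_irr
    by (subst card_insert_disjoint, simp, force simp: B1_def B_def, subst card_Un_disjoint) (auto simp: B1_def B_def)
  then have cP: "card P + card B0 = 2 * n" "card P = 1 + (card (D v) + card B1)" using cB cB01 by auto
  show False
  proof (cases "n - 1 \<le> card (D v)")
    case True
    \<comment> \<open>Two neighbours of \<open>w\<close> in \<open>D v\<close> give the path
      \<open>v a w c\<close>, and \<open>n - 1\<close> neighbours less three leave
      \<open>n - 4\<close> leaves.\<close>
    have few: "card (D w \<inter> D v) \<le> 1" if "w \<in> V - {v}" for w
    proof (rule ccontr)
      assume "\<not> ?thesis"
      then obtain a c where ac: "a \<in> D w \<inter> D v" "c \<in> D w \<inter> D v" "a \<noteq> c"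
        by (auto simp: card_le_Suc0_iff_eq[OF finite_Int[OF disjI1[OF finD]]])
      have "distinct [v,a,w,c]" using that ac by (auto simp: D_def E_def)
      then have "card (D v - {a,w,c}) < n - 4" using no'[of a w c] ac E_sym by (auto simp: D_def)
      moreover have "card {a,w,c} \<le> 3" using card_length[of "[a,w,c]"] by simp
      ultimately show False using card_D_Diff[of "{a,w,c}" v] True n by simp
    qed
    show False
    proof (cases "4 \<le> card B0")
      case True
      have "D v \<noteq> {}" using \<open>n - 1 \<le> card (D v)\<close> n by auto
      then obtain a where a: "a \<in> D v" by blast
      have "card (N a \<inter> D v) \<le> card (N a \<inter> P)" using finN by (intro card_mono) (auto simp: P_def)
      also have "\<dots> \<le> 3" by (rule join_card_N_le[OF True _ P_B0]) (use a in \<open>auto simp: P_def\<close>)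
      finally show False
        using card_D_N[OF a D_V] few[of a] a D_V D_irr \<open>n - 1 \<le> card (D v)\<close> n by fastforce
    next
      case False
      \<comment> \<open>The hub comes from \<open>D v\<close> when no vertex of \<open>B\<close>
        sees \<open>D v\<close>, since then \<open>B\<close> is tiny and \<open>D v\<close> huge;
        otherwise any vertex of \<open>B1\<close> works, as all its graph neighbours lie in
        \<open>D v\<close>.\<close>
      have "\<exists>h\<in>V - {v}. card (D h) \<le> 2 \<and> 7 \<le> card (D v - {h})"
      proof (cases "B1 = {}")
        case True
        then have "card B \<le> 3" using False cB01 by simp
        then have big: "12 \<le> card (D v)" using cB n by linarith
        then have "D v \<noteq> {}" by auto
        then obtain h where h: "h \<in> D v" by blast
        have "D h \<subseteq> insert v (D h \<inter> D v)"
        proof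
          fix u assume u: "u \<in> D h"
          show "u \<in> insert v (D h \<inter> D v)"
          proof (rule ccontr)
            assume "u \<notin> insert v (D h \<inter> D v)"
            then have "u \<in> B" using u D_V by (auto simp: B_def)
            moreover have "h \<in> D u \<inter> D v" using u h D_sym by blast
            ultimately have "u \<in> B1" by (auto simp: B1_def)
            then show False using True by simp
          qed
        qed
        then have "card (D h) \<le> card (insert v (D h \<inter> D v))" using finD by (intro card_mono) auto
        also have "\<dots> \<le> 2" using few[of h] h D_V D_irr finD by (auto simp: card_insert_if)
        finally show ?thesis using h D_V D_irr big by (intro bexI[of _ h]) auto
      next
        case False
        then obtain h where h: "h \<in> B1" by blast
        have "D h \<subseteq> D h \<inter> D v"
        proof
          fix u assume u: "u \<in> D h"
          have "\<not> A h u" using u by (auto simp: D_def E_def)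
          moreover have "A h v" using v_B[of h] h A_sym by (auto simp: B1_def)
          ultimately have "u \<notin> B" "u \<noteq> v" using B1_B[OF h, of u] u D_irr by auto
          then show "u \<in> D h \<inter> D v" using u D_V by (auto simp: B_def)
        qed
        then have "card (D h) \<le> card (D h \<inter> D v)" using finD by (intro card_mono) auto
        moreover have "D v - {h} = D v" "h \<in> V - {v}" using h by (auto simp: B1_def B_def)
        ultimately show ?thesis using few[of h] \<open>n - 1 \<le> card (D v)\<close> n by (intro bexI[of _ h]) auto
      qed
      then show False using ex_near_join_wheel[OF n(1) V _ _ _ _ few] by blast
    qed
  next
    case small: False
    show False
    proof (cases "4 \<le> card B0")
      case False
      \<comment> \<open>\<open>B\<close> has at least \<open>n + 1\<close> vertices, and
        \<open>B1\<close> is joined in the complement to all of \<open>B\<close>, itself included;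
        \<open>v\<close> is the hub.\<close>
      then have "4 \<le> card B1" using cB cB01 small n by linarith
      then obtain X where X: "X \<subseteq> B1" "card X = 4" by (meson obtain_subset_with_card_n)
      have "card B - card X \<le> card (B - X)"
        using X finB finite_subset by (intro diff_card_le_card_Diff) blast
      then have Y: "4 \<le> card (B - X)" using X cB small n by linarith
      show False
      proof (rule no_join_wheel[of X v "B - X"])
        show "4 \<le> card X" using X by simp
        show "A v x" if "x \<in> X" for x using v_B that X by (auto simp: B1_def)
        show "A v y" if "y \<in> B - X" for y using v_B that by auto
        show "A x y" if "x \<in> X" "y \<in> B - X" for x y using B1_B[of x y] that X by auto
      qed (rule Y)
    next
      case True
      have NP: "card (N x \<inter> P) \<le> 3" if "x \<in> P" for x
        by (rule join_card_N_le[OF True that P_B0])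
      have P4: "4 \<le> card P" using cP v n by linarith
      have NB: "card (N x \<inter> B0) \<le> 3" if "x \<in> B0" for x
        by (rule join_card_N_le[OF P4 that]) (use P_B0 A_sym in blast)
      have "\<not> n + 1 \<le> card P" using near_complete_has_trees[OF n PV(1) _ NP] no by blast
      moreover have "\<not> n + 1 \<le> card B0" using near_complete_has_trees[OF n PV(2) _ NB] no by blast
      ultimately have cn: "card P = n" "card B0 = n" using cP by linarith+
      have "card (D v) = n - 3 \<and> card B1 = 2 \<or> card (D v) = n - 2 \<and> card B1 = 1"
        using small v(2) cP(2) cn n by linarith
      then show False
      proof (elim disjE conjE)
        assume d: "card (D v) = n - 2" and "card B1 = 1"
        then obtain b where b: "B1 = {b}" by (auto simp: card_1_singleton_iff)
        have bP: "b \<in> P" "b \<in> B" using b by (auto simp: P_def B1_def)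
        \<comment> \<open>With \<open>n - 2\<close> neighbours at \<open>v\<close>, a path
          \<open>v a b c\<close> may use two of them. So \<open>b\<close> has at most one graph
          neighbour in \<open>P\<close> and therefore at least \<open>n - 2\<close> complement
          neighbours there, far above the cap of 3.\<close>
        have "card (D b \<inter> P) \<le> card (D b \<inter> D v)"
        proof (rule card_mono)
          have "b \<notin> D b" "v \<notin> D b" using bP D_irr D_sym[of v b] by (auto simp: B_def)
          then show "D b \<inter> P \<subseteq> D b \<inter> D v" by (auto simp: P_def b)
        qed (simp add: finD)
        also have "\<dots> \<le> 1"
        proof (rule ccontr)
          assume "\<not> ?thesis"
          then obtain a c where ac: "a \<in> D b \<inter> D v" "c \<in> D b \<inter> D v" "a \<noteq> c"
            by (auto simp: card_le_Suc0_iff_eq[OF finite_Int[OF disjI1[OF finD]]])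
          have "distinct [v,a,b,c]" using bP ac by (auto simp: D_def E_def B_def)
          then have "card (D v - {a,b,c}) < n - 4" using no'[of a b c] ac E_sym by (auto simp: D_def)
          moreover have "D v - {a,b,c} = D v - {a,c}" using bP by (auto simp: B_def)
          ultimately show False using card_D_Diff[of "{a,c}" v] d n ac by simp
        qed
        finally show False using card_D_N[OF bP(1) PV(1)] NP[OF bP(1)] cn n by linarith
      next
        assume d: "card (D v) = n - 3" and "card B1 = 2"
        txt \<open>Both sides may be complete multipartite with parts of sizes 3 and 4, hence free of the tree. So a
          wheel is needed: \<open>v\<close> is the hub, and two disjoint paths in \<open>B0\<close> are linked through \<open>B1\<close>.\<close>
        then obtain b c where bc: "B1 = {b,c}" "b \<noteq> c" by (auto simp: card_2_iff)
        \<comment> \<open>A vertex with at most one complement neighbour in \<open>B0\<close> would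
          have \<open>n - 2\<close> graph neighbours there and be a centre for the trees.\<close>
        have "2 \<le> deg_in A B0 x \<and> deg_in A B0 x \<le> 3" if "x \<in> B0" for x
        proof -
          have "\<not> n - 2 \<le> card (D x \<inter> B0)"
            using near_complete_centre_has_trees[of n B0 x] n(1) PV(2) NB that cn no by auto
          then show ?thesis using card_D_N[OF that PV(2)] cn n NB[OF that] by (simp add: deg_in_A)
        qed
        then obtain x1 x2 x3 y1 y2 y3 where xy: "{x1,x2,x3,y1,y2,y3} \<subseteq> B0" "distinct [x1,x2,x3,y1,y2,y3]"
          "A x1 x2" "A x2 x3" "A y1 y2" "A y2 y3"
          using two_disjoint_path3[OF finB(3)] cn n by metis
        have bcP: "b \<in> P" "c \<in> P" "v \<in> P" using bc by (auto simp: P_def)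
        have "B1 \<inter> B0 = {}" "v \<notin> B" "B1 \<subseteq> B" "B0 \<subseteq> B" by (auto simp: B_def B0_def B1_def)
        then have "distinct [v,b,x1,x2,x3,c,y1,y2,y3]" using bc xy(1,2) by auto
        moreover have "A v b" "A v c" using v_B bc \<open>B1 \<subseteq> B\<close> by auto
        ultimately show False
          using no_wheel[of v b x1 x2 x3 c y1 y2 y3] xy P_B0 bcP A_sym[of _ x3] A_sym[of _ y3]
          by auto
      qed
    qed
  qed
qed

end

section \<open>The tree from two joined stars\<close>

context w8_free begin

text \<open>Two vertices \<open>r\<close>, \<open>s\<close> that miss \<open>q1\<close> see all of
  \<open>q2, q3, q4\<close> and fill the places away from \<open>q1\<close>; two vertices
  \<open>p\<close>, \<open>t\<close> that see \<open>q1\<close> flank it. The rim is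
  \<open>q1 p x r y s z t\<close>, where \<open>x\<close> and \<open>z\<close> can be chosen
  distinct because \<open>p\<close> and \<open>t\<close> each miss at most one of the four.\<close>

lemma alternating_wheel_concentrated:
  assumes dist: "distinct [h,q1,q2,q3,q4]" and q: "A h q1" "A h q2" "A h q3" "A h q4"
    and P: "\<And>p. p \<in> P \<Longrightarrow> A h p" "P \<inter> {q1,q2,q3,q4} = {}"
    and one: "\<And>p. p \<in> P \<Longrightarrow> card ({q1,q2,q3,q4} - N p) \<le> 1"
    and miss: "2 \<le> card (P - N q1)" and hit: "2 \<le> card (P \<inter> N q1)"
  shows False
proof -
  have two: "\<exists>x y. x \<in> S \<and> y \<in> S \<and> x \<noteq> y" if "2 \<le> card S" for S :: "'a set"
    using that by (auto simp: card_le_Suc_iff numeral_2_eq_2)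
  have uniq: "x = y" if "p \<in> P" "x \<in> {q1,q2,q3,q4}" "y \<in> {q1,q2,q3,q4}" "\<not> A p x" "\<not> A p y" for p x y
  proof (rule ccontr)
    assume "x \<noteq> y"
    then have "card {x, y} = 2" by simp
    moreover have "{x, y} \<subseteq> {q1,q2,q3,q4} - N p" using that(2-5) by (simp add: N_def)
    then have "card {x, y} \<le> card ({q1,q2,q3,q4} - N p)" by (intro card_mono) auto
    ultimately show False using one[OF that(1)] by linarith
  qed
  obtain r s where rs: "r \<in> P - N q1" "s \<in> P - N q1" "r \<noteq> s" using two[OF miss] by blast
  obtain p t where pt: "p \<in> P \<inter> N q1" "t \<in> P \<inter> N q1" "p \<noteq> t" using two[OF hit] by blast
  have ne: "r \<noteq> p" "r \<noteq> t" "s \<noteq> p" "s \<noteq> t" using rs pt by auto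
  have adj: "A w x" if "w \<in> P - N q1" "x \<in> {q2,q3,q4}" for w x
  proof (rule ccontr)
    assume "\<not> A w x"
    moreover have "\<not> A w q1" using that(1) A_sym by (auto simp: N_def)
    ultimately have "x = q1" using uniq[of w x q1] that by blast
    then show False using that(2) dist by auto
  qed
  have hP: "h \<notin> P" using P(1) A_irr by auto
  have cyc: False if "{x,y,z} = {q2,q3,q4}" "distinct [x,y,z]" "A p x" "A t z" for x y z
  proof -
    have xyz: "x \<in> {q2,q3,q4}" "y \<in> {q2,q3,q4}" "z \<in> {q2,q3,q4}" using that by auto
    have "distinct [h,q1,x,y,z,p,r,s,t]" using dist that P(2) rs pt ne hP xyz by auto
    moreover have "A h x" "A h y" "A h z" using q xyz by auto
    moreover have "A h p" "A h r" "A h s" "A h t" using P(1) rs pt by blast+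
    moreover have "A x r" "A y r" "A y s" "A z s" using adj[OF rs(1)] adj[OF rs(2)] xyz A_sym by blast+
    moreover have "A x p" "A z t" using that(3,4) A_sym by blast+
    moreover have "A q1 p" "A q1 t" using pt by (auto simp: N_def)
    ultimately show False using no_alternating_wheel[of h q1 x y z p r s t] q(1) by blast
  qed
  have "A w x \<or> A w y" if "w \<in> P" "x \<in> {q1,q2,q3,q4}" "y \<in> {q1,q2,q3,q4}" "x \<noteq> y" for w x y
    using uniq[OF that(1-3)] that(4) by blast
  then have "A w q2 \<or> A w q3" "A w q2 \<or> A w q4" "A w q3 \<or> A w q4" if "w \<in> P" for w
    using that dist by auto
  then have "A p q2 \<or> A p q3" "A p q2 \<or> A p q4" "A p q3 \<or> A p q4" "A t q2 \<or> A t q3" "A t q2 \<or> A t q4" "A t q3 \<or> A t q4"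
    using pt by blast+
  then have "A p q2 \<and> A t q3 \<or> A p q2 \<and> A t q4 \<or> A p q3 \<and> A t q2 \<or> A p q3 \<and> A t q4 \<or> A p q4 \<and> A t q2 \<or> A p q4 \<and> A t q3"
    by blast
  then show False
  proof (elim disjE conjE)
    assume "A p q2" "A t q3" then show ?thesis using cyc[of q2 q4 q3] dist by auto
  next
    assume "A p q2" "A t q4" then show ?thesis using cyc[of q2 q3 q4] dist by auto
  next
    assume "A p q3" "A t q2" then show ?thesis using cyc[of q3 q4 q2] dist by auto
  next
    assume "A p q3" "A t q4" then show ?thesis using cyc[of q3 q2 q4] dist by auto
  next
    assume "A p q4" "A t q2" then show ?thesis using cyc[of q4 q3 q2] dist by auto
  next
    assume "A p q4" "A t q3" then show ?thesis using cyc[of q4 q2 q3] dist by auto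
  qed
qed

text \<open>If two vertices of \<open>P\<close> miss the same one of the four, the concentrated case
  applies. Otherwise any two of the four have at least \<open>6 - 2 = 4\<close> common neighbours in
  \<open>P\<close>, and the rim can be filled distinctly.\<close>

lemma no_alternating_wheel_spread:
  assumes dist: "distinct [h,q1,q2,q3,q4]" and q: "A h q1" "A h q2" "A h q3" "A h q4"
    and P: "\<And>p. p \<in> P \<Longrightarrow> A h p" "P \<inter> {q1,q2,q3,q4} = {}" "6 \<le> card P"
    and one: "\<And>p. p \<in> P \<Longrightarrow> card ({q1,q2,q3,q4} - N p) \<le> 1"
    and hit: "\<And>x. x \<in> {q1,q2,q3,q4} \<Longrightarrow> 2 \<le> card (P \<inter> N x)"
  shows False
proof -
  have le1: "card (P - N x) \<le> 1" if "x \<in> {q1,q2,q3,q4}" for x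
  proof (rule ccontr)
    assume "\<not> ?thesis"
    then have m: "2 \<le> card (P - N x)" by simp
    have perm: "{q2,q1,q3,q4} = {q1,q2,q3,q4}" "{q3,q1,q2,q4} = {q1,q2,q3,q4}" "{q4,q1,q2,q3} = {q1,q2,q3,q4}"
      by auto
    from that consider "x = q1" | "x = q2" | "x = q3" | "x = q4" by auto
    then show False
    proof cases
      case 1 then show ?thesis
        using alternating_wheel_concentrated[of h q1 q2 q3 q4 P] dist q P one m hit[of x] by auto
    next
      case 2 then show ?thesis
        using alternating_wheel_concentrated[of h q2 q1 q3 q4 P] dist q P one m hit[of x] unfolding perm by auto
    next
      case 3 then show ?thesis
        using alternating_wheel_concentrated[of h q3 q1 q2 q4 P] dist q P one m hit[of x] unfolding perm by auto
    next
      case 4 then show ?thesis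
        using alternating_wheel_concentrated[of h q4 q1 q2 q3 P] dist q P one m hit[of x] unfolding perm by auto
    qed
  qed
  have finP: "finite P" using P(3) by (simp add: card_ge_0_finite)
  have big: "4 \<le> card (P \<inter> N x \<inter> N y)" if "x \<in> {q1,q2,q3,q4}" "y \<in> {q1,q2,q3,q4}" for x y
  proof -
    have "card P \<le> card ((P \<inter> N x \<inter> N y) \<union> ((P - N x) \<union> (P - N y)))"
      using finP by (intro card_mono) auto
    also have "\<dots> \<le> card (P \<inter> N x \<inter> N y) + (card (P - N x) + card (P - N y))"
      by (meson add_mono card_Un_le le_refl order_trans)
    finally show ?thesis using le1[OF that(1)] le1[OF that(2)] P(3) by linarith
  qed
  obtain a b c d where y: "a \<in> P \<inter> N q1 \<inter> N q2" "b \<in> P \<inter> N q2 \<inter> N q3" "c \<in> P \<inter> N q3 \<inter> N q4"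
    "d \<in> P \<inter> N q4 \<inter> N q1" "distinct [a,b,c,d]"
    by (rule ex_distinct_representatives4[of "P \<inter> N q1 \<inter> N q2" "P \<inter> N q2 \<inter> N q3" "P \<inter> N q3 \<inter> N q4" "P \<inter> N q4 \<inter> N q1"])
      (use big in auto)
  have "h \<notin> P" using P(1) A_irr by auto
  then have "distinct [h,q1,q2,q3,q4,a,b,c,d]" using dist y P(2) by auto
  then show False
    using no_alternating_wheel[of h q1 q2 q3 q4 a b c d] q y P(1) by (auto simp: N_def)
qed

text \<open>The tree needs a neighbour \<open>a\<close> of \<open>v\<close> with two further
  neighbours. The fewer of these are taken from \<open>D v\<close>, the smaller the degree of
  \<open>v\<close> that suffices: \<open>n - 3\<close> if both lie outside, \<open>n - 2\<close> if
  one does, and \<open>n - 1\<close> in any case.\<close>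

lemma S3_free_degree:
  assumes n: "8 \<le> n" "even n" and V: "card V = 2 * n" and no: "\<not> has_S3 E n"
    and v: "v \<in> V"
  shows "card (D v) \<noteq> n - 2" and "card (D v) < n - 1"
    and "n - 3 \<le> card (D v) \<Longrightarrow> a \<in> D v \<Longrightarrow> card (D a - {v} - D v) \<le> 1"
proof -
  have no': "card (D v - {a,b,c}) < n - 4" if "a \<in> D v" "b \<in> D a" "c \<in> D a" "b \<noteq> c" "b \<noteq> v" "c \<noteq> v" for a b c
  proof (rule ccontr)
    assume "\<not> ?thesis"
    then have "n - 4 \<le> card ({u. E v u} - {a,b,c})" by (simp add: D_def)
    moreover have "distinct [v,a,b,c]" using that D_irr by auto
    ultimately have "has_S3 E n" unfolding has_S3_def using that unfolding D_def by blast
    then show False using no by blast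
  qed
  have two: "\<exists>x y. x \<in> S \<and> y \<in> S \<and> x \<noteq> y" if "\<not> card S \<le> 1" for S :: "'a set"
  proof -
    have "2 \<le> card S" using that by simp
    then show ?thesis by (auto simp: card_le_Suc_iff numeral_2_eq_2)
  qed
  show few: "card (D a - {v} - D v) \<le> 1" if d: "n - 3 \<le> card (D v)" and a: "a \<in> D v" for a
  proof (rule ccontr)
    assume "\<not> ?thesis"
    then obtain b c where bc: "b \<in> D a - {v} - D v" "c \<in> D a - {v} - D v" "b \<noteq> c" using two by blast
    then have "card (D v - {a,b,c}) < n - 4" using no'[of a b c] a by auto
    moreover have "D v - {a,b,c} = D v - {a}" using bc by auto
    ultimately show False using d a by simp
  qed
  show "card (D v) < n - 1"
  proof (rule ccontr)
    assume d: "\<not> ?thesis"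
    have few1: "card (D a - {v}) \<le> 1" if a: "a \<in> D v" for a
    proof (rule ccontr)
      assume "\<not> ?thesis"
      then obtain b c where bc: "b \<in> D a - {v}" "c \<in> D a - {v}" "b \<noteq> c" using two by blast
      then have "card (D v - {a,b,c}) < n - 4" using no'[of a b c] a by auto
      moreover have "card {a,b,c} \<le> 3" using card_length[of "[a,b,c]"] by simp
      ultimately show False using card_D_Diff[of "{a,b,c}" v] d n by simp
    qed
    have "D v \<noteq> {}" using d n by auto
    then obtain h where h: "h \<in> D v" by blast
    have "card (D h \<inter> D v) \<le> card (D h - {v})" using finD D_irr by (intro card_mono) auto
    then have "4 \<le> card (N h \<inter> D v)" using card_D_N[OF h D_V] few1[OF h] d n by linarith
    then obtain S where S: "S \<subseteq> N h \<inter> D v" "card S = 4" by (meson obtain_subset_with_card_n)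
    define T where "T = V - insert v (insert h S)"
    have finS: "finite S" using S(2) by (simp add: card_ge_0_finite)
    have "card V - card (insert v (insert h S)) \<le> card T"
      unfolding T_def using finS by (intro diff_card_le_card_Diff) simp
    moreover have "card (insert v (insert h S)) \<le> 6" using S(2) finS by (simp add: card_insert_if)
    ultimately have T: "7 \<le> card T" using V n by linarith
    show False
    proof (rule no_near_join_wheel[of S h T])
      show "S \<subseteq> N h" "4 \<le> card S" using S by auto
      show "7 \<le> card T" by (rule T)
      show "T \<subseteq> V" "T \<inter> insert h S = {}" by (auto simp: T_def)
      fix s assume "s \<in> insert h S"
      then have "card (D s - {v}) \<le> 1" using few1 S h by blast
      moreover have "card (D s \<inter> T) \<le> card (D s - {v})" using finD by (intro card_mono) (auto simp: T_def)
      ultimately show "card (D s \<inter> T) \<le> 1" by linarith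
    qed
  qed
  show "card (D v) \<noteq> n - 2"
  proof
    assume d: "card (D v) = n - 2"
    define B where "B = V - {v} - D v"
    have cB: "card B = n + 1" using card_outside[OF v] V d n by (simp add: B_def)
    have BV: "B \<subseteq> V" by (auto simp: B_def)
    have DaB: "D a \<inter> B = D a - {v} - D v" for a using D_V by (auto simp: B_def)
    \<comment> \<open>A neighbour \<open>b\<close> in \<open>B\<close> leaves \<open>a\<close> no
      graph neighbour in \<open>D v\<close>. Hence \<open>a\<close> has \<open>n - 3\<close>
      complement neighbours there and becomes the hub of a wheel with rim partly in
      \<open>B\<close>.\<close>
    have none: "D a \<inter> B = {}" if a: "a \<in> D v" for a
    proof (rule ccontr)
      assume "D a \<inter> B \<noteq> {}"
      then obtain b where b: "b \<in> D a" "b \<in> B" by blast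
      have "D a \<inter> D v = {}"
      proof (rule ccontr)
        assume "D a \<inter> D v \<noteq> {}"
        then obtain c where c: "c \<in> D a" "c \<in> D v" by blast
        have ac: "a \<noteq> c" using c D_irr by auto
        have "card (D v - {a,b,c}) < n - 4" using no'[of a b c] a b c D_irr by (auto simp: B_def)
        moreover have "D v - {a,b,c} = D v - {a,c}" using b by (auto simp: B_def)
        ultimately show False using card_D_Diff[of "{a,c}" v] d n ac by simp
      qed
      then have "4 \<le> card (N a \<inter> D v)" using card_D_N[OF a D_V] d n by simp
      then obtain S where S: "S \<subseteq> N a \<inter> D v" "card S = 4" by (meson obtain_subset_with_card_n)
      show False
      proof (rule no_near_join_wheel[of S a B])
        show "S \<subseteq> N a" "4 \<le> card S" using S by auto
        show "7 \<le> card B" using cB n by simp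
        show "B \<inter> insert a S = {}" using a S by (auto simp: B_def)
        show "card (D s \<inter> B) \<le> 1" if "s \<in> insert a S" for s
          unfolding DaB using few[of s] d n that a S by auto
      qed (rule BV)
    qed
    have join: "A p q" if p: "p \<in> insert v (D v)" and q: "q \<in> B" for p q
    proof -
      have "p \<in> V" "q \<in> V" "p \<noteq> q" using p q v D_V by (auto simp: B_def)
      moreover have "q \<notin> D p" using none p q by (auto simp: B_def)
      ultimately show ?thesis using A_iff by blast
    qed
    have "4 \<le> card (insert v (D v))" using d n D_irr finD by simp
    then have "card (N x \<inter> B) \<le> 3" if "x \<in> B" for x
      by (rule join_card_N_le) (use that join A_sym in blast)+
    then show False using near_complete_has_trees[OF n BV] cB no by auto
  qed
qed

lemma large_degree_has_S3:
  assumes n: "8 \<le> n" "even n" and V: "card V = 2 * n"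
    and v: "v \<in> V" "n - 3 \<le> card (D v)"
  shows "has_S3 E n"
proof (rule ccontr)
  assume no: "\<not> has_S3 E n"
  note aux = S3_free_degree[OF n V no]
  have le: "card (D x) \<le> n - 3" if "x \<in> V" for x using aux(1,2)[OF that] by linarith
  have d: "card (D v) = n - 3" using le[OF v(1)] v(2) by simp
  define B where "B = V - {v} - D v"
  define P where "P = insert v (D v)"
  have BV: "B \<subseteq> V" and BP: "P \<inter> B = {}" and PV: "P \<subseteq> V" using v D_V by (auto simp: B_def P_def)
  have finB: "finite B" using BV finV finite_subset by blast
  have cB: "card B = n + 2" using card_outside[OF v(1)] V d n by (simp add: B_def)
  have cP: "card P = n - 2" using d n D_irr finD by (simp add: P_def)
  have DaB: "D a \<inter> B = D a - {v} - D v" for a using D_V by (auto simp: B_def)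
  have few: "card (D p \<inter> B) \<le> 1" if "p \<in> P" for p
  proof (cases "p = v")
    case True
    then have "D p \<inter> B = {}" by (auto simp: B_def)
    then show ?thesis by simp
  next
    case False
    then show ?thesis unfolding DaB using aux(3)[OF v(1,2)] that by (simp add: P_def)
  qed
  have AP: "A p q" if "p \<in> P" "q \<in> B" "q \<notin> D p" for p q
    using A_iff[of p q] that PV BV BP by blast
  \<comment> \<open>Each of the \<open>n - 3\<close> vertices of \<open>D v\<close> has at most one
    graph neighbour in \<open>B\<close>, which has \<open>n + 2\<close> vertices. An untouched
    \<open>h\<close> is joined in the complement to all of \<open>P\<close> and serves as the
    hub.\<close>
  have "card (\<Union>p\<in>D v. D p \<inter> B) \<le> (\<Sum>p\<in>D v. card (D p \<inter> B))"
    by (rule card_UN_le[OF finD])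
  also have "\<dots> \<le> card (D v)" using sum_bounded_above[of "D v" "\<lambda>p. card (D p \<inter> B)" 1] few by (simp add: P_def)
  finally have "card (\<Union>p\<in>D v. D p \<inter> B) < card B" using d cB n by linarith
  then have "\<not> B \<subseteq> (\<Union>p\<in>D v. D p \<inter> B)"
    by (meson card_mono finD finite_Int finite_UN_I leD)
  then obtain h where h: "h \<in> B" "\<And>p. p \<in> D v \<Longrightarrow> h \<notin> D p" by blast
  have hP: "A h p" if "p \<in> P" for p
  proof -
    have "h \<notin> D p" using h that by (auto simp: P_def B_def)
    then show ?thesis using AP[OF that h(1)] A_sym by blast
  qed
  have "card (D h \<inter> B) \<le> n - 3"
    using le[of h] h(1) BV card_mono[OF finD, of "D h \<inter> B" h] by fastforce
  \<comment> \<open>\<open>(n + 2) - 1 - (n - 3) = 4\<close>: the global degree bound leaves just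
    enough rim vertices.\<close>
  then have "4 \<le> card (N h \<inter> B)" using card_D_N[OF h(1) BV] cB n by linarith
  then obtain q1 q2 q3 q4 where q: "{q1,q2,q3,q4} \<subseteq> N h \<inter> B" "distinct [q1,q2,q3,q4]" using ex_four by metis
  have hq: "h \<notin> {q1,q2,q3,q4}" using q(1) A_irr by (auto simp: N_def)
  show False
  proof (cases "\<exists>x\<in>{q1,q2,q3,q4}. card (P \<inter> N x) \<le> 1")
    case False
    show False
    proof (rule no_alternating_wheel_spread[of h q1 q2 q3 q4 P])
      show "distinct [h,q1,q2,q3,q4]" using q(2) hq by auto
      show "A h q1" "A h q2" "A h q3" "A h q4" using q(1) by (auto simp: N_def)
      show "P \<inter> {q1,q2,q3,q4} = {}" using q(1) BP by blast
      show "6 \<le> card P" using cP n by simp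
      show "2 \<le> card (P \<inter> N x)" if "x \<in> {q1,q2,q3,q4}" for x using False that by fastforce
      fix p assume p: "p \<in> P"
      then show "A h p" by (rule hP)
      have "{q1,q2,q3,q4} - N p \<subseteq> D p \<inter> B" using AP[OF p] q(1) by (auto simp: N_def)
      then have "card ({q1,q2,q3,q4} - N p) \<le> card (D p \<inter> B)" using finB by (intro card_mono) auto
      then show "card ({q1,q2,q3,q4} - N p) \<le> 1" using few[OF p] by linarith
    qed
  next
    case True
    txt \<open>Then \<open>x\<close> is a twin of \<open>v\<close>, and nothing else in \<open>B\<close> is adjacent to \<open>P\<close> in the graph.\<close>
    then obtain x where x: "x \<in> B" "card (P \<inter> N x) \<le> 1" using q(1) by blast
    have "P - N x \<subseteq> D x"
      using AP[of _ x] x(1) A_sym D_sym by (auto simp: N_def)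
    moreover have "v \<notin> D x" using x(1) D_sym[of v x] by (auto simp: B_def)
    ultimately have sub: "P - N x \<subseteq> D v" "P - N x \<subseteq> D x" by (auto simp: P_def)
    have "card P - card (P \<inter> N x) \<le> card (P - N x)"
      using card_Diff_subset_Int[of P "N x"] finN[of x] by simp
    then have c: "n - 3 \<le> card (P - N x)" using cP x(2) by linarith
    then have eq: "P - N x = D v" using sub(1) finD d by (metis card_seteq)
    have "D x = D v"
      using sub(2) le[of x] x(1) BV d finD unfolding eq by (metis card_seteq subsetD)
    define R where "R = B - {x}"
    have join: "A p q" if p: "p \<in> P" and r: "q \<in> R" for p q
    proof (rule AP)
      show "p \<in> P" "q \<in> B" using p r by (auto simp: R_def)
      show "q \<notin> D p"
      proof (cases "p = v")
        case True
        then show ?thesis using r by (auto simp: R_def B_def)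
      next
        case False
        then have "x \<in> D p \<inter> B" using p \<open>D x = D v\<close> D_sym[of x p] x(1) by (auto simp: P_def)
        then show ?thesis using few[OF p] r finD by (auto simp: R_def card_le_Suc0_iff_eq)
      qed
    qed
    have "4 \<le> card P" using cP n by simp
    then have "card (N y \<inter> R) \<le> 3" if "y \<in> R" for y
      by (rule join_card_N_le) (use that join A_sym in blast)+
    moreover have "R \<subseteq> V" "n + 1 \<le> card R" using BV cB x(1) finB by (auto simp: R_def)
    ultimately show False using near_complete_has_trees[OF n] no by blast
  qed
qed

lemma has_trees:
  assumes n: "8 \<le> n" "even n" and V: "card V = 2 * n"
  shows "has_S12 E n \<and> has_S21 E n \<and> has_S3 E n"
proof -
  obtain v where v: "v \<in> V" "card (N v) < n + 3" using ex_small_degree[OF V n(1)] by blast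
  then have "n - 3 \<le> card (D v)" using card_D_N_V[of v] V by linarith
  then show ?thesis using large_degree_has_S12 large_degree_has_S21 large_degree_has_S3 n V v(1) by blast
qed

end

section \<open>The trees and the wheel as subgraphs\<close>

lemma doubleton_nsets_iff: "{x, y} \<in> [S]\<^bsup>2\<^esup> \<longleftrightarrow> x \<in> S \<and> y \<in> S \<and> x \<noteq> y"
  by (auto simp: nsets_def card_insert_if)

lemma edge_verts:
  assumes "is_graph F" "{x, y} \<in> edges F"
  shows "x \<in> verts F \<and> y \<in> verts F \<and> x \<noteq> y"
proof -
  have "{x, y} \<in> [verts F]\<^bsup>2\<^esup>" using assms unfolding is_graph_def by blast
  then show ?thesis unfolding doubleton_nsets_iff .
qed

lemma path_edges_Cons: "path_edges (x # y # zs) = insert {x, y} (path_edges (y # zs))"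
proof
  show "path_edges (x # y # zs) \<subseteq> insert {x, y} (path_edges (y # zs))"
  proof
    fix e assume "e \<in> path_edges (x # y # zs)"
    then obtain i where i: "Suc i < length (x # y # zs)" "e = {(x # y # zs) ! i, (x # y # zs) ! Suc i}"
      unfolding path_edges_def by blast
    show "e \<in> insert {x, y} (path_edges (y # zs))"
    proof (cases i)
      case 0
      then show ?thesis using i by simp
    next
      case (Suc j)
      then have "Suc j < length (y # zs)" "e = {(y # zs) ! j, (y # zs) ! Suc j}" using i by simp_all
      then show ?thesis unfolding path_edges_def by blast
    qed
  qed
  show "insert {x, y} (path_edges (y # zs)) \<subseteq> path_edges (x # y # zs)"
  proof
    fix e assume "e \<in> insert {x, y} (path_edges (y # zs))"
    then consider "e = {x, y}" | i where "Suc i < length (y # zs)" "e = {(y # zs) ! i, (y # zs) ! Suc i}"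
      unfolding path_edges_def by blast
    then show "e \<in> path_edges (x # y # zs)"
    proof cases
      case 1
      then show ?thesis unfolding path_edges_def by (intro CollectI exI[of _ 0]) simp
    next
      case (2 i)
      then show ?thesis unfolding path_edges_def by (intro CollectI exI[of _ "Suc i"]) simp
    qed
  qed
qed

lemma path_edges_single: "path_edges [x] = {}"
  by (simp add: path_edges_def)

lemma star_edges_diff:
  "{{0, x} | x. x \<in> S} - {{0, y}} = {{0, x} | x. x \<in> S - {y}}" for S :: "nat set"
proof -
  have "inj (\<lambda>x::nat. {0, x})" by (auto simp: inj_def doubleton_eq_iff)
  then show ?thesis unfolding Setcompr_eq_image using image_set_diff[of "\<lambda>x. {0, x}" S "{y}"] by simp
qed

lemma edges_S_sub_1_2:
  assumes "4 \<le> n"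
  shows "edges (S_sub n 1 2) = {{0, x} | x. x \<in> {2..<n - 2}} \<union> {{0, n - 2}, {n - 2, n - 1}, {n - 1, 1}}"
proof -
  define k where "k = n - 2"
  then have k: "n = Suc (Suc k)" and nk: "n - 2 = k" "n - 1 = Suc k" using assms by simp_all
  have "S_sub n 1 2 = subdivide_edge 0 1 [k, Suc k] (star 0 {1..<k})"
    by (simp add: k S_sub_def)
  then have "edges (S_sub n 1 2) = ({{0, x} | x. x \<in> {1..<k}} - {{0, 1}}) \<union> {{0, k}, {k, Suc k}, {Suc k, 1}}"
    by (simp only: subdivide_edge_def star_def fst_conv snd_conv append_Cons append_Nil path_edges_Cons path_edges_single)
  also have "{{0, x} | x. x \<in> {1..<k}} - {{0, 1}} = {{0, x} | x. x \<in> {1..<k} - {1}}"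
    by (rule star_edges_diff)
  also have "{1..<k} - {1} = {2..<k}" by auto
  finally show ?thesis unfolding nk .
qed

lemma edges_S_sub_2_1:
  assumes "5 \<le> n"
  shows "edges (S_sub n 2 1) = {{0, x} | x. x \<in> {3..<n - 2}} \<union> {{0, n - 2}, {n - 2, 1}, {0, n - 1}, {n - 1, 2}}"
proof -
  define k where "k = n - 2"
  then have k: "n = Suc (Suc k)" and nk: "n - 2 = k" "n - 1 = Suc k" and k3: "3 \<le> k" using assms by simp_all
  have "S_sub n 2 1 = subdivide_edge 0 2 [Suc k] (subdivide_edge 0 1 [k] (star 0 {1..<k}))"
    by (simp add: k S_sub_def numeral_2_eq_2)
  then have "edges (S_sub n 2 1) =
      (({{0, x} | x. x \<in> {1..<k}} - {{0, 1}} \<union> {{0, k}, {k, 1}}) - {{0, 2}}) \<union> {{0, Suc k}, {Suc k, 2}}"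
    by (simp only: subdivide_edge_def star_def fst_conv snd_conv append_Cons append_Nil path_edges_Cons path_edges_single)
  also have "\<dots> = ({{0, x} | x. x \<in> {1..<k} - {1} - {2}} \<union> ({{0, k}, {k, 1}} - {{0, 2}})) \<union> {{0, Suc k}, {Suc k, 2}}"
    by (simp only: Un_Diff star_edges_diff)
  also have "{{0, k}, {k, 1}} - {{0, 2}} = {{0, k}, {k, 1}}"
    using k3 by (auto simp: doubleton_eq_iff)
  also have "{1..<k} - {1} - {2} = {3..<k}" by auto
  finally show ?thesis unfolding nk by (simp only: Un_assoc Un_insert_left Un_empty_left)
qed

lemma edges_S_join_3:
  assumes "4 \<le> n"
  shows "edges (S_join n 3) = {{0, x} | x. x \<in> {1..<n - 3}} \<union> {{0, n - 3}, {n - 3, n - 2}, {n - 3, n - 1}}"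
proof -
  have "{Suc (n - 3)..<n} = {n - 2, n - 1}" using assms by auto
  then show ?thesis by (auto simp: S_join_def star_def Let_def)
qed

lemma verts_trees:
  assumes "5 \<le> n"
  shows "verts (S_sub n 1 2) = {..<n}" "verts (S_sub n 2 1) = {..<n}" "verts (S_join n 3) = {..<n}"
  proof -
  have "S_sub n 1 2 = subdivided_star (n - 2) 2 1" "S_sub n 2 1 = subdivided_star (n - 2) 1 2"
    by (simp_all only: S_sub_def mult_1 mult_1_right)
  then show "verts (S_sub n 1 2) = {..<n}" "verts (S_sub n 2 1) = {..<n}"
    using assms by (simp_all only: verts_subdivided_star) auto
  show "verts (S_join n 3) = {..<n}" using assms by (auto simp: S_join_def star_def Let_def)
qed

lemma contains_of_list:
  assumes "is_graph G" "verts G = {..<length ws}" "distinct ws" "set ws \<subseteq> verts F"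
    and "\<And>e. e \<in> edges G \<Longrightarrow> (\<lambda>i. ws ! i) ` e \<in> edges F"
  shows "contains F G"
  unfolding contains_iff_embedding[OF assms(1)]
proof (intro exI[of _ "\<lambda>i. ws ! i"] conjI ballI)
  show "inj_on (\<lambda>i. ws ! i) (verts G)" using assms(2,3) by (auto simp: inj_on_def nth_eq_iff_index_eq)
  show "(\<lambda>i. ws ! i) ` verts G \<subseteq> verts F" using assms(2,4) by auto
qed (rule assms(5))

lemma ex_list_subset:
  assumes "m \<le> card S" "0 < m"
  obtains ls where "distinct ls" "length ls = m" "set ls \<subseteq> S"
proof -
  obtain L where L: "L \<subseteq> S" "card L = m" using assms(1) by (meson obtain_subset_with_card_n)
  then have "finite L" using assms(2) by (simp add: card_ge_0_finite)
  then obtain ls where "set ls = L" "distinct ls" using finite_distinct_list by blast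
  then show ?thesis using that L distinct_card by metis
qed

lemma contains_S_sub_1_2:
  assumes n: "8 \<le> n" and F: "is_graph F" and T: "has_S12 (\<lambda>x y. {x, y} \<in> edges F) n"
  shows "contains F (S_sub n 1 2)"
proof -
  obtain v a b c where d: "distinct [v,a,b,c]" and e: "{v,a} \<in> edges F" "{a,b} \<in> edges F" "{b,c} \<in> edges F"
    and c: "n - 4 \<le> card ({u. {v,u} \<in> edges F} - {a,b,c})"
    using T unfolding has_S12_def by (elim exE conjE) (rule that)
  obtain ls where ls: "distinct ls" "length ls = n - 4" "set ls \<subseteq> {u. {v,u} \<in> edges F} - {a,b,c}"
    using ex_list_subset[OF c] n by auto
  \<comment> \<open>Positions are vertex labels: the subdivided edge is the path
    \<open>0, n - 2, n - 1, 1\<close>, so its far end \<open>c\<close> comes second and the new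
    vertices \<open>a, b\<close> come last.\<close>
  let ?ws = "v # c # ls @ [a, b]"
  have ed: "x \<in> verts F \<and> y \<in> verts F \<and> x \<noteq> y" if "{x, y} \<in> edges F" for x y
    using edge_verts[OF F that] .
  have nth: "?ws ! 0 = v" "?ws ! 1 = c" "?ws ! (n - 2) = a" "?ws ! (n - 1) = b"
    using n ls(2) by (auto simp: nth_append nth_Cons')
  have leaf: "{v, ?ws ! x} \<in> edges F" if "x \<in> {2..<n - 2}" for x
  proof -
    have "?ws ! x = ls ! (x - 2)" "x - 2 < length ls"
      using that ls(2) by (auto simp: nth_append nth_Cons' numeral_2_eq_2)
    then have "?ws ! x \<in> set ls" by simp
    then show ?thesis using ls(3) by blast
  qed
  show ?thesis
  proof (rule contains_of_list[of _ ?ws])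
    show "is_graph (S_sub n 1 2)" using is_graph_S_sub(1)[of 1 2 n] n by simp
    show "verts (S_sub n 1 2) = {..<length ?ws}" using verts_trees(1)[of n] n ls(2) by simp
    show "distinct ?ws" using d ls ed[of v v] by auto
    show "set ?ws \<subseteq> verts F" using ls(3) ed e by auto
    fix i assume "i \<in> edges (S_sub n 1 2)"
    then consider x where "i = {0, x}" "x \<in> {2..<n - 2}" | "i \<in> {{0, n - 2}, {n - 2, n - 1}, {n - 1, 1}}"
      using edges_S_sub_1_2[of n] n by auto
    then show "(\<lambda>i. ?ws ! i) ` i \<in> edges F"
    proof cases
      case 1
      then show ?thesis using leaf[of x] nth(1) by (simp only: image_insert image_empty)
    next
      case 2
      then show ?thesis by (elim insertE emptyE) (simp_all only: image_insert image_empty nth e)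
    qed
  qed
qed

lemma contains_S_sub_2_1:
  assumes n: "8 \<le> n" and F: "is_graph F" and T: "has_S21 (\<lambda>x y. {x, y} \<in> edges F) n"
  shows "contains F (S_sub n 2 1)"
proof -
  obtain v a b c d where d: "distinct [v,a,b,c,d]"
    and e: "{v,a} \<in> edges F" "{a,b} \<in> edges F" "{v,c} \<in> edges F" "{c,d} \<in> edges F"
    and c: "n - 5 \<le> card ({u. {v,u} \<in> edges F} - {a,b,c,d})"
    using T unfolding has_S21_def by (elim exE conjE) (rule that)
  obtain ls where ls: "distinct ls" "length ls = n - 5" "set ls \<subseteq> {u. {v,u} \<in> edges F} - {a,b,c,d}"
    using ex_list_subset[OF c] n by auto
  \<comment> \<open>Labels 1 and 2 are the far ends of the branches; \<open>n - 2\<close> and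
    \<open>n - 1\<close> are the vertices that subdivide them.\<close>
  let ?ws = "v # b # d # ls @ [a, c]"
  have ed: "x \<in> verts F \<and> y \<in> verts F \<and> x \<noteq> y" if "{x, y} \<in> edges F" for x y
    using edge_verts[OF F that] .
  have nth: "?ws ! 0 = v" "?ws ! 1 = b" "?ws ! 2 = d" "?ws ! (n - 2) = a" "?ws ! (n - 1) = c"
    using n ls(2) by (auto simp: nth_append nth_Cons')
  have leaf: "{v, ?ws ! x} \<in> edges F" if "x \<in> {3..<n - 2}" for x
  proof -
    have "?ws ! x = ls ! (x - 3)" "x - 3 < length ls"
      using that ls(2) by (auto simp: nth_append nth_Cons' numeral_3_eq_3)
    then have "?ws ! x \<in> set ls" by simp
    then show ?thesis using ls(3) by blast
  qed
  show ?thesis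
  proof (rule contains_of_list[of _ ?ws])
    show "is_graph (S_sub n 2 1)" using is_graph_S_sub(1)[of 2 1 n] n by simp
    show "verts (S_sub n 2 1) = {..<length ?ws}" using verts_trees(2)[of n] n ls(2) by simp
    show "distinct ?ws" using d ls ed[of v v] by auto
    show "set ?ws \<subseteq> verts F" using ls(3) ed e by auto
    fix i assume "i \<in> edges (S_sub n 2 1)"
    then consider x where "i = {0, x}" "x \<in> {3..<n - 2}"
      | "i \<in> {{0, n - 2}, {n - 2, 1}, {0, n - 1}, {n - 1, 2}}"
      using edges_S_sub_2_1[of n] n by auto
    then show "(\<lambda>i. ?ws ! i) ` i \<in> edges F"
    proof cases
      case 1
      then show ?thesis using leaf[of x] nth(1) by (simp only: image_insert image_empty)
    next
      case 2
      then show ?thesis by (elim insertE emptyE) (simp_all only: image_insert image_empty nth e)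
    qed
  qed
qed

lemma contains_S_join_3:
  assumes n: "8 \<le> n" and F: "is_graph F" and T: "has_S3 (\<lambda>x y. {x, y} \<in> edges F) n"
  shows "contains F (S_join n 3)"
proof -
  obtain v a b c where d: "distinct [v,a,b,c]" and e: "{v,a} \<in> edges F" "{a,b} \<in> edges F" "{a,c} \<in> edges F"
    and c: "n - 4 \<le> card ({u. {v,u} \<in> edges F} - {a,b,c})"
    using T unfolding has_S3_def by (elim exE conjE) (rule that)
  obtain ls where ls: "distinct ls" "length ls = n - 4" "set ls \<subseteq> {u. {v,u} \<in> edges F} - {a,b,c}"
    using ex_list_subset[OF c] n by auto
  let ?ws = "v # ls @ [a, b, c]"
  have ed: "x \<in> verts F \<and> y \<in> verts F \<and> x \<noteq> y" if "{x, y} \<in> edges F" for x y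
    using edge_verts[OF F that] .
  have nth: "?ws ! 0 = v" "?ws ! (n - 3) = a" "?ws ! (n - 2) = b" "?ws ! (n - 1) = c"
    using n ls(2) by (auto simp: nth_append nth_Cons')
  have leaf: "{v, ?ws ! x} \<in> edges F" if "x \<in> {1..<n - 3}" for x
  proof -
    have "?ws ! x = ls ! (x - 1)" "x - 1 < length ls"
      using that ls(2) by (auto simp: nth_append nth_Cons')
    then have "?ws ! x \<in> set ls" by simp
    then show ?thesis using ls(3) by blast
  qed
  show ?thesis
  proof (rule contains_of_list[of _ ?ws])
    show "is_graph (S_join n 3)" using is_graph_S_join(1)[of 3 n] n by simp
    show "verts (S_join n 3) = {..<length ?ws}" using verts_trees(3)[of n] n ls(2) by simp
    show "distinct ?ws" using d ls ed[of v v] by auto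
    show "set ?ws \<subseteq> verts F" using ls(3) ed e by auto
    fix i assume "i \<in> edges (S_join n 3)"
    then consider x where "i = {0, x}" "x \<in> {1..<n - 3}" | "i \<in> {{0, n - 3}, {n - 3, n - 2}, {n - 3, n - 1}}"
      using edges_S_join_3[of n] n by auto
    then show "(\<lambda>i. ?ws ! i) ` i \<in> edges F"
    proof cases
      case 1
      then show ?thesis using leaf[of x] nth(1) by (simp only: image_insert image_empty)
    next
      case 2
      then show ?thesis by (elim insertE emptyE) (simp_all only: image_insert image_empty nth e)
    qed
  qed
qed

section \<open>The wheel in the complement, and the upper bound\<close>

lemma wheel_8:
  "verts (wheel 8) = {..<9}"
  "edges (wheel 8) = {{0,1},{1,2},{2,3},{3,4},{4,5},{5,6},{6,7},{7,0},
     {8,0},{8,1},{8,2},{8,3},{8,4},{8,5},{8,6},{8,7}}"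
proof -
  have 8: "{..<8} = {0,1,2,3,4,5,6,7::nat}" by auto
  show "verts (wheel 8) = {..<9}" by (auto simp: wheel_def cycle_graph_def)
  have "edges (cycle_graph 8) = (\<lambda>i. {i, Suc i mod 8}) ` {..<8}"
    by (auto simp: cycle_graph_def)
  moreover have "{{8, i} | i. i \<in> verts (cycle_graph 8)} = (\<lambda>i. {8, i}) ` {..<8}"
    by (auto simp: cycle_graph_def)
  ultimately have "edges (wheel 8) = (\<lambda>i. {i, Suc i mod 8}) ` {..<8} \<union> (\<lambda>i. {8, i}) ` {..<8}"
    by (simp add: wheel_def)
  then show "edges (wheel 8) = {{0,1},{1,2},{2,3},{3,4},{4,5},{5,6},{6,7},{7,0},
     {8,0},{8,1},{8,2},{8,3},{8,4},{8,5},{8,6},{8,7}}"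
    unfolding 8 by (simp add: insert_commute flip: numeral_2_eq_2)
qed

lemma w8_free_complement:
  fixes F :: "'a graph"
  assumes F: "is_graph F" and W: "\<not> contains (complement F) (wheel 8)"
  shows "w8_free (verts F) (\<lambda>x y. {x, y} \<in> edges (complement F))"
proof
  show "finite (verts F)" using F by (simp add: is_graph_def)
  show "{y, x} \<in> edges (complement F)" if "{x, y} \<in> edges (complement F)" for x y
    using that by (simp add: insert_commute)
  show "{x, x} \<notin> edges (complement F)" for x using doubleton_nsets_iff[of x x] by (auto simp: complement_def)
  show "x \<in> verts F" if "{x, y} \<in> edges (complement F)" for x y
    using that by (auto simp: complement_def nsets_def)
  fix h a b c d e f g i
  assume dist: "distinct [h,a,b,c,d,e,f,g,i]"
    and E: "{h,a} \<in> edges (complement F)" "{h,b} \<in> edges (complement F)" "{h,c} \<in> edges (complement F)"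
      "{h,d} \<in> edges (complement F)" "{h,e} \<in> edges (complement F)" "{h,f} \<in> edges (complement F)"
      "{h,g} \<in> edges (complement F)" "{h,i} \<in> edges (complement F)"
      "{a,b} \<in> edges (complement F)" "{b,c} \<in> edges (complement F)" "{c,d} \<in> edges (complement F)"
      "{d,e} \<in> edges (complement F)" "{e,f} \<in> edges (complement F)" "{f,g} \<in> edges (complement F)"
      "{g,i} \<in> edges (complement F)" "{i,a} \<in> edges (complement F)"
  let ?ws = "[a,b,c,d,e,f,g,i,h]"
  have "contains (complement F) (wheel 8)"
  proof (rule contains_of_list[of _ ?ws])
    show "is_graph (wheel 8)" by (rule is_graph_wheel) simp
    show "verts (wheel 8) = {..<length ?ws}" by (simp add: wheel_8)
    show "distinct ?ws" using dist by auto
    have "x \<in> verts F \<and> y \<in> verts F" if "{x, y} \<in> edges (complement F)" for x y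
      using that by (auto simp: complement_def nsets_def)
    then show "set ?ws \<subseteq> verts (complement F)" using E by (auto simp: complement_def)
    fix j assume "j \<in> edges (wheel 8)"
    then show "(\<lambda>k. ?ws ! k) ` j \<in> edges (complement F)"
      unfolding wheel_8(2) insert_iff empty_iff using E
      by (elim disjE) simp_all
  qed
  then show False using W by simp
qed

lemma arrows_2n:
  assumes n: "8 \<le> n" "even n"
  shows "arrows (2 * n) (S_sub n 1 2) (wheel 8)" "arrows (2 * n) (S_sub n 2 1) (wheel 8)"
    "arrows (2 * n) (S_join n 3) (wheel 8)"
proof -
  have "contains F (S_sub n 1 2) \<and> contains F (S_sub n 2 1) \<and> contains F (S_join n 3)"
    if F: "is_graph F" "card (verts F) = 2 * n" and W: "\<not> contains (complement F) (wheel 8)" for F :: "nat graph"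
  proof -
    interpret w8_free "verts F" "\<lambda>x y. {x, y} \<in> edges (complement F)"
      using w8_free_complement[OF F(1) W] .
    have "E = (\<lambda>x y. {x, y} \<in> edges F)"
    proof (intro ext)
      fix x y
      have "{x, y} \<in> edges (complement F) \<longleftrightarrow> x \<in> verts F \<and> y \<in> verts F \<and> x \<noteq> y \<and> {x, y} \<notin> edges F"
        using doubleton_nsets_iff[of x y "verts F"] by (simp add: complement_def)
      then show "E x y \<longleftrightarrow> {x, y} \<in> edges F"
        unfolding E_def using edge_verts[OF F(1)] by blast
    qed
    then show ?thesis
      using has_trees[OF n F(2)] contains_S_sub_1_2[OF n(1) F(1)] contains_S_sub_2_1[OF n(1) F(1)]
        contains_S_join_3[OF n(1) F(1)] by simp
  qed
  then show "arrows (2 * n) (S_sub n 1 2) (wheel 8)" "arrows (2 * n) (S_sub n 2 1) (wheel 8)"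
    "arrows (2 * n) (S_join n 3) (wheel 8)" unfolding arrows_def by blast+
qed

section \<open>The lower bound\<close>

lemma contains_mono:
  assumes "contains F G" "verts F \<subseteq> verts F'" "edges F \<subseteq> edges F'"
  shows "contains F' G"
  using assms unfolding contains_def subgraph_def by blast

lemma containsE:
  assumes "contains F G" "is_graph G"
  obtains f where "inj_on f (verts G)" "f ` verts G \<subseteq> verts F" "\<forall>e\<in>edges G. f ` e \<in> edges F"
  using assms(1) unfolding contains_iff_embedding[OF assms(2)] by (elim exE conjE) (rule that)

text \<open>This lets a single graph on \<open>2 * n - 1\<close> vertices refute all smaller orders:
  restrict to an induced subgraph, whose complement is the induced part of the complement.\<close>

lemma arrows_mono:
  assumes "arrows N G H" "N \<le> M"
  shows "arrows M G H"
  unfolding arrows_def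
proof (intro allI impI)
  fix F :: "nat graph" assume F: "is_graph F \<and> card (verts F) = M"
  then obtain S where S: "S \<subseteq> verts F" "card S = N" using assms(2) by (meson obtain_subset_with_card_n)
  define F' where "F' = (S, {e \<in> edges F. e \<subseteq> S})"
  have finS: "finite S" using F S finite_subset by (auto simp: is_graph_def)
  have nS: "[S]\<^bsup>2\<^esup> = {e \<in> [verts F]\<^bsup>2\<^esup>. e \<subseteq> S}" using S by (auto simp: nsets_def)
  have "is_graph F'" using F finS nS unfolding is_graph_def F'_def by auto
  then have "contains F' G \<or> contains (complement F') H"
    using assms(1) S unfolding arrows_def F'_def by simp
  then show "contains F G \<or> contains (complement F) H"
  proof
    assume "contains F' G"
    then have "contains F G" by (rule contains_mono) (use S in \<open>auto simp: F'_def\<close>)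
    then show ?thesis ..
  next
    assume "contains (complement F') H"
    then have "contains (complement F) H"
      by (rule contains_mono) (use S nS in \<open>auto simp: F'_def complement_def\<close>)
    then show ?thesis ..
  qed
qed

text \<open>The cubic graph on \<open>{..<n}\<close> consists of consecutive copies of \<open>K\<^sub>4\<close>, followed by one \<open>K\<^bsub>3,3\<^esub>\<close> on the
  last six vertices if \<open>n mod 4 = 2\<close>. The block of those six vertices carries the label \<open>n\<close>, which is
  never of the form \<open>x div 4\<close>.\<close>

definition block :: "nat \<Rightarrow> nat \<Rightarrow> nat" where
  "block n x = (if n mod 4 = 2 \<and> n - 6 \<le> x then n else x div 4)"

definition cubic_adj :: "nat \<Rightarrow> nat \<Rightarrow> nat \<Rightarrow> bool" where
  "cubic_adj n x y \<longleftrightarrow> x \<noteq> y \<and> block n x = block n y \<and> (block n x = n \<longrightarrow> odd (x + y))"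

lemma card_opposite_parity: "card {y \<in> {m..<m + 6}. odd (x + y)} = 3" for m x :: nat
proof -
  have "y \<in> {m..<m + 6} \<longleftrightarrow> y \<in> {m, m + 1, m + 2, m + 3, m + 4, m + 5}" for y by auto
  then have "{y \<in> {m..<m + 6}. odd (x + y)} = {y \<in> {m, m + 1, m + 2, m + 3, m + 4, m + 5}. odd (x + y)}"
    by simp
  also have "\<dots> = (if even (x + m) then {m + 1, m + 3, m + 5} else {m, m + 2, m + 4})"
    by (auto simp del: add_Suc_right)
  also have "card \<dots> = 3" by simp
  finally show ?thesis .
qed

lemma block_K33:
  assumes "n mod 4 = 2" "8 \<le> n" "n - 6 \<le> x" "x < n"
  shows "{y. y < n \<and> block n y = block n x} = {n - 6..<n}"
    and "{y. y < n \<and> cubic_adj n x y} = {y \<in> {n - 6..<n}. odd (x + y)}"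
proof -
  have bx: "block n x = n" using assms by (simp add: block_def)
  have by': "block n y = n \<longleftrightarrow> n - 6 \<le> y" if "y < n" for y
  proof -
    have "y div 4 < n" using that by linarith
    then show ?thesis using assms(1) by (simp add: block_def)
  qed
  show "{y. y < n \<and> block n y = block n x} = {n - 6..<n}" using bx by' by auto
  have "y < n \<and> cubic_adj n x y \<longleftrightarrow> n - 6 \<le> y \<and> y < n \<and> odd (x + y)" for y
  proof (cases "y < n")
    case True
    then show ?thesis using by'[OF True] bx by (auto simp: cubic_adj_def)
  qed simp
  then show "{y. y < n \<and> cubic_adj n x y} = {y \<in> {n - 6..<n}. odd (x + y)}" by auto
qed

lemma block_K4:
  assumes "even n" "8 \<le> n" "x < n" and x: "\<not> (n mod 4 = 2 \<and> n - 6 \<le> x)"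
  shows "{y. y < n \<and> block n y = block n x} = {4 * (x div 4)..<4 * (x div 4) + 4}"
    and "{y. y < n \<and> cubic_adj n x y} = {4 * (x div 4)..<4 * (x div 4) + 4} - {x}"
proof -
  have bx: "block n x = x div 4" using x by (auto simp: block_def)
  have "x div 4 < n" using assms(3) by linarith
  then have xn: "x div 4 \<noteq> n" by simp
  have n4: "n mod 4 = 0 \<or> n mod 4 = 2" using assms(1) by presburger
  have "y < n \<and> block n y = block n x \<longleftrightarrow> y div 4 = x div 4" for y
  proof
    assume "y < n \<and> block n y = block n x"
    then show "y div 4 = x div 4" using bx xn by (auto simp: block_def split: if_splits)
  next
    assume y: "y div 4 = x div 4"
    \<comment> \<open>A block of four is never cut by a multiple of 4. The relevant border is
      \<open>n\<close> if 4 divides \<open>n\<close>, and \<open>n - 6\<close> otherwise; both are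
      multiples of 4.\<close>
    have le: "y < m * 4" if "x < m * 4" for m
      using that y div_less_iff_less_mult[of 4 x m] div_less_iff_less_mult[of 4 y m] by simp
    have "y < n \<and> \<not> (n mod 4 = 2 \<and> n - 6 \<le> y)"
    proof (cases "n mod 4 = 2")
      case True
      then have q: "n = 4 * (n div 4) + 2" using mult_div_mod_eq[of 4 n] by linarith
      then have "n - 6 = (n div 4 - 1) * 4" using assms(2) by linarith
      then have "y < n - 6" using le[of "n div 4 - 1"] x True by simp
      then show ?thesis by simp
    next
      case False
      then have "n = n div 4 * 4" using n4 div_mult_mod_eq[of n 4] by linarith
      then show ?thesis using le[of "n div 4"] False assms(3) by simp
    qed
    then show "y < n \<and> block n y = block n x" using bx y by (auto simp: block_def)
  qed
  moreover have "y div 4 = x div 4 \<longleftrightarrow> y \<in> {4 * (x div 4)..<4 * (x div 4) + 4}" for y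
    unfolding atLeastLessThan_iff by linarith
  ultimately show 1: "{y. y < n \<and> block n y = block n x} = {4 * (x div 4)..<4 * (x div 4) + 4}" by blast
  show "{y. y < n \<and> cubic_adj n x y} = {4 * (x div 4)..<4 * (x div 4) + 4} - {x}"
    unfolding 1[symmetric] using bx xn by (auto simp: cubic_adj_def)
qed

lemma card_cubic_adj:
  assumes "even n" "8 \<le> n" "x < n"
  shows "card {y. y < n \<and> cubic_adj n x y} = 3"
proof (cases "n mod 4 = 2 \<and> n - 6 \<le> x")
  case True
  then show ?thesis using block_K33(2)[of n x] assms card_opposite_parity[of "n - 6" x] by simp
next
  case False
  then show ?thesis using block_K4(2)[OF assms False] by simp
qed

lemma card_block:
  assumes "even n" "8 \<le> n" "x < n"
  shows "card {y. y < n \<and> block n y = block n x} \<le> 6"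
proof (cases "n mod 4 = 2 \<and> n - 6 \<le> x")
  case True
  then show ?thesis using block_K33(1)[of n x] assms by simp
next
  case False
  then show ?thesis using block_K4(1)[OF assms False] by simp
qed

section \<open>The extremal graph on 2n - 1 vertices\<close>

definition extremal_adj :: "nat \<Rightarrow> nat \<Rightarrow> nat \<Rightarrow> bool" where
  "extremal_adj n x y \<longleftrightarrow> x \<noteq> y \<and> (n \<le> x \<and> n \<le> y \<or> x < n \<and> y < n \<and> \<not> cubic_adj n x y)"

definition extremal_graph :: "nat \<Rightarrow> nat graph" where
  "extremal_graph n = ({..<2 * n - 1}, {{x, y} | x y. x < 2 * n - 1 \<and> y < 2 * n - 1 \<and> extremal_adj n x y})"

lemma extremal_adj_sym: "extremal_adj n x y \<Longrightarrow> extremal_adj n y x"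
  by (auto simp: extremal_adj_def cubic_adj_def)

lemma edges_extremal_graph: "{x, y} \<in> edges (extremal_graph n) \<longleftrightarrow> x < 2 * n - 1 \<and> y < 2 * n - 1 \<and> extremal_adj n x y"
proof
  assume "{x, y} \<in> edges (extremal_graph n)"
  then obtain a b where ab: "{x, y} = {a, b}" "a < 2 * n - 1" "b < 2 * n - 1" "extremal_adj n a b"
    unfolding extremal_graph_def snd_conv by blast
  then have "x = a \<and> y = b \<or> x = b \<and> y = a" by (simp add: doubleton_eq_iff)
  then show "x < 2 * n - 1 \<and> y < 2 * n - 1 \<and> extremal_adj n x y" using ab extremal_adj_sym by blast
next
  assume "x < 2 * n - 1 \<and> y < 2 * n - 1 \<and> extremal_adj n x y"
  then show "{x, y} \<in> edges (extremal_graph n)" unfolding extremal_graph_def snd_conv by blast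
qed

lemma is_graph_extremal_graph: "is_graph (extremal_graph n)"
  unfolding is_graph_def
proof (intro conjI subsetI)
  fix e assume "e \<in> edges (extremal_graph n)"
  then obtain x y where "e = {x, y}" "x < 2 * n - 1" "y < 2 * n - 1" "x \<noteq> y"
    by (auto simp: extremal_graph_def extremal_adj_def)
  then show "e \<in> [verts (extremal_graph n)]\<^bsup>2\<^esup>" by (simp add: doubleton_nsets_iff extremal_graph_def)
qed (simp add: extremal_graph_def)

lemma edges_complement_extremal_graph:
  "{x, y} \<in> edges (complement (extremal_graph n)) \<longleftrightarrow>
    x < 2 * n - 1 \<and> y < 2 * n - 1 \<and> x \<noteq> y \<and> \<not> extremal_adj n x y"
proof -
  have "verts (extremal_graph n) = {..<2 * n - 1}" by (simp add: extremal_graph_def)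
  then show ?thesis
    unfolding complement_def snd_conv Diff_iff doubleton_nsets_iff edges_extremal_graph by auto
qed

text \<open>The assumption \<open>conn\<close> is connectedness, stated from \<open>c\<close>. A
  centre placed in the clique keeps the whole tree there, one vertex short; a centre in the other
  part has only \<open>n - 1 - 3 = n - 4\<close> neighbours, one short again.\<close>

lemma not_contains_tree_extremal_graph:
  assumes n: "8 \<le> n" "even n" and T: "is_graph T" "card (verts T) = n"
    and L: "c \<in> verts T" "n - 3 \<le> card {x. {c, x} \<in> edges T}"
    and conn: "\<And>S. c \<in> S \<Longrightarrow> (\<And>x y. {x, y} \<in> edges T \<Longrightarrow> x \<in> S \<Longrightarrow> y \<in> S) \<Longrightarrow> verts T \<subseteq> S"
  shows "\<not> contains (extremal_graph n) T"
proof
  assume "contains (extremal_graph n) T"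
  then obtain f where f: "inj_on f (verts T)" "f ` verts T \<subseteq> verts (extremal_graph n)"
    and fe: "\<forall>e\<in>edges T. f ` e \<in> edges (extremal_graph n)"
    by (rule containsE[OF _ T(1)])
  have adj: "extremal_adj n (f x) (f y)" if "{x, y} \<in> edges T" for x y
    using bspec[OF fe that] edges_extremal_graph[of "f x" "f y" n] by simp
  have lt: "f x < 2 * n - 1" if "x \<in> verts T" for x using f(2) that by (auto simp: extremal_graph_def)
  show False
  proof (cases "n \<le> f c")
    case True
    have "verts T \<subseteq> {x. n \<le> f x}"
    proof (rule conn)
      show "c \<in> {x. n \<le> f x}" using True by simp
      show "y \<in> {x. n \<le> f x}" if "{x, y} \<in> edges T" "x \<in> {x. n \<le> f x}" for x y
        using adj[OF that(1)] that(2) by (simp add: extremal_adj_def)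
    qed
    then have "f ` verts T \<subseteq> {n..<2 * n - 1}" using lt by auto
    then have "card (f ` verts T) \<le> n - 1" using card_mono[of "{n..<2 * n - 1}" "f ` verts T"] by simp
    then show False using card_image[OF f(1)] T(2) n by simp
  next
    case False
    let ?L = "{x. {c, x} \<in> edges T}"
    have LV: "?L \<subseteq> verts T" using edge_verts[OF T(1)] by blast
    have "f ` ?L \<subseteq> {..<n} - {y. y < n \<and> cubic_adj n (f c) y} - {f c}"
    proof
      fix z assume "z \<in> f ` ?L"
      then obtain x where "{c, x} \<in> edges T" "z = f x" by blast
      then show "z \<in> {..<n} - {y. y < n \<and> cubic_adj n (f c) y} - {f c}"
        using adj[of c x] False by (simp add: extremal_adj_def)
    qed
    then have "card (f ` ?L) \<le> card ({..<n} - {y. y < n \<and> cubic_adj n (f c) y} - {f c})"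
      by (intro card_mono) auto
    also have "\<dots> = n - 3 - 1"
    proof -
      have "card ({..<n} - {y. y < n \<and> cubic_adj n (f c) y}) = n - 3"
        using card_cubic_adj[OF n(2,1), of "f c"] False by (subst card_Diff_subset) auto
      moreover have "f c \<in> {..<n} - {y. y < n \<and> cubic_adj n (f c) y}" using False by (auto simp: cubic_adj_def)
      ultimately show ?thesis by simp
    qed
    finally have "card (f ` ?L) \<le> n - 4" by simp
    moreover have "card (f ` ?L) = card ?L" using f(1) LV by (meson card_image inj_on_subset)
    ultimately show False using L(2) n by simp
  qed
qed

text \<open>In the complement the clique becomes independent and is joined to all vertices below
  \<open>n\<close>. A hub in the clique forces the connected rim into one component of the cubic
  graph, which has at most six vertices. A hub below \<open>n\<close> has only three neighbours
  there, whereas the rim contains no two consecutive clique vertices.\<close>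

lemma not_contains_wheel_extremal_graph:
  assumes n: "8 \<le> n" "even n"
  shows "\<not> contains (complement (extremal_graph n)) (wheel 8)"
proof
  have wg: "is_graph (wheel 8)" by (rule is_graph_wheel) simp
  assume "contains (complement (extremal_graph n)) (wheel 8)"
  then obtain f where f': "inj_on f (verts (wheel 8))"
    and fe: "\<forall>e\<in>edges (wheel 8). f ` e \<in> edges (complement (extremal_graph n))"
    by (rule containsE[OF _ wg])
  have f: "inj_on f {..<9}" using f' unfolding wheel_8(1) .
  have nadj: "\<not> extremal_adj n (f i) (f j) \<and> f i \<noteq> f j" if "{i, j} \<in> edges (wheel 8)" for i j
    using bspec[OF fe that] edges_complement_extremal_graph[of "f i" "f j" n] by simp
  have rim: "\<not> extremal_adj n (f 0) (f 1)" "\<not> extremal_adj n (f 1) (f 2)" "\<not> extremal_adj n (f 2) (f 3)" "\<not> extremal_adj n (f 3) (f 4)"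
    "\<not> extremal_adj n (f 4) (f 5)" "\<not> extremal_adj n (f 5) (f 6)" "\<not> extremal_adj n (f 6) (f 7)"
    using nadj by (simp_all add: wheel_8(2))
  have hub: "\<not> extremal_adj n (f 8) (f i)" if "i < 8" for i
  proof -
    have "{8, i} \<in> edges (wheel 8)" using that by (auto simp: wheel_def cycle_graph_def)
    then show ?thesis using nadj by blast
  qed
  have inj: "f i \<noteq> f j" if "i < 9" "j < 9" "i \<noteq> j" for i j using f that by (auto dest: inj_onD)
  show False
  proof (cases "n \<le> f 8")
    case True
    have small: "f i < n" if "i < 8" for i
      using hub[OF that] inj[of 8 i] that True by (auto simp: extremal_adj_def)
    have blk: "block n (f i) = block n (f j)" if "\<not> extremal_adj n (f i) (f j)" "i < 8" "j < 8" for i j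
      using that small by (auto simp: extremal_adj_def cubic_adj_def)
    have eq: "block n (f 0) = block n (f 1)" "block n (f 1) = block n (f 2)" "block n (f 2) = block n (f 3)"
      "block n (f 3) = block n (f 4)" "block n (f 4) = block n (f 5)" "block n (f 5) = block n (f 6)"
      "block n (f 6) = block n (f 7)"
      by (rule blk, rule rim, simp, simp)+
    have block0: "block n (f i) = block n (f 0)" if "i < 8" for i
    proof -
      have "i \<in> {0,1,2,3,4,5,6,7}" using that by auto
      then show ?thesis by (elim insertE emptyE) (simp_all only: eq)
    qed
    have "f ` {..<8} \<subseteq> {y. y < n \<and> block n y = block n (f 0)}"
      using small block0 by blast
    then have "card (f ` {..<8}) \<le> card {y. y < n \<and> block n y = block n (f 0)}"
      by (rule card_mono[rotated]) simp
    also have "\<dots> \<le> 6" by (rule card_block[OF n(2,1)]) (rule small, simp)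
    finally have "card (f ` {..<8}) \<le> 6" .
    moreover have "card (f ` {..<8}) = 8" by (subst card_image) (auto intro: inj_on_subset[OF f])
    ultimately show False by simp
  next
    case False
    have cubic_adj: "cubic_adj n (f 8) (f i)" if "i < 8" "f i < n" for i
      using hub[OF that(1)] inj[of 8 i] that False by (auto simp: extremal_adj_def)
    \<comment> \<open>Each of four disjoint rim edges has an end below \<open>n\<close>, which makes
      four neighbours of the hub in a cubic graph.\<close>
    have "\<exists>i\<in>{0,1}. f i < n" using rim(1) inj[of 0 1] by (auto simp: extremal_adj_def)
    then obtain i where i: "i \<in> {0,1}" "f i < n" by blast
    have "\<exists>j\<in>{2,3}. f j < n" using rim(3) inj[of 2 3] by (auto simp: extremal_adj_def)
    then obtain j where j: "j \<in> {2,3}" "f j < n" by blast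
    have "\<exists>k\<in>{4,5}. f k < n" using rim(5) inj[of 4 5] by (auto simp: extremal_adj_def)
    then obtain k where k: "k \<in> {4,5}" "f k < n" by blast
    have "\<exists>l\<in>{6,7}. f l < n" using rim(7) inj[of 6 7] by (auto simp: extremal_adj_def)
    then obtain l where l: "l \<in> {6,7}" "f l < n" by blast
    have lt: "i < 8" "j < 8" "k < 8" "l < 8" using i j k l by auto
    have "distinct [i, j, k, l]" using i j k l by auto
    then have "card {i, j, k, l} = 4" by simp
    moreover have "inj_on f {i, j, k, l}" by (rule inj_on_subset[OF f]) (use lt in auto)
    ultimately have "card (f ` {i, j, k, l}) = 4" by (simp only: card_image)
    moreover have "f ` {i, j, k, l} \<subseteq> {y. y < n \<and> cubic_adj n (f 8) y}" using cubic_adj lt i(2) j(2) k(2) l(2) by blast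
    then have "card (f ` {i, j, k, l}) \<le> card {y. y < n \<and> cubic_adj n (f 8) y}" by (intro card_mono) auto
    ultimately show False using card_cubic_adj[OF n(2,1), of "f 8"] False by simp
  qed
qed

lemma ramsey_number_eq_2n:
  assumes n: "8 \<le> n" "even n" and ar: "arrows (2 * n) T (wheel 8)" and no: "\<not> contains (extremal_graph n) T"
  shows "ramsey_number T (wheel 8) = 2 * n"
  unfolding ramsey_number_def
proof (rule Least_equality)
  show "0 < 2 * n \<and> arrows (2 * n) T (wheel 8)" using ar n by simp
  fix N assume N: "0 < N \<and> arrows N T (wheel 8)"
  show "2 * n \<le> N"
  proof (rule ccontr)
    assume "\<not> 2 * n \<le> N"
    then have "arrows (2 * n - 1) T (wheel 8)" by (intro arrows_mono[OF conjunct2[OF N]]) simp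
    moreover have "card (verts (extremal_graph n)) = 2 * n - 1" by (simp add: extremal_graph_def)
    ultimately show False
      using no not_contains_wheel_extremal_graph[OF n] is_graph_extremal_graph unfolding arrows_def by blast
  qed
qed

lemma not_contains_S_sub_1_2:
  assumes n: "8 \<le> n" "even n"
  shows "\<not> contains (extremal_graph n) (S_sub n 1 2)"
proof (rule not_contains_tree_extremal_graph[OF n])
  have E: "edges (S_sub n 1 2) = {{0, x} | x. x \<in> {2..<n - 2}} \<union> {{0, n - 2}, {n - 2, n - 1}, {n - 1, 1}}"
    using edges_S_sub_1_2[of n] n by simp
  show "is_graph (S_sub n 1 2)" "card (verts (S_sub n 1 2)) = n"
    using is_graph_S_sub[of 1 2 n] n by auto
  show "0 \<in> verts (S_sub n 1 2)" using verts_trees(1)[of n] n by simp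
  have "{2..<n - 1} \<subseteq> {x. {0, x} \<in> edges (S_sub n 1 2)}"
  proof
    fix x assume "x \<in> {2..<n - 1}"
    then have "x \<in> {2..<n - 2} \<or> x = n - 2" by auto
    then show "x \<in> {x. {0, x} \<in> edges (S_sub n 1 2)}" unfolding E by blast
  qed
  then have "card {2..<n - 1} \<le> card {x. {0, x} \<in> edges (S_sub n 1 2)}"
    by (rule card_mono[rotated]) (rule finite_subset[of _ "verts (S_sub n 1 2)"],
      use edge_verts[of "S_sub n 1 2"] is_graph_S_sub(1)[of 1 2 n] verts_trees(1)[of n] n in auto)
  then show "n - 3 \<le> card {x. {0, x} \<in> edges (S_sub n 1 2)}" by simp
  fix S assume S: "0 \<in> S" "\<And>x y. {x, y} \<in> edges (S_sub n 1 2) \<Longrightarrow> x \<in> S \<Longrightarrow> y \<in> S"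
  have leaf: "x \<in> S" if "x \<in> {2..<n - 2}" for x using S(2)[of 0 x] S(1) that unfolding E by blast
  have a: "n - 2 \<in> S" using S(2)[of 0 "n - 2"] S(1) unfolding E by blast
  have b: "n - 1 \<in> S" using S(2)[of "n - 2" "n - 1"] a unfolding E by blast
  have c: "1 \<in> S" using S(2)[of "n - 1" 1] b unfolding E by blast
  show "verts (S_sub n 1 2) \<subseteq> S"
  proof
    fix x assume "x \<in> verts (S_sub n 1 2)"
    then have "x < n" using verts_trees(1)[of n] n by simp
    then have "x = 0 \<or> x = 1 \<or> x \<in> {2..<n - 2} \<or> x = n - 2 \<or> x = n - 1"
      unfolding atLeastLessThan_iff by presburger
    then show "x \<in> S" using leaf a b c S(1) by blast
  qed
qed

lemma not_contains_S_sub_2_1: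
  assumes n: "8 \<le> n" "even n"
  shows "\<not> contains (extremal_graph n) (S_sub n 2 1)"
proof (rule not_contains_tree_extremal_graph[OF n])
  have E: "edges (S_sub n 2 1) = {{0, x} | x. x \<in> {3..<n - 2}} \<union> {{0, n - 2}, {n - 2, 1}, {0, n - 1}, {n - 1, 2}}"
    using edges_S_sub_2_1[of n] n by simp
  show "is_graph (S_sub n 2 1)" "card (verts (S_sub n 2 1)) = n"
    using is_graph_S_sub[of 2 1 n] n by auto
  show "0 \<in> verts (S_sub n 2 1)" using verts_trees(2)[of n] n by simp
  have "{3..<n} \<subseteq> {x. {0, x} \<in> edges (S_sub n 2 1)}"
  proof
    fix x assume "x \<in> {3..<n}"
    then have "x \<in> {3..<n - 2} \<or> x = n - 2 \<or> x = n - 1" by auto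
    then show "x \<in> {x. {0, x} \<in> edges (S_sub n 2 1)}" unfolding E by blast
  qed
  then have "card {3..<n} \<le> card {x. {0, x} \<in> edges (S_sub n 2 1)}"
    by (rule card_mono[rotated]) (rule finite_subset[of _ "verts (S_sub n 2 1)"],
      use edge_verts[of "S_sub n 2 1"] is_graph_S_sub(1)[of 2 1 n] verts_trees(2)[of n] n in auto)
  then show "n - 3 \<le> card {x. {0, x} \<in> edges (S_sub n 2 1)}" by simp
  fix S assume S: "0 \<in> S" "\<And>x y. {x, y} \<in> edges (S_sub n 2 1) \<Longrightarrow> x \<in> S \<Longrightarrow> y \<in> S"
  have leaf: "x \<in> S" if "x \<in> {3..<n - 2}" for x using S(2)[of 0 x] S(1) that unfolding E by blast
  have a: "n - 2 \<in> S" "n - 1 \<in> S" using S(2)[of 0 "n - 2"] S(2)[of 0 "n - 1"] S(1) unfolding E by blast+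
  have b: "1 \<in> S" using S(2)[of "n - 2" 1] a unfolding E by blast
  have c: "2 \<in> S" using S(2)[of "n - 1" 2] a unfolding E by blast
  show "verts (S_sub n 2 1) \<subseteq> S"
  proof
    fix x assume "x \<in> verts (S_sub n 2 1)"
    then have "x < n" using verts_trees(2)[of n] n by simp
    then have "x = 0 \<or> x = 1 \<or> x = 2 \<or> x \<in> {3..<n - 2} \<or> x = n - 2 \<or> x = n - 1"
      unfolding atLeastLessThan_iff by presburger
    then show "x \<in> S" using leaf a b c S(1) by blast
  qed
qed

lemma not_contains_S_join_3:
  assumes n: "8 \<le> n" "even n"
  shows "\<not> contains (extremal_graph n) (S_join n 3)"
proof (rule not_contains_tree_extremal_graph[OF n])
  have E: "edges (S_join n 3) = {{0, x} | x. x \<in> {1..<n - 3}} \<union> {{0, n - 3}, {n - 3, n - 2}, {n - 3, n - 1}}"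
    using edges_S_join_3[of n] n by simp
  show "is_graph (S_join n 3)" "card (verts (S_join n 3)) = n"
    using is_graph_S_join[of 3 n] n by auto
  show "0 \<in> verts (S_join n 3)" using verts_trees(3)[of n] n by simp
  have "{1..<n - 2} \<subseteq> {x. {0, x} \<in> edges (S_join n 3)}"
  proof
    fix x assume "x \<in> {1..<n - 2}"
    then have "x \<in> {1..<n - 3} \<or> x = n - 3" by auto
    then show "x \<in> {x. {0, x} \<in> edges (S_join n 3)}" unfolding E by blast
  qed
  then have "card {1..<n - 2} \<le> card {x. {0, x} \<in> edges (S_join n 3)}"
    by (rule card_mono[rotated]) (rule finite_subset[of _ "verts (S_join n 3)"],
      use edge_verts[of "S_join n 3"] is_graph_S_join(1)[of 3 n] verts_trees(3)[of n] n in auto)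
  then show "n - 3 \<le> card {x. {0, x} \<in> edges (S_join n 3)}" by simp
  fix S assume S: "0 \<in> S" "\<And>x y. {x, y} \<in> edges (S_join n 3) \<Longrightarrow> x \<in> S \<Longrightarrow> y \<in> S"
  have leaf: "x \<in> S" if "x \<in> {1..<n - 3}" for x using S(2)[of 0 x] S(1) that unfolding E by blast
  have a: "n - 3 \<in> S" using S(2)[of 0 "n - 3"] S(1) unfolding E by blast
  have b: "n - 2 \<in> S" "n - 1 \<in> S"
    using S(2)[of "n - 3" "n - 2"] S(2)[of "n - 3" "n - 1"] a unfolding E by blast+
  show "verts (S_join n 3) \<subseteq> S"
  proof
    fix x assume "x \<in> verts (S_join n 3)"
    then have "x < n" using verts_trees(3)[of n] n by simp
    then have "x = 0 \<or> x \<in> {1..<n - 3} \<or> x = n - 3 \<or> x = n - 2 \<or> x = n - 1"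
      unfolding atLeastLessThan_iff by presburger
    then show "x \<in> S" using leaf a b S(1) by blast
  qed
qed

theorem theorem9:
  fixes n :: nat
  assumes "even n" and "n \<ge> 8"
  shows "ramsey_number (S_sub n 1 2) (wheel 8) = 2 * n
       \<and> ramsey_number (S_sub n 2 1) (wheel 8) = 2 * n
       \<and> ramsey_number (S_join n 3) (wheel 8) = 2 * n"
  using ramsey_number_eq_2n[OF assms(2,1)] arrows_2n[OF assms(2,1)] not_contains_S_sub_1_2[OF assms(2,1)]
    not_contains_S_sub_2_1[OF assms(2,1)] not_contains_S_join_3[OF assms(2,1)] by blast

end
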